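(* In the mixture Cramér–Lundberg model described in the context, for each fixed $n\in\mathbb{N}$, the variance of the control variate estimator $\hat\varphi^{n}_\kappa(u)$ behaves asymptotically as $$\mathrm{Var}\big(\hat\varphi^{n}_\kappa(u)\big)\sim\left(\frac{\epsilon\theta}{1-\rho^\bullet}\right)^{n+3}\frac{1+n\left(\frac{1-\rho}{1-\rho^\bullet}\right)}{\frac{1-\rho}{1-\rho^\bullet}}\cdot\frac{\overline{F_h^e}(u)}{\kappa}\qquad\text{as }u\to\infty,$$ and satisfies $$\frac{\mathrm{Var}\big(\hat\varphi^{n}_\kappa(u)\big)}{\mathrm{Var}\big(\hat z_\kappa(u)\big)}\to\left(\frac{\epsilon\theta}{1-\rho^\bullet}\right)^{n-1}\frac{1+n\left(\frac{1-\rho}{1-\rho^\bullet}\right)}{1+\frac{1-\rho}{1-\rho^\bullet}}\qquad\text{as }u\to\infty.$$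
   Context: Write $\overline F=1-F$ for tails; $f(u)\sim g(u)$ means $f(u)/g(u)\to1$. A distribution function $F$ on $[0,\infty)$ is subexponential if $\overline{F^{*n}}(u)\sim n\overline F(u)$ as $u\to\infty$ for every $n\in\mathbb{N}$ ($F^{*n}$ is the $n$-fold convolution). A phase-type distribution is the law of the absorption time of a finite-state Markov jump process with all states but one transient and the remaining one absorbing. Model. Claims arrive according to a homogeneous Poisson process with rate $\lambda$, the premium rate is $1$, the initial capital is $u$, and claim sizes are i.i.d., independent of the arrivals, with distribution function $G=(1-\epsilon)F_p+\epsilon F_h$, where $\epsilon\in(0,1)$, $F_p$ is the phase-type distribution function of a random variable $B$ with finite mean $\mu_B$, and $F_h$ is the subexponential distribution function of a random variable $C$ with finite mean $\mu_C$. Put $\delta=\lambda\mu_B$, $\theta=\lambda\mu_C$, $\rho^\bullet=(1-\epsilon)\delta$, $\rho=\rho^\bullet+\epsilon\theta$, and assume the safety loading condition $\rho<1$. Stationary excess distributions: $F_p^e(u)=\frac1{\mu_B}\int_0^u(1-F_p(x))\,dx$ and $F_h^e(u)=\frac1{\mu_C}\int_0^u(1-F_h(x))\,dx$. Let $C^e_1,C^e_2,\dots$ be i.i.d. with distribution function $F_h^e$; it is assumed that $F_h^e$ is subexponential. Let $M^\bullet$ be the supremum of the claim surplus process (aggregate claims minus premiums) of the compound Poisson risk model with premium rate $1$, arrival rate $(1-\epsilon)\lambda$ and claim size distribution $F_p$; equivalently $\mathbb{P}(M^\bullet\le u)=(1-\rho^\bullet)\sum_{k=0}^\infty(\rho^\bullet)^k(F_p^e)^{*k}(u)$.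 Let $M^\bullet_0,M^\bullet_1,\dots$ be i.i.d. copies of $M^\bullet$. Let $N$ be geometric with $\mathbb{P}(N=k)=\frac{1-\rho}{1-\rho^\bullet}\left(\frac{\epsilon\theta}{1-\rho^\bullet}\right)^k$, $k=0,1,2,\dots$ (note $\frac{1-\rho}{1-\rho^\bullet}=1-\frac{\epsilon\theta}{1-\rho^\bullet}$). The families $(M^\bullet_k)$, $(C^e_k)$ and $N$ are independent. Define $$V=M^\bullet_0+M^\bullet_1+C^e_1+\sum_{k=2}^{N+2}(M^\bullet_k+C^e_k),\qquad V_n=\max\{C^e_1,\dots,C^e_{N+2}\}\,\mathbf 1_{\{N+2\le n\}},$$ $$Z(u)=\left(\frac{\epsilon\theta}{1-\rho^\bullet}\right)^2\mathbf 1_{\{V>u\}},\qquad W_n(u)=\left(\frac{\epsilon\theta}{1-\rho^\bullet}\right)^2\mathbf 1_{\{V_n>u\}},$$ $$\varphi_n(u)=\mathbb{E}\,W_n(u)=\frac{1-\rho}{1-\rho^\bullet}\sum_{k=2}^n\left(\frac{\epsilon\theta}{1-\rho^\bullet}\right)^k\mathbb{P}\big(\max\{C^e_1,\dots,C^e_k\}>u\big).$$ Let $(V^{(i)},V_n^{(i)})$, $i=1,\dots,\kappa$, be i.i.d. copies of the pair $(V,V_n)$, where $\kappa$ is the number of simulations, and let $(Z^{(i)}(u),W^{(i)}(u))$ be the corresponding copies of $(Z(u),W_n(u))$. Put $$\hat z_\kappa(u)=\frac1\kappa\sum_{i=1}^\kappa Z^{(i)}(u),\quad \hat w_\kappa(u)=\frac1\kappa\sum_{i=1}^\kappa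 W^{(i)}(u),\quad \hat\alpha_\kappa=-\frac{\sum_{i=1}^\kappa\big(Z^{(i)}(u)-\hat z_\kappa(u)\big)\big(W^{(i)}(u)-\hat w_\kappa(u)\big)}{\sum_{i=1}^\kappa\big(W^{(i)}(u)-\hat w_\kappa(u)\big)^2},$$ and define the estimator $$\hat\varphi^{n}_\kappa(u)=\hat z_\kappa(u)+\hat\alpha_\kappa\big(\hat w_\kappa(u)-\varphi_n(u)\big).$$ *)

theory Defs
  imports "HOL-Probability.Probability"
begin

text \<open>
  Distributions on the line are represented by probability measures on the Borel sets of the
  reals; the distribution function of \<open>F\<close> is \<^term>\<open>cdf F\<close>.
\<close>

definition tail :: "real measure \<Rightarrow> real \<Rightarrow> real" where
  "tail F u = 1 - cdf F u"

definition mean :: "real measure \<Rightarrow> real" where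
  "mean F = (\<integral>x. x \<partial>F)"

text \<open>
  The library relation \<open>f \<sim>[at_top] g\<close> reads 0/0 as 1. Here 0/0 is 0, as in HOL, so that
  \<open>g\<close> must eventually be nonzero; in particular, a subexponential tail below never vanishes.
\<close>

definition ratio_equiv :: "(real \<Rightarrow> real) \<Rightarrow> (real \<Rightarrow> real) \<Rightarrow> bool" where
  "ratio_equiv f g \<longleftrightarrow> ((\<lambda>u. f u / g u) \<longlongrightarrow> 1) at_top"

primrec conv_power :: "nat \<Rightarrow> real measure \<Rightarrow> real measure" where
  "conv_power 0 F = return borel 0"
| "conv_power (Suc n) F = (F \<star> conv_power n F)"

definition subexponential :: "real measure \<Rightarrow> bool" where
  "subexponential F \<longleftrightarrow> real_distribution F \<and> measure F {..<0} = 0 \<and>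
     (\<forall>n\<ge>1. ratio_equiv (tail (conv_power n F)) (\<lambda>u. real n * tail F u))"

definition stationary_excess :: "real measure \<Rightarrow> real measure" where
  "stationary_excess F =
     density lborel (\<lambda>x. ennreal (indicator {0..} x * ((1 - cdf F x) / mean F)))"

text \<open>
  A time-homogeneous Markov jump process with finite state space \<open>S\<close> is given by its laws \<open>P i\<close>
  for the initial states \<open>i\<close> in \<open>S\<close>; the transition probabilities are \<open>P i (X t = j)\<close>. The two
  path conditions say that paths are right-continuous with left limits for the discrete
  topology, that is, piecewise constant with finitely many jumps in bounded time.
\<close>

definition markov_jump_process ::
    "'s set \<Rightarrow> ('s \<Rightarrow> 'p measure) \<Rightarrow> (real \<Rightarrow> 'p \<Rightarrow> 's) \<Rightarrow> bool" where
  "markov_jump_process S P X \<longleftrightarrow> finite S \<and>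
     (\<forall>i\<in>S. prob_space (P i) \<and>
       (\<forall>t\<ge>0. X t \<in> measurable (P i) (count_space S)) \<and>
       (AE \<omega> in P i. X 0 \<omega> = i) \<and>
       (\<forall>\<omega>\<in>space (P i). \<forall>t\<ge>0. \<forall>\<^sub>F s in at_right t. X s \<omega> = X t \<omega>) \<and>
       (\<forall>\<omega>\<in>space (P i). \<forall>t>0. \<exists>j. \<forall>\<^sub>F s in at_left t. X s \<omega> = j) \<and>
       (\<forall>n t j. 0 \<le> t 0 \<and> (\<forall>k\<le>n. t k < t (Suc k)) \<and> (\<forall>k\<le>Suc n. j k \<in> S) \<longrightarrow>
          measure (P i) {\<omega>\<in>space (P i). \<forall>k\<le>Suc n. X (t k) \<omega> = j k} =
          measure (P i) {\<omega>\<in>space (P i). \<forall>k\<le>n. X (t k) \<omega> = j k} *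
          measure (P (j n)) {\<omega>\<in>space (P (j n)). X (t (Suc n) - t n) \<omega> = j (Suc n)}))"

definition absorbing :: "('s \<Rightarrow> 'p measure) \<Rightarrow> (real \<Rightarrow> 'p \<Rightarrow> 's) \<Rightarrow> 's \<Rightarrow> bool" where
  "absorbing P X i \<longleftrightarrow> (\<forall>t\<ge>0. AE \<omega> in P i. X t \<omega> = i)"

definition transient :: "('s \<Rightarrow> 'p measure) \<Rightarrow> (real \<Rightarrow> 'p \<Rightarrow> 's) \<Rightarrow> 's \<Rightarrow> bool" where
  "transient P X i \<longleftrightarrow> (AE \<omega> in P i. bdd_above {t. 0 \<le> t \<and> X t \<omega> = i})"

definition absorption_time :: "(real \<Rightarrow> 'p \<Rightarrow> 's) \<Rightarrow> 's \<Rightarrow> 'p \<Rightarrow> real" where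
  "absorption_time X \<Delta> \<omega> = Inf {t. 0 \<le> t \<and> X t \<omega> = \<Delta>}"

text \<open>
  \<open>F\<close> is the law of the time to absorption in \<open>\<Delta>\<close> of the process with initial distribution
  \<open>\<alpha>\<close>. Absorption occurs almost surely, so that the value of the infimum of the empty set plays
  no role.
\<close>

definition phase_type ::
    "'s set \<Rightarrow> 's \<Rightarrow> ('s \<Rightarrow> real) \<Rightarrow> ('s \<Rightarrow> 'p measure) \<Rightarrow> (real \<Rightarrow> 'p \<Rightarrow> 's) \<Rightarrow> real measure \<Rightarrow> bool"
  where
  "phase_type S \<Delta> \<alpha> P X F \<longleftrightarrow>
     markov_jump_process S P X \<and>
     \<Delta> \<in> S \<and> absorbing P X \<Delta> \<and> (\<forall>i\<in>S - {\<Delta>}. transient P X i) \<and>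
     (\<forall>i\<in>S. 0 \<le> \<alpha> i) \<and> (\<Sum>i\<in>S. \<alpha> i) = 1 \<and>
     real_distribution F \<and>
     (\<forall>x. cdf F x =
        (\<Sum>i\<in>S. \<alpha> i * measure (P i) {\<omega>\<in>space (P i). absorption_time X \<Delta> \<omega> \<le> x}))"

text \<open>
  \<open>T i\<close> are the interarrival times and \<open>Y i\<close> the claim sizes. The premium rate is 1.
\<close>

definition compound_poisson_model ::
    "'q measure \<Rightarrow> real \<Rightarrow> real measure \<Rightarrow> (nat \<Rightarrow> 'q \<Rightarrow> real) \<Rightarrow> (nat \<Rightarrow> 'q \<Rightarrow> real) \<Rightarrow> bool" where
  "compound_poisson_model Q \<beta> F T Y \<longleftrightarrow>
     prob_space Q \<and>
     prob_space.indep_vars Q (\<lambda>_. borel) (case_sum T Y) UNIV \<and>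
     (\<forall>i. distributed Q lborel (T i) (exponential_density \<beta>)) \<and>
     (\<forall>i. distr Q borel (Y i) = F)"

definition claim_count :: "(nat \<Rightarrow> 'q \<Rightarrow> real) \<Rightarrow> real \<Rightarrow> 'q \<Rightarrow> nat" where
  "claim_count T t \<omega> = card {n. (\<Sum>i\<le>n. T i \<omega>) \<le> t}"

definition claim_surplus ::
    "(nat \<Rightarrow> 'q \<Rightarrow> real) \<Rightarrow> (nat \<Rightarrow> 'q \<Rightarrow> real) \<Rightarrow> real \<Rightarrow> 'q \<Rightarrow> real" where
  "claim_surplus T Y t \<omega> = (\<Sum>i<claim_count T t \<omega>. Y i \<omega>) - t"

definition surplus_supremum ::
    "'q measure \<Rightarrow> (nat \<Rightarrow> 'q \<Rightarrow> real) \<Rightarrow> (nat \<Rightarrow> 'q \<Rightarrow> real) \<Rightarrow> ('q \<Rightarrow> real) \<Rightarrow> bool" where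
  "surplus_supremum Q T Y R \<longleftrightarrow> R \<in> borel_measurable Q \<and>
     (AE \<omega> in Q. ereal (R \<omega>) = (SUP t\<in>{0..}. ereal (claim_surplus T Y t \<omega>)))"

text \<open>
  One index type for the families \<open>(M k)\<close> for \<open>k \<ge> 0\<close>, \<open>(C k)\<close> for \<open>k \<ge> 1\<close> and the variable
  \<open>N\<close>, which are jointly independent. \<open>N\<close> enters through its injective image in the reals.
\<close>

datatype input_index = Base nat | Excess nat | Count

primrec input_var ::
    "(nat \<Rightarrow> 'a \<Rightarrow> real) \<Rightarrow> (nat \<Rightarrow> 'a \<Rightarrow> real) \<Rightarrow> ('a \<Rightarrow> nat) \<Rightarrow> input_index \<Rightarrow> 'a \<Rightarrow> real" where
  "input_var M C N (Base k) = M k"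
| "input_var M C N (Excess k) = C k"
| "input_var M C N Count = (\<lambda>\<omega>. real (N \<omega>))"

definition simulation_input ::
    "'a measure \<Rightarrow> real measure \<Rightarrow> real measure \<Rightarrow> real
      \<Rightarrow> (nat \<Rightarrow> 'a \<Rightarrow> real) \<Rightarrow> (nat \<Rightarrow> 'a \<Rightarrow> real) \<Rightarrow> ('a \<Rightarrow> nat) \<Rightarrow> bool" where
  "simulation_input \<Omega> FM FC a M C N \<longleftrightarrow>
     prob_space \<Omega> \<and>
     prob_space.indep_vars \<Omega> (\<lambda>_. borel) (input_var M C N)
       (range Base \<union> Excess ` {1..} \<union> {Count}) \<and>
     (\<forall>k. distr \<Omega> borel (M k) = FM) \<and>
     (\<forall>k\<ge>1. distr \<Omega> borel (C k) = FC) \<and>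
     (\<forall>k. measure \<Omega> {\<omega>\<in>space \<Omega>. N \<omega> = k} = (1 - a) * a ^ k)"

definition V_var ::
    "(nat \<Rightarrow> 'a \<Rightarrow> real) \<Rightarrow> (nat \<Rightarrow> 'a \<Rightarrow> real) \<Rightarrow> ('a \<Rightarrow> nat) \<Rightarrow> 'a \<Rightarrow> real" where
  "V_var M C N \<omega> = M 0 \<omega> + M 1 \<omega> + C 1 \<omega> + (\<Sum>k=2..N \<omega> + 2. M k \<omega> + C k \<omega>)"

definition Vn_var :: "nat \<Rightarrow> (nat \<Rightarrow> 'a \<Rightarrow> real) \<Rightarrow> ('a \<Rightarrow> nat) \<Rightarrow> 'a \<Rightarrow> real" where
  "Vn_var n C N \<omega> = Max ((\<lambda>k. C k \<omega>) ` {1..N \<omega> + 2}) * (if N \<omega> + 2 \<le> n then 1 else 0)"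

definition scaled_exceedance :: "real \<Rightarrow> real \<Rightarrow> real \<Rightarrow> real" where
  "scaled_exceedance a u v = a\<^sup>2 * indicator {u<..} v"

definition phi_n :: "'a measure \<Rightarrow> real \<Rightarrow> ('a \<Rightarrow> real) \<Rightarrow> real \<Rightarrow> real" where
  "phi_n \<Omega> a Vn u = (\<integral>\<omega>. scaled_exceedance a u (Vn \<omega>) \<partial>\<Omega>)"

text \<open>
  The pairs \<open>(V' i, Vn' i)\<close> for \<open>1 \<le> i \<le> \<kappa>\<close> are independent copies of \<open>(V, Vn)\<close>.
\<close>

definition iid_copies ::
    "'a measure \<Rightarrow> ('a \<Rightarrow> real) \<Rightarrow> ('a \<Rightarrow> real) \<Rightarrow>
     'b measure \<Rightarrow> nat \<Rightarrow> (nat \<Rightarrow> 'b \<Rightarrow> real) \<Rightarrow> (nat \<Rightarrow> 'b \<Rightarrow> real) \<Rightarrow> bool" where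
  "iid_copies \<Omega> V Vn \<Omega>' \<kappa> V' Vn' \<longleftrightarrow>
     prob_space \<Omega>' \<and>
     prob_space.indep_vars \<Omega>' (\<lambda>_. borel \<Otimes>\<^sub>M borel) (\<lambda>i \<omega>. (V' i \<omega>, Vn' i \<omega>)) {1..\<kappa>} \<and>
     (\<forall>i\<in>{1..\<kappa>}. distr \<Omega>' (borel \<Otimes>\<^sub>M borel) (\<lambda>\<omega>. (V' i \<omega>, Vn' i \<omega>)) =
                 distr \<Omega> (borel \<Otimes>\<^sub>M borel) (\<lambda>\<omega>. (V \<omega>, Vn \<omega>)))"

definition sample_mean :: "nat \<Rightarrow> (nat \<Rightarrow> real) \<Rightarrow> real" where
  "sample_mean \<kappa> x = (\<Sum>i=1..\<kappa>. x i) / real \<kappa>"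

text \<open>
  If all \<open>w i\<close> coincide, the quotient is 0/0, which is 0 in HOL: without variation in the control
  variate no correction is made.
\<close>

definition cv_coefficient :: "nat \<Rightarrow> (nat \<Rightarrow> real) \<Rightarrow> (nat \<Rightarrow> real) \<Rightarrow> real" where
  "cv_coefficient \<kappa> z w =
     - ((\<Sum>i=1..\<kappa>. (z i - sample_mean \<kappa> z) * (w i - sample_mean \<kappa> w)) /
        (\<Sum>i=1..\<kappa>. (w i - sample_mean \<kappa> w)\<^sup>2))"

definition cv_estimator :: "nat \<Rightarrow> (nat \<Rightarrow> real) \<Rightarrow> (nat \<Rightarrow> real) \<Rightarrow> real \<Rightarrow> real" where
  "cv_estimator \<kappa> z w m = sample_mean \<kappa> z + cv_coefficient \<kappa> z w * (sample_mean \<kappa> w - m)"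

definition z_hat :: "nat \<Rightarrow> real \<Rightarrow> (nat \<Rightarrow> 'b \<Rightarrow> real) \<Rightarrow> real \<Rightarrow> 'b \<Rightarrow> real" where
  "z_hat \<kappa> a V' u \<omega> = sample_mean \<kappa> (\<lambda>i. scaled_exceedance a u (V' i \<omega>))"

definition phi_hat ::
    "nat \<Rightarrow> real \<Rightarrow> (real \<Rightarrow> real) \<Rightarrow> (nat \<Rightarrow> 'b \<Rightarrow> real) \<Rightarrow> (nat \<Rightarrow> 'b \<Rightarrow> real) \<Rightarrow> real \<Rightarrow> 'b \<Rightarrow> real"
  where
  "phi_hat \<kappa> a \<phi> V' Vn' u \<omega> =
     cv_estimator \<kappa> (\<lambda>i. scaled_exceedance a u (V' i \<omega>))
       (\<lambda>i. scaled_exceedance a u (Vn' i \<omega>)) (\<phi> u)"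

end

theory Submission
  imports Defs
begin

text \<open>
  Write \<open>q\<close> and \<open>p\<close> for the probabilities of \<open>V > u\<close> and \<open>Vn > u\<close>. The second event implies the
  first. Up to an event of probability \<open>O(q\<^sup>2)\<close> at most one of the \<open>\<kappa>\<close> samples of \<open>V\<close> exceeds \<open>u\<close>:
  if none does, the estimator is 0; if one does while its control does not, it is \<open>a\<^sup>2 / \<kappa>\<close>; if both
  do, the fitted coefficient is \<open>-1\<close> and the estimator collapses to \<open>a\<^sup>2 p\<close>. Hence its variance is
  \<open>(a\<^sup>2)\<^sup>2 (q - p) / \<kappa> + O(q\<^sup>2)\<close>, whereas crude Monte Carlo has \<open>(a\<^sup>2)\<^sup>2 q / \<kappa> + O(q\<^sup>2)\<close>.

  The base supremum has an exponential tail, since the phase-type law does and the random walk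
  embedded at claim times has negative drift; it is therefore negligible against the subexponential
  tail. Kesten's bound and dominated convergence for series give \<open>q\<close> and \<open>p\<close> as multiples of the
  tail of the excess law, the multiples being the means of \<open>N + 2\<close> and of \<open>N + 2\<close> restricted to
  \<open>N + 2 \<le> n\<close>.
\<close>

section \<open>Tails of convolutions\<close>

text \<open>The fitted coefficient is a quotient of random sums, so its moments are not computed.
  Discreteness replaces them: for fixed \<open>\<kappa>\<close> and \<open>a\<close> the coefficient
  depends only on which samples and which controls exceed \<open>u\<close>, hence takes finitely
  many values and is bounded uniformly in \<open>u\<close>. The collapse on a single joint
  exceedance rests on \<open>\<kappa> \<ge> 2\<close>, since a second sample with control 0 is what
  gives the controls a positive sample variance. The value left over there is itself of order
  \<open>q\<close>, so its contribution to the second moment is of higher order.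

  Termwise limits for a fixed number of summands would not suffice for \<open>V\<close>, because
  \<open>N\<close> is unbounded. Kesten's bound allows any growth rate \<open>1 + \<eta>\<close>
  above 1, and \<open>\<eta>\<close> is adapted to \<open>a\<close> so that
  \<open>a * (1 + \<eta>) < 1\<close>.

  The exponent \<open>n + 3\<close> is \<open>4 + (n - 1)\<close>: the 4 is the squared scale
  \<open>a\<^sup>2\<close> of the exceedances, and \<open>a ^ (n - 1)\<close> comes from the mean of
  \<open>N + 2\<close> restricted to \<open>N + 2 > n\<close>, which is what the difference
  \<open>q - p\<close> retains.\<close>

lemma tail_eq_measure: "real_distribution F \<Longrightarrow> tail F u = measure F {u<..}"
proof -
  assume "real_distribution F"
  then interpret F: real_distribution F .
  have "measure F (space F - {..u}) = 1 - measure F {..u}"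
    by (rule F.prob_compl) simp
  moreover have "space F - {..u} = {u<..}" by auto
  ultimately show ?thesis by (simp add: tail_def cdf_def)
qed

lemma tail_nonneg: "real_distribution F \<Longrightarrow> 0 \<le> tail F u"
  by (simp add: tail_eq_measure)

lemma tail_le_1: "real_distribution F \<Longrightarrow> tail F u \<le> 1"
  by (metis tail_eq_measure prob_space.prob_le_1 real_distribution.axioms(1))

lemma tail_antimono: "real_distribution F \<Longrightarrow> u \<le> v \<Longrightarrow> tail F v \<le> tail F u"
  unfolding tail_def
  by (meson diff_left_mono finite_borel_measure.cdf_nondecreasing
        real_distribution.finite_borel_measure_M)

lemma tail_tendsto_0: "real_distribution F \<Longrightarrow> (tail F \<longlongrightarrow> 0) at_top"
proof -
  assume F: "real_distribution F"
  have "((\<lambda>u. 1 - cdf F u) \<longlongrightarrow> 1 - 1) at_top"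
    by (intro tendsto_intros real_distribution.cdf_lim_at_top_prob F)
  then show ?thesis by (simp add: tail_def[abs_def])
qed

lemma borel_measurable_tail [measurable]: "real_distribution F \<Longrightarrow> tail F \<in> borel_measurable borel"
proof -
  assume F: "real_distribution F"
  have "(\<lambda>u. - tail F u) \<in> borel_measurable borel"
    using tail_antimono[OF F] by (intro borel_measurable_mono) (auto simp: mono_def)
  then show ?thesis by simp
qed

lemma sets_pair_real_distribution:
  "real_distribution F \<Longrightarrow> real_distribution G \<Longrightarrow> sets (F \<Otimes>\<^sub>M G) = sets (borel \<Otimes>\<^sub>M borel)"
  by (intro sets_pair_measure_cong) (auto simp: real_distribution.events_eq_borel)

lemma real_distribution_convolution:
  assumes F: "real_distribution F" and G: "real_distribution G"
  shows "real_distribution (F \<star> G)"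
proof -
  interpret F: real_distribution F by fact
  interpret G: real_distribution G by fact
  interpret FG: pair_prob_space F G ..
  note [measurable_cong] = sets_pair_real_distribution[OF F G]
  have "(\<lambda>(x, y). x + y) \<in> borel_measurable (F \<Otimes>\<^sub>M G)"
    by measurable
  then show ?thesis unfolding convolution_def by (rule FG.real_distribution_distr)
qed

lemma tail_convolution:
  assumes F: "real_distribution F" and G: "real_distribution G"
  shows "tail (F \<star> G) u = (\<integral>y. tail F (u - y) \<partial>G)"
proof -
  interpret F: real_distribution F by fact
  interpret G: real_distribution G by fact
  interpret GF: real_distribution "G \<star> F" by (rule real_distribution_convolution) fact+
  note [measurable] = borel_measurable_tail[OF F]
  have comm: "(F \<star> G) = (G \<star> F)"
    by (rule convolution_commutative) (auto intro: F.finite_measure G.finite_measure)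
  have "emeasure (G \<star> F) {u<..} = (\<integral>\<^sup>+x. emeasure F {a. a + x \<in> {u<..}} \<partial>G)"
    by (rule convolution_emeasure) (auto intro: F.finite_measure G.finite_measure)
  also have "\<dots> = (\<integral>\<^sup>+x. ennreal (tail F (u - x)) \<partial>G)"
  proof (rule nn_integral_cong)
    fix x
    have "{a. a + x \<in> {u<..}} = {u - x<..}" by auto
    then show "emeasure F {a. a + x \<in> {u<..}} = ennreal (tail F (u - x))"
      by (simp add: F.emeasure_eq_measure tail_eq_measure[OF F])
  qed
  also have "\<dots> = ennreal (\<integral>x. tail F (u - x) \<partial>G)"
    using tail_nonneg[OF F] tail_le_1[OF F]
    by (intro nn_integral_eq_integral G.integrable_const_bound[where B = 1]) auto
  finally have "measure (G \<star> F) {u<..} = (\<integral>x. tail F (u - x) \<partial>G)"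
    unfolding GF.emeasure_eq_measure
    by (simp add: integral_nonneg tail_nonneg[OF F])
  then show ?thesis
    using tail_eq_measure[of "G \<star> F"] GF.real_distribution_axioms by (simp add: comm)
qed

section \<open>Convolution of laws on the nonnegative half-line\<close>

definition nonneg_law :: "real measure \<Rightarrow> bool" where
  "nonneg_law F \<longleftrightarrow> real_distribution F \<and> (AE x in F. 0 \<le> x)"

lemma nonneg_lawD: "nonneg_law F \<Longrightarrow> real_distribution F" "nonneg_law F \<Longrightarrow> AE x in F. 0 \<le> x"
  by (auto simp: nonneg_law_def)

lemma nonneg_law_tail_neg:
  assumes "nonneg_law F" "u < 0" shows "tail F u = 1"
proof -
  interpret F: real_distribution F using assms by (simp add: nonneg_law_def)
  have "F.prob {u<..} = 1"
    using nonneg_lawD(2)[OF assms(1)] assms(2) by (subst F.prob_eq_1) (auto elim!: AE_mp)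
  then show ?thesis by (simp add: tail_eq_measure F.real_distribution_axioms)
qed

text \<open>Levels below 0 leave an atom at 0 possible; the bound at 0 itself is the countable
  intersection of the almost sure bounds at \<open>- 1 / real (Suc n)\<close>.\<close>

lemma nonneg_lawI_tail:
  assumes F: "real_distribution F" and "\<And>u. u < 0 \<Longrightarrow> tail F u = 1"
  shows "nonneg_law F"
proof -
  interpret F: real_distribution F by fact
  have "AE x in F. - 1 / real (Suc n) < x" for n
  proof -
    have "F.prob {- 1 / real (Suc n)<..} = 1"
      using assms(2)[of "- 1 / real (Suc n)"] by (simp add: tail_eq_measure[OF F])
    then show ?thesis by (subst (asm) F.prob_eq_1) auto
  qed
  then have "AE x in F. \<forall>n. - 1 / real (Suc n) < x" by (subst AE_all_countable) auto
  then have "AE x in F. 0 \<le> x"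
  proof (rule AE_mp, intro AE_I2 impI)
    fix x :: real assume *: "\<forall>n. - 1 / real (Suc n) < x"
    show "0 \<le> x"
    proof (rule ccontr)
      assume "\<not> 0 \<le> x"
      then obtain n where "1 / real (Suc n) < - x" using nat_approx_posE[of "-x"] by auto
      with *[rule_format, of n] show False by (auto simp: field_simps)
    qed
  qed
  with F show ?thesis by (simp add: nonneg_law_def)
qed

lemma nonneg_law_convolution:
  assumes F: "nonneg_law F" and G: "nonneg_law G"
  shows "nonneg_law (F \<star> G)"
proof (rule nonneg_lawI_tail)
  note rd = nonneg_lawD(1)[OF F] nonneg_lawD(1)[OF G]
  interpret G: real_distribution G by (rule rd)
  show "real_distribution (F \<star> G)" by (rule real_distribution_convolution) (rule rd)+
  fix u :: real assume "u < 0"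
  have "(\<integral>y. tail F (u - y) \<partial>G) = (\<integral>y. 1 \<partial>G)"
  proof (rule integral_cong_AE)
    note [measurable] = borel_measurable_tail[OF rd(1)]
    show "(\<lambda>y. tail F (u - y)) \<in> borel_measurable G" by measurable
    show "AE y in G. tail F (u - y) = 1"
      using nonneg_lawD(2)[OF G] by eventually_elim (use \<open>u < 0\<close> nonneg_law_tail_neg[OF F] in simp)
  qed simp
  then show "tail (F \<star> G) u = 1"
    using G.prob_space by (simp add: tail_convolution[OF rd])
qed

lemma integrable_indicator_real_distribution:
  assumes F: "real_distribution F" and A: "A \<in> sets borel"
  shows "integrable F (indicator A :: real \<Rightarrow> real)"
proof -
  interpret F: real_distribution F by fact
  show ?thesis using A by (intro F.integrable_const_bound[where B = 1]) auto
qed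

lemma measure_Ioi:
  "real_distribution F \<Longrightarrow> measure F {v<..} = tail F v"
  by (simp add: tail_eq_measure real_distribution.events_eq_borel)

lemma measure_Iic:
  "real_distribution F \<Longrightarrow> measure F {..v} = 1 - tail F v"
  by (simp add: tail_def cdf_def real_distribution.events_eq_borel)

lemma measure_Ioc:
  assumes F: "real_distribution F" and "v \<le> u"
  shows "measure F {v<..u} = tail F v - tail F u"
proof -
  interpret F: real_distribution F by fact
  have "measure F {v<..u} = cdf F u - cdf F v"
    using assms(2) F.cdf_diff_eq[of v u] by (cases "v = u") auto
  then show ?thesis by (simp add: tail_def)
qed

lemma integral_add3:
  fixes f g h :: "'a \<Rightarrow> real"
  assumes "integrable M f" "integrable M g" "integrable M h"
  shows "(\<integral>x. f x + g x + h x \<partial>M) = (\<integral>x. f x \<partial>M) + (\<integral>x. g x \<partial>M) + (\<integral>x. h x \<partial>M)"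
  using assms by simp

lemma integrable_tail_shift:
  assumes F: "real_distribution F" and G: "real_distribution G"
    and f: "f \<in> borel_measurable borel"
  shows "integrable G (\<lambda>y. tail F (f y))"
proof -
  interpret G: real_distribution G by fact
  note [measurable] = borel_measurable_tail[OF F] f
  show ?thesis using tail_nonneg[OF F] tail_le_1[OF F]
    by (intro G.integrable_const_bound[where B = 1]) auto
qed

text \<open>The left side is the probability that at least one of two independent summands exceeds
  \<open>u\<close>, and for nonnegative summands this forces the sum above \<open>u\<close>.\<close>

lemma tail_convolution_ge:
  assumes F: "nonneg_law F" and G: "nonneg_law G" and u: "0 \<le> u"
  shows "tail F u + tail G u - tail F u * tail G u \<le> tail (F \<star> G) u"
proof -
  note rd = nonneg_lawD(1)[OF F] nonneg_lawD(1)[OF G]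
  interpret G: real_distribution G by (rule rd)
  note [measurable] = borel_measurable_tail[OF rd(1)]
  have "(\<integral>y. indicator {u<..} y + tail F u * indicator {..u} y \<partial>G) \<le> (\<integral>y. tail F (u - y) \<partial>G)"
  proof (rule integral_mono_AE)
    show "AE y in G. indicator {u<..} y + tail F u * indicator {..u} y \<le> tail F (u - y)"
      using nonneg_lawD(2)[OF G]
      by eventually_elim
        (auto simp: indicator_def nonneg_law_tail_neg[OF F] intro!: tail_antimono[OF rd(1)])
  qed (auto intro!: integrable_tail_shift[OF rd] integrable_indicator_real_distribution[OF rd(2)] Bochner_Integration.integrable_add integrable_mult_right)
  also have "(\<integral>y. indicator {u<..} y + tail F u * indicator {..u} y \<partial>G)
      = tail G u + tail F u * (1 - tail G u)"
    by (subst Bochner_Integration.integral_add)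
      (auto intro!: integrable_mult_right integrable_indicator_real_distribution[OF rd(2)]
        simp: measure_Ioi[OF rd(2)] measure_Iic[OF rd(2)]
       )
  finally show ?thesis by (simp add: tail_convolution[OF rd] algebra_simps)
qed

text \<open>The three terms bound the contributions of a second summand in
  \<open>(u, \<infinity>)\<close>, \<open>(v, u]\<close> and \<open>[0, v]\<close>. When the right
  side is close to twice \<open>tail F u\<close>, the middle term leaves no room for
  \<open>tail F (u - v)\<close> to exceed \<open>tail F u\<close> by a fixed factor.\<close>

lemma long_tailed_lower:
  assumes F: "nonneg_law F" and v: "0 \<le> v" "v \<le> u"
  shows "tail F u + (tail F v - tail F u) * tail F (u - v) + (1 - tail F v) * tail F u
      \<le> tail (F \<star> F) u"
proof -
  note rd = nonneg_lawD(1)[OF F]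
  interpret F: real_distribution F by (rule rd)
  note [measurable] = borel_measurable_tail[OF rd]
  let ?f = "\<lambda>y. indicator {u<..} y + tail F (u - v) * indicator {v<..u} y
    + tail F u * indicator {..v} y"
  have "(\<integral>y. ?f y \<partial>F) \<le> (\<integral>y. tail F (u - y) \<partial>F)"
  proof (rule integral_mono_AE)
    show "AE y in F. ?f y \<le> tail F (u - y)"
      using nonneg_lawD(2)[OF F]
      by eventually_elim
        (use v in \<open>auto simp: indicator_def nonneg_law_tail_neg[OF F] intro!: tail_antimono[OF rd]\<close>)
  qed (auto intro!: integrable_tail_shift[OF rd rd] integrable_indicator_real_distribution[OF rd] Bochner_Integration.integrable_add integrable_mult_right)
  also have "(\<integral>y. ?f y \<partial>F)
      = tail F u + tail F (u - v) * (tail F v - tail F u) + tail F u * (1 - tail F v)"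
    by (subst integral_add3)
      (auto intro!: integrable_mult_right integrable_indicator_real_distribution[OF rd]
        simp: measure_Ioi[OF rd] measure_Iic[OF rd]
          measure_Ioc[OF rd v(2)])
  finally show ?thesis by (simp add: tail_convolution[OF rd rd] algebra_simps)
qed

section \<open>Both summands large\<close>

text \<open>For independent summands with laws \<open>F\<close> and \<open>G\<close>, this is the
  probability that both exceed \<open>v\<close> and their sum exceeds \<open>u\<close>, with the
  \<open>F\<close>-summand integrated out.\<close>

definition joint_tail :: "real measure \<Rightarrow> real measure \<Rightarrow> real \<Rightarrow> real \<Rightarrow> real" where
  "joint_tail F G v u = (\<integral>y. indicator {v<..} y * tail F (max v (u - y)) \<partial>G)"

lemma integrable_joint_tail:
  assumes "real_distribution F" "real_distribution G"
  shows "integrable G (\<lambda>y. indicator {v<..} y * tail F (max v (u - y)))"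
proof -
  interpret G: real_distribution G by fact
  have "integrable G (\<lambda>y. tail F (max v (u - y)) * indicator {v<..} y)"
    by (intro integrable_real_mult_indicator integrable_tail_shift assms) auto
  then show ?thesis by (simp add: mult.commute)
qed

text \<open>The maximum in the definition keeps the argument of the tail at or above
  \<open>v\<close>, so a comparison of tails valid only from \<open>v\<close> on is enough.\<close>

lemma joint_tail_mono:
  assumes F: "real_distribution F" "real_distribution F'" "real_distribution G"
    and K: "\<And>t. v \<le> t \<Longrightarrow> tail F t \<le> K * tail F' t"
  shows "joint_tail F G v u \<le> K * joint_tail F' G v u"
proof -
  have "joint_tail F G v u \<le> (\<integral>y. K * (indicator {v<..} y * tail F' (max v (u - y))) \<partial>G)"
    unfolding joint_tail_def
    by (intro integral_mono integrable_joint_tail integrable_mult_right F)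
      (auto simp: indicator_def intro!: K)
  then show ?thesis by (simp add: joint_tail_def)
qed

text \<open>Fubini for a symmetric integrand. It allows the law of the other summand to be replaced
  by the same monotonicity argument.\<close>

lemma joint_tail_commute:
  assumes F: "real_distribution F" and G: "real_distribution G"
  shows "joint_tail F G v u = joint_tail G F v u"
proof -
  interpret F: real_distribution F by fact
  interpret G: real_distribution G by fact
  interpret FG: pair_prob_space F G ..
  define f :: "real \<Rightarrow> real \<Rightarrow> real" where
    "f = (\<lambda>x y. indicator {v<..} x * indicator {v<..} y * indicator {u<..} (x + y))"
  have inner: "(\<integral>x. f x y \<partial>H) = indicator {v<..} y * tail H (max v (u - y))"
    if "real_distribution H" for H y
  proof -
    have "(\<lambda>x. f x y) = (\<lambda>x. indicator {v<..} y * indicator {max v (u - y)<..} x)"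
      by (auto simp: f_def indicator_def fun_eq_iff)
    then have "(\<integral>x. f x y \<partial>H) = (\<integral>x. indicator {v<..} y * indicator {max v (u - y)<..} x \<partial>H)"
      by simp
    also have "\<dots> = indicator {v<..} y * (\<integral>x. indicator {max v (u - y)<..} x \<partial>H)"
      by (rule integral_mult_right_zero)
    finally show ?thesis by (simp add: measure_Ioi[OF that] real_distribution.space_eq_univ[OF that])
  qed
  have inner': "(\<integral>y. f x y \<partial>H) = indicator {v<..} x * tail H (max v (u - x))"
    if "real_distribution H" for H x
    using inner[OF that, of x] by (simp add: f_def mult.commute add.commute mult.left_commute)
  have int: "integrable (F \<Otimes>\<^sub>M G) (case_prod f)"
  proof (rule FG.P.integrable_const_bound[where B = 1])
    note [measurable_cong] = sets_pair_real_distribution[OF F G]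
    show "case_prod f \<in> borel_measurable (F \<Otimes>\<^sub>M G)"
      unfolding f_def by measurable
  qed (auto simp: f_def indicator_def)
  show ?thesis
    using FG.Fubini_integral[OF int] by (simp add: inner[OF F] inner'[OF G] joint_tail_def)
qed

text \<open>The event that the sum exceeds \<open>u\<close> contains three disjoint pieces: both
  summands above \<open>v\<close>, and the two cases of one summand at most \<open>v\<close> and the
  other above \<open>u\<close>. For subexponential \<open>F\<close> the joint piece is therefore
  asymptotically at most \<open>2 * tail F v * tail F u\<close>.\<close>

lemma joint_tail_le_convolution:
  assumes F: "nonneg_law F" and v: "0 \<le> v" "v \<le> u"
  shows "joint_tail F F v u + 2 * (1 - tail F v) * tail F u \<le> tail (F \<star> F) u"
proof -
  note rd = nonneg_lawD(1)[OF F]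
  interpret F: real_distribution F by (rule rd)
  let ?f = "\<lambda>y. indicator {v<..} y * tail F (max v (u - y)) + (1 - tail F v) * indicator {u<..} y
    + tail F u * indicator {..v} y"
  have "(\<integral>y. ?f y \<partial>F) \<le> (\<integral>y. tail F (u - y) \<partial>F)"
  proof (rule integral_mono_AE)
    show "AE y in F. ?f y \<le> tail F (u - y)"
      using nonneg_lawD(2)[OF F]
    proof eventually_elim
      case (elim y)
      consider "y \<le> v" | "v < y" "y \<le> u" | "u < y" by linarith
      then show ?case
      proof cases
        \<comment> \<open>Here \<open>max v (u - y) = v\<close>, so the first two terms add up to
          exactly 1.\<close>
        case 3
        then show ?thesis using v by (simp add: indicator_def nonneg_law_tail_neg[OF F] max_def)
      qed (use v elim in \<open>auto simp: indicator_def intro!: tail_antimono[OF rd]\<close>)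
    qed
  qed (auto intro!: integrable_tail_shift[OF rd rd] integrable_joint_tail[OF rd rd]
      integrable_indicator_real_distribution[OF rd] Bochner_Integration.integrable_add integrable_mult_right)
  also have "(\<integral>y. ?f y \<partial>F)
      = joint_tail F F v u + (1 - tail F v) * tail F u + tail F u * (1 - tail F v)"
    unfolding joint_tail_def
    by (subst integral_add3)
      (auto intro!: integrable_mult_right integrable_indicator_real_distribution[OF rd]
          integrable_joint_tail[OF rd rd]
        simp: measure_Ioi[OF rd] measure_Iic[OF rd]
       )
  finally show ?thesis by (simp add: tail_convolution[OF rd rd] algebra_simps)
qed

text \<open>If one summand is at most \<open>v\<close>, the other must exceed \<open>u - v\<close>;
  otherwise both exceed \<open>v\<close>.\<close>

lemma tail_convolution_le_joint_tail:
  assumes F: "nonneg_law F" and G: "nonneg_law G"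
  shows "tail (F \<star> G) u \<le> tail F (u - v) + tail G (u - v) + joint_tail F G v u"
proof -
  note rd = nonneg_lawD(1)[OF F] nonneg_lawD(1)[OF G]
  interpret G: real_distribution G by (rule rd)
  let ?f = "\<lambda>y. tail F (u - v) + indicator {u - v<..} y
    + indicator {v<..} y * tail F (max v (u - y))"
  have "(\<integral>y. tail F (u - y) \<partial>G) \<le> (\<integral>y. ?f y \<partial>G)"
  proof (rule integral_mono)
    fix y
    consider "y \<le> v" | "v < y" "y \<le> u - v" | "u - v < y" by linarith
    then show "tail F (u - y) \<le> ?f y"
    proof cases
      case 1
      then show ?thesis using tail_antimono[OF rd(1), of "u - v" "u - y"]
        by (simp add: indicator_def)
    next
      case 2
      then show ?thesis by (simp add: indicator_def max_def tail_nonneg[OF rd(1)])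
    next
      case 3
      then show ?thesis using tail_le_1[OF rd(1), of "u - y"]
        by (simp add: indicator_def tail_nonneg[OF rd(1)] add_increasing2 add_increasing)
    qed
  qed (auto intro!: integrable_tail_shift[OF rd] integrable_joint_tail[OF rd]
      integrable_indicator_real_distribution[OF rd(2)] Bochner_Integration.integrable_add)
  also have "(\<integral>y. ?f y \<partial>G) = tail F (u - v) + tail G (u - v) + joint_tail F G v u"
    using G.prob_space unfolding joint_tail_def
    by (subst integral_add3)
      (auto intro!: integrable_indicator_real_distribution[OF rd(2)] integrable_joint_tail[OF rd]
        simp: measure_Ioi[OF rd(2)])
  finally show ?thesis by (simp add: tail_convolution[OF rd])
qed

section \<open>Subexponential laws\<close>

text \<open>Positivity at every level keeps all ratios meaningful, and the twofold condition passes
  to a convolution with a lighter law by a single limit computation.\<close>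

definition subexp :: "real measure \<Rightarrow> bool" where
  "subexp F \<longleftrightarrow> nonneg_law F \<and> (\<forall>u. 0 < tail F u) \<and>
     ((\<lambda>u. tail (F \<star> F) u / tail F u) \<longlongrightarrow> 2) at_top"

lemma subexpD:
  assumes "subexp F"
  shows "nonneg_law F" "real_distribution F" "\<And>u. 0 < tail F u"
    "((\<lambda>u. tail (F \<star> F) u / tail F u) \<longlongrightarrow> 2) at_top"
  using assms by (auto simp: subexp_def nonneg_law_def)

lemma filterlim_minus_const_at_top: "filterlim (\<lambda>u::real. u - v) at_top at_top"
  using filterlim_tendsto_add_at_top[OF tendsto_const filterlim_ident, of "- v"] by simp

lemma subexp_long_tailed:
  assumes F: "subexp F" and v: "0 \<le> v"
  shows "((\<lambda>u. tail F (u - v) / tail F u) \<longlongrightarrow> 1) at_top"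
proof (rule tendsto_sandwich)
  note rd = subexpD(2)[OF F] and pos = subexpD(3)[OF F]
  \<comment> \<open>This is \<open>long_tailed_lower\<close> solved for the ratio. As the
    convolution ratio tends to 2, numerator and denominator both tend to
    \<open>tail F v\<close>.\<close>
  let ?U = "\<lambda>u. (tail (F \<star> F) u / tail F u - 1 - (1 - tail F v)) / (tail F v - tail F u)"
  show "\<forall>\<^sub>F u in at_top. 1 \<le> tail F (u - v) / tail F u"
    using tail_antimono[OF rd, of "u - v" u for u] v pos by (auto simp: field_simps)
  have "\<forall>\<^sub>F u in at_top. tail F u < tail F v"
    using order_tendstoD(2)[OF tail_tendsto_0[OF rd] pos[of v]] .
  then show "\<forall>\<^sub>F u in at_top. tail F (u - v) / tail F u \<le> ?U u"
    using eventually_ge_at_top[of v]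
  proof eventually_elim
    case (elim u)
    have "(tail F v - tail F u) * tail F (u - v)
        \<le> (tail (F \<star> F) u / tail F u - 1 - (1 - tail F v)) * tail F u"
    proof -
      have "(tail (F \<star> F) u / tail F u - 1 - (1 - tail F v)) * tail F u
          = tail (F \<star> F) u - tail F u - (1 - tail F v) * tail F u"
        using pos[of u] by (simp add: field_simps)
      then show ?thesis using long_tailed_lower[OF subexpD(1)[OF F] v elim(2)] by linarith
    qed
    then show ?case using elim pos[of u] by (simp add: field_simps)
  qed
  have "(?U \<longlongrightarrow> (2 - 1 - (1 - tail F v)) / (tail F v - 0)) at_top"
    using pos[of v] by (intro tendsto_intros subexpD(4)[OF F] tail_tendsto_0[OF rd]) auto
  then show "(?U \<longlongrightarrow> 1) at_top" using pos[of v] by simp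
qed simp

lemma tail_ratio_shift:
  assumes F: "subexp F" and v: "0 \<le> v"
    and G: "((\<lambda>u. tail G u / tail F u) \<longlongrightarrow> c) at_top"
  shows "((\<lambda>u. tail G (u - v) / tail F u) \<longlongrightarrow> c) at_top"
proof -
  have "((\<lambda>u. (tail G (u - v) / tail F (u - v)) * (tail F (u - v) / tail F u)) \<longlongrightarrow> c * 1) at_top"
    by (intro tendsto_mult subexp_long_tailed F v
          filterlim_compose[OF G filterlim_minus_const_at_top])
  then show ?thesis using subexpD(3)[OF F] by (simp add: less_imp_neq[symmetric])
qed

text \<open>If both summands exceed \<open>v\<close>, replacing them by independent copies with law \<open>F\<close> costs a
  constant factor, and for \<open>F\<close> itself this event is negligible as \<open>v\<close> grows.\<close>
theorem tail_convolution_ratio: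
  assumes F: "subexp F" and G: "nonneg_law G" and H: "nonneg_law H"
    and c: "((\<lambda>u. tail G u / tail F u) \<longlongrightarrow> c) at_top"
    and d: "((\<lambda>u. tail H u / tail F u) \<longlongrightarrow> d) at_top"
  shows "((\<lambda>u. tail (G \<star> H) u / tail F u) \<longlongrightarrow> c + d) at_top"
proof (rule order_tendstoI)
  note rdF = subexpD(2)[OF F] and pos = subexpD(3)[OF F]
  note rdG = nonneg_lawD(1)[OF G] and rdH = nonneg_lawD(1)[OF H]
  fix e assume e: "e < c + d"
  have "((\<lambda>u. tail G u / tail F u + tail H u / tail F u - tail G u / tail F u * tail H u)
      \<longlongrightarrow> c + d - c * 0) at_top"
    by (intro tendsto_intros c d tail_tendsto_0 rdH)
  then have "\<forall>\<^sub>F u in at_top.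
      e < tail G u / tail F u + tail H u / tail F u - tail G u / tail F u * tail H u"
    using e by (intro order_tendstoD(1)[where y = "c + d"]) auto
  then show "\<forall>\<^sub>F u in at_top. e < tail (G \<star> H) u / tail F u"
    using eventually_ge_at_top[of 0]
  proof eventually_elim
    case (elim u)
    have "tail G u / tail F u + tail H u / tail F u - tail G u / tail F u * tail H u
        = (tail G u + tail H u - tail G u * tail H u) / tail F u"
      by (simp add: diff_divide_distrib add_divide_distrib)
    also have "\<dots> \<le> tail (G \<star> H) u / tail F u"
      using pos[of u] tail_convolution_ge[OF G H elim(2)] by (intro divide_right_mono) auto
    finally show ?case using elim by simp
  qed
next
  note rdF = subexpD(2)[OF F] and pos = subexpD(3)[OF F]
  note rdG = nonneg_lawD(1)[OF G] and rdH = nonneg_lawD(1)[OF H]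
  fix e assume e: "c + d < e"
  define K where "K = \<bar>c\<bar> + \<bar>d\<bar> + 1"
  have K: "1 \<le> K" "c < K" "d < K" by (auto simp: K_def)
  have "\<forall>\<^sub>F v in at_top. tail G v / tail F v < K" "\<forall>\<^sub>F v in at_top. tail H v / tail F v < K"
    using order_tendstoD(2)[OF c K(2)] order_tendstoD(2)[OF d K(3)] .
  then have "\<forall>\<^sub>F v in at_top. tail G v / tail F v < K \<and> tail H v / tail F v < K"
    by eventually_elim simp
  then obtain v0 where v0: "\<And>t. v0 \<le> t \<Longrightarrow> tail G t / tail F t < K \<and> tail H t / tail F t < K"
    by (auto simp: eventually_at_top_linorder)
  \<comment> \<open>The contribution of two large summands, relative to \<open>tail F u\<close>, has
    limit at most \<open>2 * K\<^sup>2 * tail F v\<close>. Choosing \<open>v\<close> first makes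
    this smaller than the slack \<open>e - (c + d)\<close>; only then does \<open>u\<close>
    grow.\<close>
  have "((\<lambda>v. 2 * K\<^sup>2 * tail F v) \<longlongrightarrow> 2 * K\<^sup>2 * 0) at_top"
    by (intro tendsto_intros tail_tendsto_0 rdF)
  then have "\<forall>\<^sub>F v in at_top. 2 * K\<^sup>2 * tail F v < e - (c + d)"
    using e by (intro order_tendstoD(2)[where y = 0]) auto
  then obtain v where v: "max 0 v0 \<le> v" "2 * K\<^sup>2 * tail F v < e - (c + d)"
    by (metis (mono_tags, lifting) eventually_at_top_linorder max.cobounded1 max.cobounded2)
  have GK: "tail G t \<le> K * tail F t" and HK: "tail H t \<le> K * tail F t" if "v \<le> t" for t
    using v0[of t] v(1) that pos[of t] by (auto simp: field_simps)
  let ?U = "\<lambda>u. tail G (u - v) / tail F u + tail H (u - v) / tail F u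
    + K\<^sup>2 * (tail (F \<star> F) u / tail F u - 2 * (1 - tail F v))"
  have "(?U \<longlongrightarrow> c + d + K\<^sup>2 * (2 - 2 * (1 - tail F v))) at_top"
    using v(1) by (intro tendsto_intros subexpD(4)[OF F] tail_ratio_shift[OF F] c d) auto
  then have "\<forall>\<^sub>F u in at_top. ?U u < e"
    by (rule order_tendstoD(2)) (use v(2) in \<open>simp add: algebra_simps\<close>)
  then show "\<forall>\<^sub>F u in at_top. tail (G \<star> H) u / tail F u < e"
    using eventually_ge_at_top[of v]
  proof eventually_elim
    case (elim u)
    \<comment> \<open>The two laws are replaced by \<open>F\<close> one after the other, exchanging
      the roles of the summands in between.\<close>
    have "joint_tail G H v u \<le> K * joint_tail F H v u"
      by (rule joint_tail_mono[OF rdG rdF rdH GK])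
    also have "joint_tail F H v u = joint_tail H F v u"
      by (rule joint_tail_commute[OF rdF rdH])
    also have "K * joint_tail H F v u \<le> K * (K * joint_tail F F v u)"
      using K by (intro mult_left_mono joint_tail_mono[OF rdH rdF rdF HK]) auto
    also have "\<dots> \<le> K * (K * (tail (F \<star> F) u - 2 * (1 - tail F v) * tail F u))"
      using K joint_tail_le_convolution[OF subexpD(1)[OF F], of v u] v(1) elim(2)
      by (intro mult_left_mono) auto
    finally have "tail (G \<star> H) u \<le> tail G (u - v) + tail H (u - v)
        + K * (K * (tail (F \<star> F) u - 2 * (1 - tail F v) * tail F u))"
      using tail_convolution_le_joint_tail[OF G H, of u v] by linarith
    then have "tail (G \<star> H) u / tail F u \<le> (tail G (u - v) + tail H (u - v)
        + K * (K * (tail (F \<star> F) u - 2 * (1 - tail F v) * tail F u))) / tail F u"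
      using pos[of u] by (intro divide_right_mono) auto
    also have "\<dots> = ?U u"
      using pos[of u] by (simp add: field_simps power2_eq_square)
    finally show ?case using elim(1) by simp
  qed
qed

text \<open>Meant for the pair \<open>M k + C k\<close>: its law becomes an admissible step for
  Kesten's bound. The pointwise inequality supplies the start of that bound, where the partial sum
  consists of the base variable alone.\<close>

lemma subexp_convolution:
  assumes F: "subexp F" and G: "nonneg_law G"
    and G0: "((\<lambda>u. tail G u / tail F u) \<longlongrightarrow> 0) at_top"
  shows "subexp (G \<star> F)" "((\<lambda>u. tail (G \<star> F) u / tail F u) \<longlongrightarrow> 1) at_top"
    "tail G u \<le> tail (G \<star> F) u"
proof -
  note nF = subexpD(1)[OF F] and pos = subexpD(3)[OF F]
  have F1: "((\<lambda>u. tail F u / tail F u) \<longlongrightarrow> 1) at_top"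
    using pos by (simp add: less_imp_neq[symmetric])
  show GF: "((\<lambda>u. tail (G \<star> F) u / tail F u) \<longlongrightarrow> 1) at_top"
    using tail_convolution_ratio[OF F G nF G0 F1] by simp
  have nGF: "nonneg_law (G \<star> F)" by (rule nonneg_law_convolution[OF G nF])
  have ge: "tail G u + tail F u * (1 - tail G u) \<le> tail (G \<star> F) u" if "0 \<le> u" for u
    using tail_convolution_ge[OF G nF that] by (simp add: algebra_simps)
  show le: "tail G u \<le> tail (G \<star> F) u" for u
  proof (cases "0 \<le> u")
    case True
    then show ?thesis
      using ge[of u] mult_nonneg_nonneg[of "tail F u" "1 - tail G u"] pos[of u]
        tail_le_1[OF nonneg_lawD(1)[OF G], of u] by linarith
  qed (simp add: nonneg_law_tail_neg[OF nGF] tail_le_1 nonneg_lawD[OF G])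
  have posGF: "0 < tail (G \<star> F) u" for u
  proof (cases "0 \<le> u \<and> tail G u = 0")
    case True
    then show ?thesis using ge[of u] pos[of u] by simp
  next
    case False
    then show ?thesis
      using le[of u] tail_nonneg[OF nonneg_lawD(1)[OF G], of u] nonneg_law_tail_neg[OF nGF, of u]
      by fastforce
  qed
  have "((\<lambda>u. tail ((G \<star> F) \<star> (G \<star> F)) u / tail F u) \<longlongrightarrow> 1 + 1) at_top"
    by (rule tail_convolution_ratio[OF F nGF nGF GF GF])
  then have "((\<lambda>u. (tail ((G \<star> F) \<star> (G \<star> F)) u / tail F u) / (tail (G \<star> F) u / tail F u))
      \<longlongrightarrow> (1 + 1) / 1) at_top"
    by (intro tendsto_divide GF) auto
  then have "((\<lambda>u. tail ((G \<star> F) \<star> (G \<star> F)) u / tail (G \<star> F) u) \<longlongrightarrow> 2) at_top"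
    using pos by (simp add: less_imp_neq[symmetric])
  then show "subexp (G \<star> F)" using nGF posGF by (simp add: subexp_def)
qed

section \<open>Uniform bounds for iterated convolutions\<close>

text \<open>One round of Kesten's recursion. The constant \<open>D\<close> depends on
  \<open>H\<close> and \<open>\<eta>\<close> but not on \<open>L\<close> or \<open>A\<close>, which
  is what makes the step iterable.\<close>

lemma subexp_convolution_step:
  assumes H: "subexp H" and \<eta>: "0 < \<eta>"
  obtains D where "0 \<le> D"
    "\<And>L A u. \<lbrakk>real_distribution L; 0 \<le> A; \<And>t. tail L t \<le> A * tail H t\<rbrakk>
      \<Longrightarrow> tail (L \<star> H) u \<le> (D + (1 + \<eta>) * A) * tail H u"
proof -
  note nH = subexpD(1)[OF H] and rd = subexpD(2)[OF H] and pos = subexpD(3)[OF H]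
  interpret H: real_distribution H by (rule rd)
  have "\<forall>\<^sub>F u in at_top. tail (H \<star> H) u / tail H u < 2 + \<eta>"
    using \<eta> by (intro order_tendstoD(2)[OF subexpD(4)[OF H]]) auto
  then obtain T where T: "\<And>u. T \<le> u \<Longrightarrow> tail (H \<star> H) u / tail H u < 2 + \<eta>"
    by (auto simp: eventually_at_top_linorder)
  \<comment> \<open>The summand 1 is used above \<open>T\<close>; below \<open>T\<close> the trivial
    bound 1 on the tail is at most \<open>tail H u / tail H T\<close>.\<close>
  define D where "D = 1 + 1 / tail H T"
  have D: "1 \<le> D" using pos[of T] by (simp add: D_def)
  show thesis
  proof (rule that[of D])
    show "0 \<le> D" using D by simp
    fix L A u
    assume L: "real_distribution L" and A: "0 \<le> A" and LA: "\<And>t. tail L t \<le> A * tail H t"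
    show "tail (L \<star> H) u \<le> (D + (1 + \<eta>) * A) * tail H u"
    proof (cases "T \<le> u")
      case True
      have "tail (L \<star> H) u = (\<integral>y. tail L (u - y) \<partial>H)"
        by (rule tail_convolution[OF L rd])
      \<comment> \<open>For \<open>y > u\<close> the factor \<open>tail H (u - y)\<close> equals 1,
        so the right side is 1; the correction \<open>1 - A\<close> prevents the factor
        \<open>A\<close> from being paid there, which would turn \<open>1 + \<eta>\<close> into
        \<open>2 + \<eta>\<close>.\<close>
      also have "\<dots> \<le> (\<integral>y. (1 - A) * indicator {u<..} y + A * tail H (u - y) \<partial>H)"
      proof (rule integral_mono)
        fix y
        show "tail L (u - y) \<le> (1 - A) * indicator {u<..} y + A * tail H (u - y)"
          using LA[of "u - y"] tail_le_1[OF L, of "u - y"] nonneg_law_tail_neg[OF nH, of "u - y"]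
          by (auto simp: indicator_def)
      qed (auto intro!: integrable_tail_shift[OF L rd] integrable_tail_shift[OF rd rd]
          integrable_indicator_real_distribution[OF rd] Bochner_Integration.integrable_add
          integrable_mult_right)
      also have "\<dots> = (1 - A) * tail H u + A * tail (H \<star> H) u"
        by (subst Bochner_Integration.integral_add)
          (auto intro!: integrable_tail_shift[OF rd rd]
            integrable_indicator_real_distribution[OF rd] integrable_mult_right
            simp: measure_Ioi[OF rd] tail_convolution[OF rd rd])
      also have "\<dots> \<le> (1 - A) * tail H u + A * ((2 + \<eta>) * tail H u)"
        using T[OF True] pos[of u] A by (intro add_left_mono mult_left_mono) (auto simp: field_simps)
      also have "\<dots> = (1 + (1 + \<eta>) * A) * tail H u" by (simp add: algebra_simps)
      also have "\<dots> \<le> (D + (1 + \<eta>) * A) * tail H u"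
        using D pos[of u] by (intro mult_right_mono) auto
      finally show ?thesis .
    next
      case False
      have "tail (L \<star> H) u \<le> 1" by (intro tail_le_1 real_distribution_convolution L rd)
      also have "\<dots> \<le> 1 / tail H T * tail H u"
        using tail_antimono[OF rd, of u T] False pos[of T] by (simp add: field_simps)
      also have "\<dots> \<le> (D + (1 + \<eta>) * A) * tail H u"
        using pos[of u] A \<eta> by (intro mult_right_mono) (auto simp: D_def)
      finally show ?thesis .
    qed
  qed
qed

text \<open>Kesten's bound.\<close>
theorem subexp_iterated_convolution_bound:
  assumes H: "subexp H" and \<eta>: "0 < \<eta>"
    and L: "\<And>k. real_distribution (L k)" "\<And>k. L (Suc k) = (L k \<star> H)"
      "\<And>u. tail (L 0) u \<le> tail H u"
  shows "\<exists>K. \<forall>k u. tail (L k) u \<le> K * (1 + \<eta>) ^ k * tail H u"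
proof -
  obtain D where D: "0 \<le> D" "\<And>L A u. \<lbrakk>real_distribution L; 0 \<le> A; \<And>t. tail L t \<le> A * tail H t\<rbrakk>
      \<Longrightarrow> tail (L \<star> H) u \<le> (D + (1 + \<eta>) * A) * tail H u"
    using subexp_convolution_step[OF H \<eta>] by metis
  \<comment> \<open>The solution of \<open>A (Suc k) = D + (1 + \<eta>) * A k\<close> with
    \<open>A 0 = 1\<close>.\<close>
  define A where "A k = (1 + D / \<eta>) * (1 + \<eta>) ^ k - D / \<eta>" for k
  have A: "0 \<le> A k" for k
  proof -
    have "1 + D / \<eta> \<le> (1 + D / \<eta>) * (1 + \<eta>) ^ k"
      using mult_left_mono[of 1 "(1 + \<eta>) ^ k" "1 + D / \<eta>"] D(1) \<eta> by simp
    then show ?thesis by (simp add: A_def)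
  qed
  have A_Suc: "A (Suc k) = D + (1 + \<eta>) * A k" for k
    using \<eta> by (simp add: A_def field_simps)
  have bound: "tail (L k) u \<le> A k * tail H u" for k u
  proof (induction k arbitrary: u)
    case 0
    then show ?case using L(3) by (simp add: A_def)
  next
    case (Suc k)
    show ?case unfolding L(2) A_Suc by (rule D(2)[OF L(1) A Suc.IH])
  qed
  have "tail (L k) u \<le> (1 + D / \<eta>) * (1 + \<eta>) ^ k * tail H u" for k u
  proof -
    have "A k * tail H u \<le> (1 + D / \<eta>) * (1 + \<eta>) ^ k * tail H u"
      using subexpD(3)[OF H, of u] D(1) \<eta> by (intro mult_right_mono) (auto simp: A_def)
    with bound[of k u] show ?thesis by linarith
  qed
  then show ?thesis by blast
qed

section \<open>Exponential against subexponential tails\<close>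

text \<open>By long-tailedness a unit step eventually costs at most a factor
  \<open>exp (- \<gamma> / 2)\<close>, so the tail of \<open>F\<close> is at least a multiple of
  \<open>exp (- \<gamma> / 2 * u)\<close>. This leaves half of the exponential rate of
  \<open>G\<close> to spare.\<close>

lemma exp_bounded_tail_negligible:
  assumes F: "subexp F" and G: "real_distribution G" and \<gamma>: "0 < \<gamma>"
    and K: "\<And>u. 0 \<le> u \<Longrightarrow> tail G u \<le> K * exp (- \<gamma> * u)"
  shows "((\<lambda>u. tail G u / tail F u) \<longlongrightarrow> 0) at_top"
proof -
  note rd = subexpD(2)[OF F] and pos = subexpD(3)[OF F]
  have "\<forall>\<^sub>F u in at_top. tail F (u - 1) / tail F u < exp (\<gamma> / 2)"
    using \<gamma> by (intro order_tendstoD(2)[OF subexp_long_tailed[OF F]]) auto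
  then obtain u0 where u0: "\<And>u. u0 \<le> u \<Longrightarrow> tail F (u - 1) / tail F u < exp (\<gamma> / 2)"
    by (auto simp: eventually_at_top_linorder)
  have geom: "exp (- \<gamma> / 2 * real n) * tail F u0 \<le> tail F (u0 + real n)" for n
  proof (induction n)
    case (Suc n)
    have "exp (- \<gamma> / 2 * real (Suc n)) * tail F u0
        = exp (- \<gamma> / 2) * (exp (- \<gamma> / 2 * real n) * tail F u0)"
      by (simp add: exp_add[symmetric] algebra_simps mult_exp_exp)
    also have "\<dots> \<le> exp (- \<gamma> / 2) * tail F (u0 + real n)"
      by (intro mult_left_mono Suc.IH) simp
    also have "\<dots> \<le> exp (- \<gamma> / 2) * (exp (\<gamma> / 2) * tail F (u0 + real (Suc n)))"
      using u0[of "u0 + real (Suc n)"] pos[of "u0 + real (Suc n)"]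
      by (intro mult_left_mono) (auto simp: field_simps)
    also have "\<dots> = tail F (u0 + real (Suc n))"
      by (simp add: mult.assoc[symmetric] mult_exp_exp)
    finally show ?case .
  qed simp
  \<comment> \<open>The level \<open>u\<close> is reached from \<open>u0\<close> in whole steps; the
    1 in the exponent pays for rounding their number up.\<close>
  define c where "c = exp (- \<gamma> / 2 * (1 - u0)) * tail F u0"
  have c: "0 < c" using pos by (simp add: c_def)
  have lower: "c * exp (- \<gamma> / 2 * u) \<le> tail F u" if "u0 \<le> u" for u
  proof -
    define n where "n = nat \<lceil>u - u0\<rceil>"
    have n: "u \<le> u0 + real n" "real n \<le> u - u0 + 1"
      using that by (auto simp: n_def) linarith+
    have "c * exp (- \<gamma> / 2 * u) = exp (- \<gamma> / 2 * (u - u0 + 1)) * tail F u0"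
      by (simp add: c_def mult_exp_exp field_simps)
    also have "\<dots> \<le> exp (- \<gamma> / 2 * real n) * tail F u0"
      using n(2) \<gamma> pos[of u0] by (intro mult_right_mono) auto
    also have "\<dots> \<le> tail F (u0 + real n)" by (rule geom)
    also have "\<dots> \<le> tail F u" by (rule tail_antimono[OF rd n(1)])
    finally show ?thesis .
  qed
  show ?thesis
  proof (rule tendsto_sandwich)
    show "\<forall>\<^sub>F u in at_top. 0 \<le> tail G u / tail F u"
      using pos tail_nonneg[OF G] by (simp add: less_imp_le)
    show "\<forall>\<^sub>F u in at_top. tail G u / tail F u \<le> \<bar>K\<bar> / c * exp (- \<gamma> / 2 * u)"
      using eventually_ge_at_top[of "max 0 u0"]
    proof eventually_elim
      case (elim u)
      have "tail G u \<le> \<bar>K\<bar> * exp (- \<gamma> * u)"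
        using elim by (intro order_trans[OF K mult_right_mono]) auto
      also have "\<dots> = \<bar>K\<bar> / c * exp (- \<gamma> / 2 * u) * (c * exp (- \<gamma> / 2 * u))"
        using c by (simp add: mult_exp_exp field_simps)
      also have "\<dots> \<le> \<bar>K\<bar> / c * exp (- \<gamma> / 2 * u) * tail F u"
        using lower[of u] elim c by (intro mult_left_mono) auto
      finally show ?case using pos[of u] by (simp add: field_simps)
    qed
    have "filterlim (\<lambda>u. - \<gamma> / 2 * u) at_bot at_top"
      using \<gamma> by (intro filterlim_tendsto_neg_mult_at_bot[OF tendsto_const] filterlim_ident) auto
    then have "((\<lambda>u. \<bar>K\<bar> / c * exp (- \<gamma> / 2 * u)) \<longlongrightarrow> \<bar>K\<bar> / c * 0) at_top"
      by (intro tendsto_intros filterlim_compose[OF exp_at_bot])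
    then show "((\<lambda>u. \<bar>K\<bar> / c * exp (- \<gamma> / 2 * u)) \<longlongrightarrow> 0) at_top" by simp
  qed simp
qed

lemma subexponential_imp_subexp:
  assumes F: "subexponential F"
  shows "subexp F"
proof -
  have rd: "real_distribution F" and neg: "measure F {..<0} = 0"
    and ratio: "\<And>n. 1 \<le> n \<Longrightarrow>
      ((\<lambda>u. tail (conv_power n F) u / (real n * tail F u)) \<longlongrightarrow> 1) at_top"
    using F by (auto simp: subexponential_def ratio_equiv_def)
  interpret F: real_distribution F by (rule rd)
  have "AE x in F. x \<notin> {..<0}"
    using neg by (subst F.prob_eq_0[symmetric]) auto
  then have n: "nonneg_law F" using rd by (auto simp: nonneg_law_def not_less elim!: eventually_mono)
  have "(F \<star> return borel 0) = F"
  proof (rule measure_eqI)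
    fix A assume "A \<in> sets (F \<star> return borel 0)"
    then have A: "A \<in> sets borel" by simp
    have "emeasure (F \<star> return borel 0) A = (\<integral>\<^sup>+x. emeasure (return borel 0) {a. a + x \<in> A} \<partial>F)"
      using A F.finite_measure
      by (intro convolution_emeasure)
        (auto simp: prob_space.finite_measure prob_space_return)
    also have "\<dots> = (\<integral>\<^sup>+x. indicator A x \<partial>F)"
    proof (rule nn_integral_cong)
      fix x :: real
      have "{a. a + x \<in> A} = (\<lambda>a. a + x) -` A \<inter> space borel" by auto
      also have "\<dots> \<in> sets borel" using A by (intro measurable_sets[of _ borel borel]) auto
      finally show "emeasure (return borel 0) {a. a + x \<in> A} = indicator A x"
        by (simp add: indicator_def)
    qed
    also have "\<dots> = emeasure F A" using A by (simp add: F.events_eq_borel)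
    finally show "emeasure (F \<star> return borel 0) A = emeasure F A" .
  qed simp
  then have conv: "conv_power 1 F = F" "conv_power 2 F = (F \<star> F)"
    by (simp_all add: numeral_2_eq_2)
  have "\<forall>\<^sub>F u in at_top. 0 < tail F u / (1 * tail F u)"
    using order_tendstoD(1)[OF ratio[of 1], of 0] by (simp add: conv[simplified])
  then obtain u0 where u0: "\<And>u. u0 \<le> u \<Longrightarrow> 0 < tail F u / tail F u"
    by (auto simp: eventually_at_top_linorder)
  \<comment> \<open>Since 0/0 is 0, the case \<open>n = 1\<close> of the definition, a quotient of
    the tail by itself, forces nonzero tails from \<open>u0\<close> on. Monotonicity carries this
    down to all levels.\<close>
  have pos: "0 < tail F u" for u
  proof -
    have "tail F (max u u0) \<noteq> 0" using u0[of "max u u0"] by auto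
    then show ?thesis
      using tail_nonneg[OF rd, of "max u u0"] tail_antimono[OF rd, of u "max u u0"] by simp
  qed
  have "((\<lambda>u. 2 * (tail (F \<star> F) u / (2 * tail F u))) \<longlongrightarrow> 2 * 1) at_top"
    using ratio[of 2] by (intro tendsto_intros) (simp add: conv)
  then have "((\<lambda>u. tail (F \<star> F) u / tail F u) \<longlongrightarrow> 2) at_top" by simp
  with n pos show ?thesis by (simp add: subexp_def)
qed

section \<open>Exponential tails of phase-type laws\<close>

lemma markov_jump_processD:
  assumes "markov_jump_process S P X"
  shows "finite S"
    "\<And>i. i \<in> S \<Longrightarrow> prob_space (P i)"
    "\<And>i t. i \<in> S \<Longrightarrow> 0 \<le> t \<Longrightarrow> X t \<in> measurable (P i) (count_space S)"
    "\<And>i. i \<in> S \<Longrightarrow> AE \<omega> in P i. X 0 \<omega> = i"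
    "\<And>i \<omega> t. i \<in> S \<Longrightarrow> \<omega> \<in> space (P i) \<Longrightarrow> 0 \<le> t \<Longrightarrow> \<forall>\<^sub>F s in at_right t. X s \<omega> = X t \<omega>"
    "\<And>i n t j. i \<in> S \<Longrightarrow> 0 \<le> t 0 \<Longrightarrow> (\<And>k. k \<le> n \<Longrightarrow> t k < t (Suc k)) \<Longrightarrow>
       (\<And>k. k \<le> Suc n \<Longrightarrow> j k \<in> S) \<Longrightarrow>
          measure (P i) {\<omega>\<in>space (P i). \<forall>k\<le>Suc n. X (t k) \<omega> = j k} =
          measure (P i) {\<omega>\<in>space (P i). \<forall>k\<le>n. X (t k) \<omega> = j k} *
          measure (P (j n)) {\<omega>\<in>space (P (j n)). X (t (Suc n) - t n) \<omega> = j (Suc n)}"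
  using assms unfolding markov_jump_process_def by blast+

section \<open>The jump process at integer times\<close>

text \<open>The skeleton chain suffices for a geometric bound on absorption and turns the Markov
  property into products of transition probabilities.\<close>

definition transition_prob ::
    "('s \<Rightarrow> 'p measure) \<Rightarrow> (real \<Rightarrow> 'p \<Rightarrow> 's) \<Rightarrow> 's \<Rightarrow> 's \<Rightarrow> nat \<Rightarrow> real" where
  "transition_prob P X i j m = measure (P i) {\<omega>\<in>space (P i). X (real m) \<omega> = j}"

lemma transition_prob_nonneg: "0 \<le> transition_prob P X i j m"
  by (simp add: transition_prob_def)

context
  fixes S :: "'s set" and P :: "'s \<Rightarrow> 'p measure" and X :: "real \<Rightarrow> 'p \<Rightarrow> 's"
  assumes mjp: "markov_jump_process S P X"
begin

lemma state_event: "i \<in> S \<Longrightarrow> 0 \<le> t \<Longrightarrow> {\<omega>\<in>space (P i). X t \<omega> = j} \<in> sets (P i)"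
proof -
  assume i: "i \<in> S" "0 \<le> t"
  note X = markov_jump_processD(3)[OF mjp i]
  have "{\<omega>\<in>space (P i). X t \<omega> = j} = X t -` ({j} \<inter> S) \<inter> space (P i)"
    using measurable_space[OF X] by auto
  then show ?thesis using measurable_sets[OF X, of "{j} \<inter> S"] by simp
qed

lemma measure_partition:
  assumes i: "i \<in> S" and t: "0 \<le> t" and A: "A \<in> sets (P i)"
  shows "measure (P i) A = (\<Sum>k\<in>S. measure (P i) (A \<inter> {\<omega>\<in>space (P i). X t \<omega> = k}))"
proof -
  interpret prob_space "P i" by (rule markov_jump_processD(2)[OF mjp i])
  have "A = (\<Union>k\<in>S. A \<inter> {\<omega>\<in>space (P i). X t \<omega> = k})"
    using sets.sets_into_space[OF A] measurable_space[OF markov_jump_processD(3)[OF mjp i t]]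
    by auto
  also have "measure (P i) \<dots> = (\<Sum>k\<in>S. measure (P i) (A \<inter> {\<omega>\<in>space (P i). X t \<omega> = k}))"
    using markov_jump_processD(1)[OF mjp] A state_event[OF i t]
    by (intro finite_measure_finite_Union) (auto simp: disjoint_family_on_def)
  finally show ?thesis .
qed

lemma sum_transition_prob: "i \<in> S \<Longrightarrow> (\<Sum>j\<in>S. transition_prob P X i j m) = 1"
proof -
  assume i: "i \<in> S"
  interpret prob_space "P i" by (rule markov_jump_processD(2)[OF mjp i])
  have "space (P i) \<inter> {\<omega>\<in>space (P i). X (real m) \<omega> = k} = {\<omega>\<in>space (P i). X (real m) \<omega> = k}" for k
    by auto
  then show ?thesis
    using measure_partition[OF i, of "real m" "space (P i)"] prob_space
    by (simp add: transition_prob_def)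
qed

lemma transition_prob_0:
  assumes i: "i \<in> S"
  shows "transition_prob P X i j 0 = (if j = i then 1 else 0)"
proof -
  interpret prob_space "P i" by (rule markov_jump_processD(2)[OF mjp i])
  have "AE \<omega> in P i. X 0 \<omega> = i" by (rule markov_jump_processD(4)[OF mjp i])
  then have "prob {\<omega>\<in>space (P i). X 0 \<omega> = j} = (if j = i then 1 else 0)"
    using state_event[OF i, of 0 j]
    by (auto simp: prob_eq_1 prob_eq_0 elim!: AE_mp)
  then show ?thesis by (simp add: transition_prob_def)
qed

text \<open>The Markov property concerns strictly increasing times, so \<open>l = 0\<close> is
  treated apart, by means of the almost sure initial state.\<close>

lemma chapman_kolmogorov:
  assumes i: "i \<in> S" and j: "j \<in> S"
  shows "transition_prob P X i j (m + l)
    = (\<Sum>k\<in>S. transition_prob P X i k m * transition_prob P X k j l)"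
proof (cases "l = 0")
  case True
  have "(\<Sum>k\<in>S. transition_prob P X i k m * transition_prob P X k j 0)
      = (\<Sum>k\<in>S. if k = j then transition_prob P X i k m else 0)"
    by (intro sum.cong) (auto simp: transition_prob_0)
  with True j markov_jump_processD(1)[OF mjp] show ?thesis by simp
next
  case False
  have "measure (P i) ({\<omega>\<in>space (P i). X (real (m + l)) \<omega> = j} \<inter> {\<omega>\<in>space (P i). X (real m) \<omega> = k})
      = transition_prob P X i k m * transition_prob P X k j l" if k: "k \<in> S" for k
  proof -
    define t where "t r = (if r = 0 then real m else real m + real r * real l)" for r :: nat
    define s where "s r = (if r = 0 then k else j)" for r :: nat
    have le1: "(\<forall>r\<le>Suc 0. Q r) \<longleftrightarrow> Q 0 \<and> Q 1" for Q :: "nat \<Rightarrow> bool"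
      by (auto simp: le_Suc_eq)
    have "measure (P i) {\<omega>\<in>space (P i). \<forall>r\<le>Suc 0. X (t r) \<omega> = s r} =
          measure (P i) {\<omega>\<in>space (P i). \<forall>r\<le>0. X (t r) \<omega> = s r} *
          measure (P (s 0)) {\<omega>\<in>space (P (s 0)). X (t (Suc 0) - t 0) \<omega> = s (Suc 0)}"
      using i j k False
      by (intro markov_jump_processD(6)[OF mjp]) (auto simp: t_def s_def)
    moreover have "{\<omega>\<in>space (P i). \<forall>r\<le>Suc 0. X (t r) \<omega> = s r}
        = {\<omega>\<in>space (P i). X (real (m + l)) \<omega> = j} \<inter> {\<omega>\<in>space (P i). X (real m) \<omega> = k}"
      by (auto simp: le1 t_def s_def)
    ultimately show ?thesis by (simp add: transition_prob_def t_def s_def)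
  qed
  then show ?thesis
    using measure_partition[OF i, of "real m" "{\<omega>\<in>space (P i). X (real (m + l)) \<omega> = j}"]
      state_event[OF i] by (simp add: transition_prob_def)
qed

lemma transition_prob_mult_le:
  assumes "i \<in> S" "k \<in> S" "j \<in> S"
  shows "transition_prob P X i k m * transition_prob P X k j l \<le> transition_prob P X i j (m + l)"
  unfolding chapman_kolmogorov[OF assms(1,3)]
  using assms(2) markov_jump_processD(1)[OF mjp]
  by (intro member_le_sum[where f = "\<lambda>k. transition_prob P X i k m * transition_prob P X k j l"])
    (auto simp: transition_prob_nonneg)

text \<open>Almost every path has a last visit to \<open>i\<close>, so the indicators of being in
  \<open>i\<close> at time \<open>m\<close> vanish eventually, and dominated convergence
  applies.\<close>

lemma transient_transition_prob_tendsto_0: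
  assumes i: "i \<in> S" and tr: "transient P X i"
  shows "transition_prob P X i i \<longlonglongrightarrow> 0"
proof -
  interpret prob_space "P i" by (rule markov_jump_processD(2)[OF mjp i])
  let ?A = "\<lambda>m. {\<omega>\<in>space (P i). X (real m) \<omega> = i}"
  have "(\<lambda>m. \<integral>\<omega>. indicator (?A m) \<omega> \<partial>P i) \<longlonglongrightarrow> (\<integral>\<omega>. (0::real) \<partial>P i)"
  proof (rule integral_dominated_convergence[where w = "\<lambda>_. 1"])
    show "AE \<omega> in P i. (\<lambda>m. indicator (?A m) \<omega> :: real) \<longlonglongrightarrow> 0"
      using tr unfolding transient_def
    proof eventually_elim
      case (elim \<omega>)
      then obtain B where B: "\<And>t. 0 \<le> t \<Longrightarrow> X t \<omega> = i \<Longrightarrow> t \<le> B" by (auto simp: bdd_above_def)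
      have "\<forall>\<^sub>F m in sequentially. B < real m"
        using filterlim_real_sequentially by (simp add: filterlim_at_top_dense)
      then have "\<forall>\<^sub>F m in sequentially. indicator (?A m) \<omega> = (0::real)"
      proof eventually_elim
        case (elim m)
        then have "X (real m) \<omega> \<noteq> i" using B[of "real m"] by auto
        then show ?case by (simp add: indicator_def)
      qed
      then show ?case by (rule tendsto_eventually)
    qed
  qed (use state_event[OF i] in \<open>auto simp: indicator_def\<close>)
  moreover have "(\<integral>\<omega>. indicator (?A m) \<omega> \<partial>P i) = transition_prob P X i i m" for m
    using state_event[OF i] by (simp add: transition_prob_def)
  ultimately show ?thesis by simp
qed

text \<open>Otherwise a state that does not lead to \<open>\<Delta>\<close> and has a minimal set of successors belongs to
  a finite closed class of transient states, whose total probability would tend to 0.\<close>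
lemma absorbing_state_reachable:
  assumes \<Delta>: "\<Delta> \<in> S" and tr: "\<And>i. i \<in> S - {\<Delta>} \<Longrightarrow> transient P X i" and i: "i \<in> S"
  shows "\<exists>m. 0 < transition_prob P X i \<Delta> m"
proof (rule ccontr)
  let ?p = "transition_prob P X"
  define U where "U = {i\<in>S. \<forall>m. ?p i \<Delta> m = 0}"
  define R where "R i = {k\<in>S. \<exists>m. 0 < ?p i k m}" for i
  have fin: "finite S" by (rule markov_jump_processD(1)[OF mjp])
  have pos: "0 < ?p i k m \<longleftrightarrow> ?p i k m \<noteq> 0" for i k m
    using transition_prob_nonneg[of P X i k m] by auto
  assume "\<nexists>m. 0 < ?p i \<Delta> m"
  then have "i \<in> U" using i by (auto simp: U_def pos)
  \<comment> \<open>Minimality of the number of successors will turn the inclusion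
    \<open>R k \<subseteq> R j\<close> into an equality for every successor \<open>k\<close> of
    \<open>j\<close>.\<close>
  then obtain j where j: "j \<in> U" and min: "\<And>k. k \<in> U \<Longrightarrow> card (R j) \<le> card (R k)"
    using arg_min_nat_lemma[of "\<lambda>k. k \<in> U" i "\<lambda>k. card (R k)"] by blast
  have jS: "j \<in> S" using j by (simp add: U_def)
  have "j \<noteq> \<Delta>" using j transition_prob_0[OF jS, of j] by (auto simp: U_def)
  then have trj: "?p j j \<longlonglongrightarrow> 0"
    using jS tr by (intro transient_transition_prob_tendsto_0) auto
  have returns: "\<exists>m. 0 < ?p k j m" if k: "k \<in> R j" for k
  proof -
    from k obtain m where m: "k \<in> S" "0 < ?p j k m" by (auto simp: R_def)
    have "?p k \<Delta> l = 0" for l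
    proof -
      have "?p j k m * ?p k \<Delta> l \<le> 0"
        using transition_prob_mult_le[OF jS m(1) \<Delta>, of m l] j by (simp add: U_def)
      then show ?thesis
        using m(2) transition_prob_nonneg[of P X k \<Delta> l] by (simp add: mult_le_0_iff)
    qed
    then have "k \<in> U" using m by (simp add: U_def)
    moreover have "R k \<subseteq> R j"
    proof
      fix k' assume "k' \<in> R k"
      then obtain l where l: "k' \<in> S" "0 < ?p k k' l" by (auto simp: R_def)
      have "0 < ?p j k m * ?p k k' l" using m l by simp
      also have "\<dots> \<le> ?p j k' (m + l)" by (rule transition_prob_mult_le[OF jS m(1) l(1)])
      finally show "k' \<in> R j" using l by (auto simp: R_def)
    qed
    moreover have "finite (R j)" using fin by (simp add: R_def)
    ultimately have "R k = R j" using min[of k] by (intro card_seteq) auto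
    moreover have "j \<in> R j"
      using jS transition_prob_0[OF jS, of j] by (auto simp: R_def intro!: exI[of _ 0])
    ultimately show ?thesis by (auto simp: R_def)
  qed
  have "(\<lambda>m. ?p j k m) \<longlonglongrightarrow> 0" if k: "k \<in> S" for k
  proof (cases "k \<in> R j")
    case False
    then have "?p j k m = 0" for m using k pos by (auto simp: R_def)
    then show ?thesis by simp
  next
    case True
    then obtain l where l: "0 < ?p k j l" using returns by auto
    \<comment> \<open>A return from \<open>k\<close> to \<open>j\<close> of fixed length
      \<open>l\<close> and positive probability passes the decay of returns to \<open>j\<close> on
      to \<open>k\<close>.\<close>
    have "(\<lambda>m. ?p j j (m + l) / ?p k j l) \<longlonglongrightarrow> 0 / ?p k j l"
      using l by (intro tendsto_intros LIMSEQ_ignore_initial_segment trj) auto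
    then have lim: "(\<lambda>m. ?p j j (m + l) / ?p k j l) \<longlonglongrightarrow> 0" by simp
    show ?thesis
    proof (rule tendsto_sandwich[OF _ _ tendsto_const lim])
      show "\<forall>\<^sub>F m in sequentially. ?p j k m \<le> ?p j j (m + l) / ?p k j l"
        using transition_prob_mult_le[OF jS k jS, of _ l] l by (simp add: field_simps)
    qed (simp add: transition_prob_nonneg)
  qed
  then have "(\<lambda>m. \<Sum>k\<in>S. ?p j k m) \<longlonglongrightarrow> (\<Sum>k\<in>S. 0)" by (intro tendsto_sum) auto
  then show False by (simp add: sum_transition_prob[OF jS] LIMSEQ_const_iff)
qed

text \<open>Absorption probabilities do not decrease in time and the state space is finite, so a
  single block length \<open>M\<close> gives every state a positive chance of absorption. By the
  Markov property the chances of surviving successive blocks multiply.\<close>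

lemma geometric_absorption:
  assumes \<Delta>: "\<Delta> \<in> S" and abs: "absorbing P X \<Delta>"
    and tr: "\<And>i. i \<in> S - {\<Delta>} \<Longrightarrow> transient P X i"
  obtains M :: nat and q :: real where "0 < M" "0 < q" "q < 1"
    "\<And>i k. i \<in> S \<Longrightarrow> 1 - q ^ k \<le> transition_prob P X i \<Delta> (k * M)"
proof -
  let ?p = "transition_prob P X"
  have fin: "finite S" by (rule markov_jump_processD(1)[OF mjp])
  interpret \<Delta>: prob_space "P \<Delta>" by (rule markov_jump_processD(2)[OF mjp \<Delta>])
  have stay: "?p \<Delta> \<Delta> m = 1" for m
    using abs state_event[OF \<Delta>, of "real m" \<Delta>]
    by (auto simp: transition_prob_def absorbing_def \<Delta>.prob_eq_1 elim!: allE[of _ "real m"] AE_mp)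
  have mono: "?p i \<Delta> m \<le> ?p i \<Delta> (m + l)" if "i \<in> S" for i m l
    using transition_prob_mult_le[OF that \<Delta> \<Delta>, of m l] by (simp add: stay)
  have le1: "?p i \<Delta> m \<le> 1" if "i \<in> S" for i m
    using markov_jump_processD(2)[OF mjp that] by (simp add: transition_prob_def prob_space.prob_le_1)
  from absorbing_state_reachable[OF \<Delta> tr]
  obtain r where r: "\<And>i. i \<in> S \<Longrightarrow> 0 < ?p i \<Delta> (r i)" by metis
  define M where "M = Suc (Max (r ` S))"
  have pM: "0 < ?p i \<Delta> M" if i: "i \<in> S" for i
  proof -
    have "r i \<le> M" using fin i by (auto simp: M_def le_Suc_eq)
    then have "?p i \<Delta> (r i) \<le> ?p i \<Delta> M" using mono[OF i, of "r i" "M - r i"] by simp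
    with r[OF i] show ?thesis by simp
  qed
  define c where "c = Min ((\<lambda>i. ?p i \<Delta> M) ` S)"
  have "c \<in> (\<lambda>i. ?p i \<Delta> M) ` S"
    using fin \<Delta> unfolding c_def by (intro Min_in) auto
  then have c: "0 < c" "\<And>i. i \<in> S \<Longrightarrow> c \<le> ?p i \<Delta> M"
    using fin pM by (auto simp: c_def)
  \<comment> \<open>The maximum with \<open>1 / 2\<close> keeps \<open>q\<close> positive even if
    absorption within one block is certain; a logarithm of \<open>q\<close> is taken later.\<close>
  define q where "q = max (1 / 2) (1 - c)"
  have q: "0 < q" "q < 1" using c(1) by (auto simp: q_def)
  have qM: "1 - ?p i \<Delta> M \<le> q" if "i \<in> S" for i using c(2)[OF that] by (simp add: q_def)
  have geo: "1 - ?p i \<Delta> (k * M) \<le> q ^ k" if "i \<in> S" for i k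
    using that
  proof (induction k arbitrary: i)
    case 0
    then show ?case using transition_prob_nonneg[of P X i \<Delta> 0] by simp
  next
    case (Suc k)
    have "1 - ?p i \<Delta> (Suc k * M) = (\<Sum>j\<in>S. ?p i j M) - (\<Sum>j\<in>S. ?p i j M * ?p j \<Delta> (k * M))"
      using chapman_kolmogorov[OF Suc.prems \<Delta>, of M "k * M"] sum_transition_prob[OF Suc.prems]
      by simp
    also have "\<dots> = (\<Sum>j\<in>S. ?p i j M * (1 - ?p j \<Delta> (k * M)))"
      by (simp add: sum_subtractf[symmetric] algebra_simps)
    \<comment> \<open>The term of \<open>\<Delta>\<close> vanishes because the chain stays there, so
      only survival of the first block is counted.\<close>
    also have "\<dots> = (\<Sum>j\<in>S - {\<Delta>}. ?p i j M * (1 - ?p j \<Delta> (k * M)))"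
      using fin \<Delta> by (simp add: sum.remove stay)
    also have "\<dots> \<le> (\<Sum>j\<in>S - {\<Delta>}. ?p i j M * q ^ k)"
      by (intro sum_mono mult_left_mono Suc.IH) (auto simp: transition_prob_nonneg)
    also have "\<dots> = (1 - ?p i \<Delta> M) * q ^ k"
      using fin \<Delta> sum_transition_prob[OF Suc.prems, of M]
      by (simp add: sum.remove sum_distrib_right[symmetric])
    also have "\<dots> \<le> q * q ^ k"
      using q qM[OF Suc.prems] by (intro mult_right_mono) auto
    finally show ?case by simp
  qed
  show thesis
  proof (rule that[of M q])
    fix i k assume "i \<in> S"
    then show "1 - q ^ k \<le> ?p i \<Delta> (k * M)" using geo[of i k] by linarith
  qed (use q in \<open>auto simp: M_def\<close>)
qed

section \<open>Measurability of the absorption time\<close>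

text \<open>By right continuity a visit to \<open>\<Delta>\<close> is also seen at rational times
  just after it, which reduces the infimum over uncountably many times to countably many state
  events. The last alternative collects the paths that never visit \<open>\<Delta>\<close>; for them
  the value is the unspecified real \<open>Inf {}\<close>.\<close>

lemma absorption_time_le_iff:
  assumes i: "i \<in> S" and \<omega>: "\<omega> \<in> space (P i)" and x: "0 \<le> x"
  shows "absorption_time X \<Delta> \<omega> \<le> x \<longleftrightarrow>
    X x \<omega> = \<Delta> \<or> (\<exists>r\<in>\<rat>. 0 \<le> r \<and> r < x \<and> X r \<omega> = \<Delta>) \<or>
    ((\<forall>r\<in>\<rat>. 0 \<le> r \<longrightarrow> X r \<omega> \<noteq> \<Delta>) \<and> Inf {} \<le> x)"
proof -
  define H where "H = {t. 0 \<le> t \<and> X t \<omega> = \<Delta>}"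
  have bdd: "bdd_below H" by (auto simp: H_def bdd_below_def)
  have rat: "\<exists>r\<in>\<rat>. t < r \<and> r < y \<and> X r \<omega> = \<Delta>" if tH: "t \<in> H" and ty: "t < y" for t y
  proof -
    have "\<forall>\<^sub>F s in at_right t. X s \<omega> = X t \<omega>"
      using tH by (intro markov_jump_processD(5)[OF mjp i \<omega>]) (auto simp: H_def)
    then obtain b where b: "t < b" "\<And>s. t < s \<Longrightarrow> s < b \<Longrightarrow> X s \<omega> = X t \<omega>"
      by (auto simp: eventually_at_right_field)
    obtain r where "r \<in> \<rat>" "t < r" "r < min b y"
      using Rats_dense_in_real[of t "min b y"] b(1) ty by auto
    then show ?thesis using b(2)[of r] tH by (auto simp: H_def)
  qed
  show ?thesis
  proof (cases "H = {}")
    case True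
    then have "X t \<omega> \<noteq> \<Delta>" if "0 \<le> t" for t using that by (auto simp: H_def)
    moreover have "absorption_time X \<Delta> \<omega> = Inf {}"
      by (simp only: absorption_time_def True[unfolded H_def])
    ultimately show ?thesis using x by auto
  next
    case False
    define s where "s = Inf H"
    have s0: "0 \<le> s" using False by (auto simp: s_def H_def intro!: cInf_greatest)
    have lower: "s \<le> t" if "t \<in> H" for t
      unfolding s_def using bdd that by (rule cInf_lower[rotated])
    \<comment> \<open>Right continuity makes the infimum attained: the state is constant just after
      \<open>s\<close>, and visits to \<open>\<Delta>\<close> occur arbitrarily close after
      \<open>s\<close> if not at \<open>s\<close>.\<close>
    have sH: "s \<in> H"
    proof (rule ccontr)
      assume "s \<notin> H"
      have "\<forall>\<^sub>F r in at_right s. X r \<omega> = X s \<omega>"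
        by (rule markov_jump_processD(5)[OF mjp i \<omega> s0])
      then obtain b where b: "s < b" "\<And>r. s < r \<Longrightarrow> r < b \<Longrightarrow> X r \<omega> = X s \<omega>"
        by (auto simp: eventually_at_right_field)
      obtain t where t: "t \<in> H" "t < b"
        using b(1) False bdd by (auto simp: s_def cInf_less_iff)
      then have "s < t" using lower[OF t(1)] \<open>s \<notin> H\<close> by (cases "s = t") auto
      with b(2)[of t] t have "X s \<omega> = \<Delta>" by (auto simp: H_def)
      then show False using s0 \<open>s \<notin> H\<close> by (simp add: H_def)
    qed
    have abs: "absorption_time X \<Delta> \<omega> = s" by (simp add: absorption_time_def s_def H_def)
    obtain r where r: "r \<in> \<rat>" "s < r" "X r \<omega> = \<Delta>" using rat[OF sH, of "s + 1"] by auto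
    have "0 \<le> r" using s0 r(2) by linarith
    with r have notN: "\<not> (\<forall>r\<in>\<rat>. 0 \<le> r \<longrightarrow> X r \<omega> \<noteq> \<Delta>)" by blast
    show ?thesis
    proof
      assume "absorption_time X \<Delta> \<omega> \<le> x"
      then consider "s = x" | "s < x" using abs by linarith
      then show "X x \<omega> = \<Delta> \<or> (\<exists>r\<in>\<rat>. 0 \<le> r \<and> r < x \<and> X r \<omega> = \<Delta>) \<or>
          ((\<forall>r\<in>\<rat>. 0 \<le> r \<longrightarrow> X r \<omega> \<noteq> \<Delta>) \<and> Inf {} \<le> x)"
      proof cases
        case 1
        then show ?thesis using sH by (auto simp: H_def)
      next
        case 2
        then obtain r where r: "r \<in> \<rat>" "s < r" "r < x" "X r \<omega> = \<Delta>" using rat[OF sH] by blast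
        then have "0 \<le> r" using s0 by linarith
        with r show ?thesis by blast
      qed
    next
      assume "X x \<omega> = \<Delta> \<or> (\<exists>r\<in>\<rat>. 0 \<le> r \<and> r < x \<and> X r \<omega> = \<Delta>) \<or>
          ((\<forall>r\<in>\<rat>. 0 \<le> r \<longrightarrow> X r \<omega> \<noteq> \<Delta>) \<and> Inf {} \<le> x)"
      then obtain t where "t \<in> H" "t \<le> x" using notN x by (auto simp: H_def)
      then show "absorption_time X \<Delta> \<omega> \<le> x" using lower[of t] abs by simp
    qed
  qed
qed

lemma absorption_time_event:
  assumes i: "i \<in> S" and x: "0 \<le> x"
  shows "{\<omega>\<in>space (P i). absorption_time X \<Delta> \<omega> \<le> x} \<in> sets (P i)"
proof -
  let ?E = "\<lambda>t. {\<omega>\<in>space (P i). X t \<omega> = \<Delta>}"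
  have "{\<omega>\<in>space (P i). absorption_time X \<Delta> \<omega> \<le> x} =
      ?E x \<union> (\<Union>r\<in>{r\<in>\<rat>. 0 \<le> r \<and> r < x}. ?E r) \<union>
      (if Inf {} \<le> x then space (P i) - (\<Union>r\<in>{r\<in>\<rat>. 0 \<le> r}. ?E r) else {})"
    using absorption_time_le_iff[OF i _ x, of _ \<Delta>] by auto
  also have "\<dots> \<in> sets (P i)"
    using state_event[OF i] x
    by (auto intro!: sets.countable_UN'' countable_subset[OF _ countable_rat] sets.Un sets.Diff)
  finally show ?thesis .
qed

end

theorem phase_type_exponential_tail:
  assumes ph: "phase_type S \<Delta> \<alpha> P X F"
  obtains K c :: real where "0 < c" "\<And>x. 0 \<le> x \<Longrightarrow> tail F x \<le> K * exp (- c * x)"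
proof -
  have mjp: "markov_jump_process S P X" and \<Delta>: "\<Delta> \<in> S" and abs: "absorbing P X \<Delta>"
    and tr: "\<And>i. i \<in> S - {\<Delta>} \<Longrightarrow> transient P X i"
    and \<alpha>: "\<And>i. i \<in> S \<Longrightarrow> 0 \<le> \<alpha> i" "(\<Sum>i\<in>S. \<alpha> i) = 1"
    and cdf: "\<And>x. cdf F x =
        (\<Sum>i\<in>S. \<alpha> i * measure (P i) {\<omega>\<in>space (P i). absorption_time X \<Delta> \<omega> \<le> x})"
    using ph by (auto simp: phase_type_def)
  obtain M q where M: "0 < M" and q: "0 < q" "q < 1"
    and geo: "\<And>i k. i \<in> S \<Longrightarrow> 1 - q ^ k \<le> transition_prob P X i \<Delta> (k * M)"
    using geometric_absorption[OF mjp \<Delta> abs tr] by metis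
  \<comment> \<open>Chosen so that \<open>exp (- c * real M) = q\<close>.\<close>
  define c where "c = - ln q / real M"
  have c: "0 < c" using q M ln_less_zero[of q] by (simp add: c_def divide_neg_pos)
  show thesis
  proof (rule that[OF c, of "1 / q"])
    fix x :: real assume x: "0 \<le> x"
    \<comment> \<open>The number of complete blocks before \<open>x\<close>. It may fall short of
      \<open>x / real M\<close> by up to one, which costs the factor \<open>1 / q\<close>.\<close>
    define k where "k = nat \<lfloor>x / real M\<rfloor>"
    have k: "real k \<le> x / real M" "x / real M - 1 \<le> real k"
      using x M by (auto simp: k_def)
    have kx: "real (k * M) \<le> x" using k(1) M by (simp add: field_simps)
    have "1 - q ^ k \<le> measure (P i) {\<omega>\<in>space (P i). absorption_time X \<Delta> \<omega> \<le> x}" if i: "i \<in> S" for i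
    proof -
      interpret prob_space "P i" by (rule markov_jump_processD(2)[OF mjp i])
      have "absorption_time X \<Delta> \<omega> \<le> x" if "X (real (k * M)) \<omega> = \<Delta>" for \<omega>
      proof -
        have "absorption_time X \<Delta> \<omega> \<le> real (k * M)"
          unfolding absorption_time_def using that
          by (intro cInf_lower) (auto simp: bdd_below_def)
        with kx show ?thesis by simp
      qed
      then have "transition_prob P X i \<Delta> (k * M) \<le> prob {\<omega>\<in>space (P i). absorption_time X \<Delta> \<omega> \<le> x}"
        unfolding transition_prob_def
        by (intro finite_measure_mono absorption_time_event[OF mjp i x]) auto
      with geo[OF i, of k] show ?thesis by linarith
    qed
    then have "(\<Sum>i\<in>S. \<alpha> i * (1 - q ^ k)) \<le> cdf F x"
      unfolding cdf by (intro sum_mono mult_left_mono \<alpha>(1))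
    then have "tail F x \<le> q ^ k"
      by (simp add: tail_def sum_distrib_right[symmetric] \<alpha>(2))
    also have "q ^ k = exp (ln q * real k)"
      using q by (simp add: exp_of_nat2_mult)
    also have "\<dots> \<le> exp (ln q * (x / real M - 1))"
      using k(2) q by (simp add: mult_left_mono_neg)
    also have "\<dots> = 1 / q * exp (- c * x)"
      using q by (simp add: c_def right_diff_distrib exp_diff)
    finally show "tail F x \<le> 1 / q * exp (- c * x)" .
  qed
qed

section \<open>Exponential tail of the surplus supremum\<close>

text \<open>The slopes of secants of a convex function through a fixed point increase. This bounds
  the difference quotients of the moment generating function uniformly.\<close>

lemma exp_secant_le:
  fixes h g x :: real
  assumes "0 < h" "h \<le> g"
  shows "(exp (h * x) - 1) / h \<le> (exp (g * x) - 1) / g"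
proof -
  have "exp ((1 - h / g) *\<^sub>R 0 + (h / g) *\<^sub>R (g * x)) \<le> (1 - h / g) * exp 0 + h / g * exp (g * x)"
    using assms by (intro convex_onD[OF exp_convex]) auto
  then have "exp (h * x) - 1 \<le> h / g * (exp (g * x) - 1)"
    using assms by (simp add: algebra_simps)
  then show ?thesis using assms by (simp add: field_simps)
qed

text \<open>The derivative at 0 of the moment generating function is the mean.\<close>
lemma (in prob_space) negative_mean_exponential_moment:
  fixes D :: "'a \<Rightarrow> real"
  assumes D: "integrable M D" "expectation D < 0"
    and g: "0 < g" "integrable M (\<lambda>\<omega>. exp (g * D \<omega>))"
  obtains h where "0 < h" "h \<le> g" "integrable M (\<lambda>\<omega>. exp (h * D \<omega>))"
    "expectation (\<lambda>\<omega>. exp (h * D \<omega>)) < 1"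
proof -
  have [measurable]: "D \<in> borel_measurable M" using D by auto
  define h where "h n = g / real (Suc n)" for n
  have h: "0 < h n" "h n \<le> g" for n using g(1) by (auto simp: h_def field_simps)
  have lower: "x \<le> (exp (h n * x) - 1) / h n" for n x
    using exp_ge_add_one_self[of "h n * x"] h(1)[of n] by (simp add: field_simps)
  have "h \<longlonglongrightarrow> 0"
    unfolding h_def by (rule LIMSEQ_Suc[OF lim_const_over_n])
  then have h0: "filterlim h (at 0) sequentially"
    using h(1) by (auto simp: filterlim_at less_imp_neq[symmetric])
  have lim: "(\<lambda>n. (exp (h n * x) - 1) / h n) \<longlonglongrightarrow> x" for x
  proof -
    have "((\<lambda>y. exp (y * x)) has_real_derivative x) (at 0)"
      by (auto intro!: derivative_eq_intros)
    then have "((\<lambda>y. (exp (y * x) - 1) / y) \<longlongrightarrow> x) (at 0)"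
      by (simp add: DERIV_def)
    from filterlim_compose[OF this h0] show ?thesis .
  qed
  \<comment> \<open>The tangent at 0 bounds the quotient from below by \<open>D \<omega>\<close>,
    the secant at \<open>g\<close> bounds it from above.\<close>
  have bound: "norm ((exp (h n * D \<omega>) - 1) / h n) \<le> \<bar>D \<omega>\<bar> + exp (g * D \<omega>) / g" for n \<omega>
  proof -
    have "(exp (h n * D \<omega>) - 1) / h n \<le> (exp (g * D \<omega>) - 1) / g"
      by (rule exp_secant_le[OF h])
    also have "\<dots> \<le> exp (g * D \<omega>) / g" using g(1) by (simp add: divide_right_mono)
    finally have "(exp (h n * D \<omega>) - 1) / h n \<le> exp (g * D \<omega>) / g" .
    moreover have "0 \<le> exp (g * D \<omega>) / g" using g(1) by simp
    ultimately show ?thesis using lower[of "D \<omega>" n] unfolding real_norm_def by linarith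
  qed
  have dom: "integrable M (\<lambda>\<omega>. \<bar>D \<omega>\<bar> + exp (g * D \<omega>) / g)"
    using D(1) g(2) by auto
  have int: "integrable M (\<lambda>\<omega>. (exp (h n * D \<omega>) - 1) / h n)" for n
  proof (rule Bochner_Integration.integrable_bound[OF dom])
    show "AE \<omega> in M. norm ((exp (h n * D \<omega>) - 1) / h n) \<le> norm (\<bar>D \<omega>\<bar> + exp (g * D \<omega>) / g)"
      using order_trans[OF bound abs_ge_self] by simp
  qed simp
  have "(\<lambda>n. expectation (\<lambda>\<omega>. (exp (h n * D \<omega>) - 1) / h n)) \<longlonglongrightarrow> expectation D"
    by (rule integral_dominated_convergence[OF _ _ dom]) (use lim bound in auto)
  then have "\<forall>\<^sub>F n in sequentially. expectation (\<lambda>\<omega>. (exp (h n * D \<omega>) - 1) / h n) < 0"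
    using D(2) by (rule order_tendstoD)
  then obtain n where n: "expectation (\<lambda>\<omega>. (exp (h n * D \<omega>) - 1) / h n) < 0"
    by (auto simp: eventually_sequentially)
  have "integrable M (\<lambda>\<omega>. h n * ((exp (h n * D \<omega>) - 1) / h n) + 1)"
    using int[of n] by (intro Bochner_Integration.integrable_add integrable_mult_right) auto
  then have int_exp: "integrable M (\<lambda>\<omega>. exp (h n * D \<omega>))"
    using h(1)[of n] by simp
  have "expectation (\<lambda>\<omega>. (exp (h n * D \<omega>) - 1) / h n) = (expectation (\<lambda>\<omega>. exp (h n * D \<omega>)) - 1) / h n"
    using int_exp by (simp add: prob_space)
  with n h(1)[of n] have "expectation (\<lambda>\<omega>. exp (h n * D \<omega>)) < 1"
    by (simp add: divide_less_0_iff)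
  then show thesis using that h int_exp by blast
qed

text \<open>Cutting the half-line into unit layers, the layer above \<open>k\<close> contributes at
  most \<open>exp (\<gamma> * (real k + 1))\<close> times the tail at \<open>k\<close>; these
  products form a geometric series of ratio \<open>exp (\<gamma> - c)\<close>.\<close>

lemma exponential_tail_imp_exponential_moment:
  assumes F: "real_distribution F" and \<gamma>: "0 < \<gamma>" "\<gamma> < c"
    and K: "\<And>x. 0 \<le> x \<Longrightarrow> tail F x \<le> K * exp (- c * x)"
  shows "integrable F (\<lambda>x. exp (\<gamma> * x))"
proof (rule integrableI_bounded)
  interpret F: real_distribution F by fact
  show "(\<lambda>x. exp (\<gamma> * x)) \<in> borel_measurable F" by simp
  let ?e = "\<lambda>k. ennreal (exp (\<gamma> * (real k + 1)))"
  have "(\<integral>\<^sup>+x. ennreal (norm (exp (\<gamma> * x))) \<partial>F)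
      \<le> (\<integral>\<^sup>+x. 1 + (\<Sum>k. ?e k * indicator {real k<..} x) \<partial>F)"
  proof (rule nn_integral_mono)
    fix x :: real
    show "ennreal (norm (exp (\<gamma> * x))) \<le> 1 + (\<Sum>k. ?e k * indicator {real k<..} x)"
    proof (cases "x \<le> 0")
      case True
      then have "ennreal (exp (\<gamma> * x)) \<le> 1" using \<gamma> by (simp add: mult_nonneg_nonpos)
      then show ?thesis by (simp add: add_increasing2)
    next
      case False
      \<comment> \<open>Ceiling minus one, not the floor: the layer \<open>{real k<..}\<close> is
        open, so \<open>k\<close> must lie strictly below \<open>x\<close> even if \<open>x\<close>
        is an integer.\<close>
      define k where "k = nat (\<lceil>x\<rceil> - 1)"
      have k: "real k < x" "x \<le> real k + 1"
        using False by (auto simp: k_def) linarith+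
      have "ennreal (exp (\<gamma> * x)) \<le> ?e k * indicator {real k<..} x"
        using k \<gamma> by (auto simp: ennreal_leI)
      also have "\<dots> = (\<Sum>i\<in>{k}. ?e i * indicator {real i<..} x)"
        by (simp only: sum.insert[OF finite.emptyI] sum.empty add_0_right empty_iff not_False_eq_True)
      also have "\<dots> \<le> (\<Sum>k. ?e k * indicator {real k<..} x)"
        by (intro sum_le_suminf) auto
      also have "\<dots> \<le> 1 + (\<Sum>k. ?e k * indicator {real k<..} x)" by simp
      finally show ?thesis by simp
    qed
  qed
  also have "\<dots> = 1 + (\<Sum>k. ?e k * emeasure F {real k<..})"
    using F.emeasure_space_1
    by (subst nn_integral_add) (auto simp: nn_integral_suminf nn_integral_cmult)
  also have "\<dots> \<le> 1 + (\<Sum>k. ennreal (exp \<gamma> * \<bar>K\<bar> * exp (\<gamma> - c) ^ k))"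
  proof (intro add_left_mono suminf_le allI)
    fix k
    have "exp (\<gamma> * (real k + 1)) * tail F (real k) \<le> exp (\<gamma> * (real k + 1)) * (\<bar>K\<bar> * exp (- c * real k))"
      by (intro mult_left_mono order_trans[OF K mult_right_mono]) auto
    also have "\<dots> = exp \<gamma> * \<bar>K\<bar> * exp (\<gamma> - c) ^ k"
      by (simp add: exp_of_nat_mult[symmetric] mult_exp_exp algebra_simps)
    finally show "?e k * emeasure F {real k<..} \<le> ennreal (exp \<gamma> * \<bar>K\<bar> * exp (\<gamma> - c) ^ k)"
      by (simp add: F.emeasure_eq_measure measure_Ioi[OF F] ennreal_mult[symmetric]
          tail_nonneg[OF F] ennreal_leI)
  qed auto
  also have "\<dots> = 1 + ennreal (\<Sum>k. exp \<gamma> * \<bar>K\<bar> * exp (\<gamma> - c) ^ k)"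
    using \<gamma> by (subst suminf_ennreal2) (auto intro!: summable_mult summable_geometric)
  also have "\<dots> < \<infinity>" by simp
  finally show "(\<integral>\<^sup>+x. ennreal (norm (exp (\<gamma> * x))) \<partial>F) < \<infinity>" .
qed

section \<open>From the surplus process to the embedded random walk\<close>

text \<open>Between claims the surplus only decreases, so its value at \<open>t\<close> is at most
  its value at the last claim before \<open>t\<close>.\<close>

lemma claim_surplus_le_random_walk:
  assumes T: "\<And>i. 0 < T i \<omega>" and t: "0 \<le> t"
  shows "\<exists>n. claim_surplus T Y t \<omega> \<le> (\<Sum>i<n. Y i \<omega> - T i \<omega>)"
proof -
  define A where "A = {n. (\<Sum>i\<le>n. T i \<omega>) \<le> t}"
  define k where "k = claim_count T t \<omega>"
  have k: "k = card A" by (simp add: k_def claim_count_def A_def)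
  have "(\<Sum>i<k. T i \<omega>) \<le> t"
  proof (cases k)
    case (Suc m)
    \<comment> \<open>An infinite set has \<open>card\<close> 0, so a path with infinitely many
      arrivals before \<open>t\<close> falls under the case \<open>k = 0\<close>, where the sum is
      empty. In the present case \<open>A\<close> is finite and, being closed downwards, has
      \<open>m\<close> as an element.\<close>
    have fin: "finite A" using Suc k card.infinite by fastforce
    have "m \<in> A"
    proof (rule ccontr)
      assume m: "m \<notin> A"
      have "A \<subseteq> {..<m}"
      proof
        fix n assume n: "n \<in> A"
        show "n \<in> {..<m}"
        proof (rule ccontr)
          assume "n \<notin> {..<m}"
          then have "(\<Sum>i\<le>m. T i \<omega>) \<le> (\<Sum>i\<le>n. T i \<omega>)"
            using T by (intro sum_mono2) (auto simp: less_imp_le)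
          with n m show False by (simp add: A_def)
        qed
      qed
      then have "card A \<le> m" using card_mono[of "{..<m}" A] by simp
      with k Suc show False by simp
    qed
    then show ?thesis by (simp add: A_def Suc lessThan_Suc_atMost)
  qed (simp add: t)
  then have "claim_surplus T Y t \<omega> \<le> (\<Sum>i<k. Y i \<omega> - T i \<omega>)"
    by (simp add: claim_surplus_def k_def sum_subtractf)
  then show ?thesis by blast
qed

text \<open>Since time 0 belongs to the range of the supremum, this makes the supremum
  nonnegative.\<close>

lemma claim_surplus_0:
  assumes T: "\<And>i. 0 < T i \<omega>"
  shows "claim_surplus T Y 0 \<omega> = 0"
proof -
  have "0 < (\<Sum>i\<le>n. T i \<omega>)" for n using T by (intro sum_pos) auto
  then have "{n. (\<Sum>i\<le>n. T i \<omega>) \<le> 0} = {}" by (auto simp: not_le)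
  then show ?thesis by (simp add: claim_surplus_def claim_count_def)
qed

text \<open>With \<open>r = E exp (\<gamma> (Y - T)) < 1\<close>, summing the Chernoff bounds \<open>r^n exp (- \<gamma> u)\<close> of the
  embedded random walk over \<open>n\<close> suffices.\<close>
theorem surplus_supremum_exponential_tail:
  assumes model: "compound_poisson_model Q \<beta> F T Y" and R: "surplus_supremum Q T Y R"
    and \<beta>: "0 < \<beta>" and F: "integrable F (\<lambda>x. x)" "\<beta> * mean F < 1"
    and c: "0 < c" "\<And>x. 0 \<le> x \<Longrightarrow> tail F x \<le> K * exp (- c * x)"
  shows "nonneg_law (distr Q borel R)"
    "\<exists>\<gamma>>0. \<exists>K. \<forall>u. tail (distr Q borel R) u \<le> K * exp (- \<gamma> * u)"
proof -
  interpret Q: prob_space Q using model by (simp add: compound_poisson_model_def)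
  have indep: "Q.indep_vars (\<lambda>_. borel) (case_sum T Y) UNIV"
    and T: "\<And>i. distributed Q lborel (T i) (exponential_density \<beta>)"
    and Y: "\<And>i. distr Q borel (Y i) = F"
    using model by (auto simp: compound_poisson_model_def)
  have rv: "case_sum T Y i \<in> borel_measurable Q" for i
    using indep by (simp add: Q.indep_vars_def)
  have [measurable]: "T i \<in> borel_measurable Q" "Y i \<in> borel_measurable Q" for i
    using rv[of "Inl i"] rv[of "Inr i"] by auto
  have [measurable]: "R \<in> borel_measurable Q" using R by (simp add: surplus_supremum_def)
  have rdF: "real_distribution F" using Q.real_distribution_distr[of "Y 0"] unfolding Y by simp
  have "AE \<omega> in Q. 0 < T i \<omega>" for i
  proof -
    have "Q.prob {\<omega>\<in>space Q. 0 < T i \<omega>} = 1"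
      using Q.exponential_distributedD_gt[OF T _ \<beta>, of 0 i] by simp
    from Q.AE_prob_1[OF this] show ?thesis by auto
  qed
  then have Tpos: "AE \<omega> in Q. \<forall>i. 0 < T i \<omega>" unfolding AE_all_countable by blast
  have sup: "AE \<omega> in Q. ereal (R \<omega>) = (SUP t\<in>{0..}. ereal (claim_surplus T Y t \<omega>))"
    using R by (simp add: surplus_supremum_def)
  have rdR: "real_distribution (distr Q borel R)" by (rule Q.real_distribution_distr) simp
  have "AE \<omega> in Q. 0 \<le> R \<omega>"
    using Tpos sup
  proof eventually_elim
    case (elim \<omega>)
    have "ereal (claim_surplus T Y 0 \<omega>) \<le> ereal (R \<omega>)"
      unfolding elim(2) by (intro SUP_upper) auto
    then show ?case using claim_surplus_0[of T \<omega> Y] elim(1) by simp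
  qed
  then show "nonneg_law (distr Q borel R)"
    using rdR by (auto simp: nonneg_law_def intro!: AE_distr_iff[THEN iffD2])
  define D where "D \<omega> = Y 0 \<omega> - T 0 \<omega>" for \<omega>
  have intY: "integrable Q (Y 0)"
    by (rule integrable_distr[of "Y 0" Q borel "\<lambda>x. x"]) (simp, simp only: Y F(1))
  have meanY: "Q.expectation (Y 0) = mean F"
    unfolding mean_def Y[of 0, symmetric] by (rule integral_distr[symmetric]) simp_all
  have meanT: "Q.expectation (T 0) = 1 / \<beta>"
    by (rule Q.exponential_distributed_expectation[OF \<beta> T])
  \<comment> \<open>The Bochner integral of a non-integrable function is 0, so the nonzero mean
    already yields integrability.\<close>
  then have intT: "integrable Q (T 0)"
    using \<beta> not_integrable_integral_eq[of Q "T 0"] by auto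
  have D: "integrable Q D" "Q.expectation D < 0"
    using intY intT F(2) \<beta> by (auto simp: D_def[abs_def] meanY meanT field_simps)
  \<comment> \<open>Any exponent strictly between 0 and the tail rate \<open>c\<close> would
    do.\<close>
  have "integrable F (\<lambda>x. exp (c / 2 * x))"
    by (rule exponential_tail_imp_exponential_moment[OF rdF _ _ c(2)]) (use c(1) in auto)
  then have expY: "integrable Q (\<lambda>\<omega>. exp (c / 2 * Y 0 \<omega>))"
    by (intro integrable_distr[of "Y 0" Q borel "\<lambda>x. exp (c / 2 * x)"]) (simp, simp only: Y)
  have "integrable Q (\<lambda>\<omega>. exp (c / 2 * D \<omega>))"
  proof (rule Bochner_Integration.integrable_bound[OF expY])
    show "AE \<omega> in Q. norm (exp (c / 2 * D \<omega>)) \<le> norm (exp (c / 2 * Y 0 \<omega>))"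
      using Tpos by eventually_elim (use c(1) in \<open>simp add: D_def less_imp_le\<close>)
  qed (simp add: D_def)
  then obtain \<gamma> where \<gamma>: "0 < \<gamma>" and int: "integrable Q (\<lambda>\<omega>. exp (\<gamma> * D \<omega>))"
    and less1: "Q.expectation (\<lambda>\<omega>. exp (\<gamma> * D \<omega>)) < 1"
    using Q.negative_mean_exponential_moment[OF D, of "c / 2"] c(1) by (metis half_gt_zero)
  define r where "r = Q.expectation (\<lambda>\<omega>. exp (\<gamma> * D \<omega>))"
  have r: "0 \<le> r" "r < 1" using less1 by (auto simp: r_def)
  define S where "S n \<omega> = (\<Sum>i<n. Y i \<omega> - T i \<omega>)" for n \<omega>
  have [measurable]: "S n \<in> borel_measurable Q" for n by (simp add: S_def[abs_def])
  \<comment> \<open>Nonnegative integrals let the expectation of the product factorise without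
    integrability conditions on the separate factors.\<close>
  define A where "A = (\<integral>\<^sup>+x. ennreal (exp (- \<gamma> * x)) \<partial>density lborel (exponential_density \<beta>))"
  define B where "B = (\<integral>\<^sup>+x. ennreal (exp (\<gamma> * x)) \<partial>F)"
  have TA: "(\<integral>\<^sup>+\<omega>. ennreal (exp (- \<gamma> * T i \<omega>)) \<partial>Q) = A" for i
    unfolding A_def distributed_distr_eq_density[OF T, of i, symmetric]
    by (subst nn_integral_distr) auto
  have YB: "(\<integral>\<^sup>+\<omega>. ennreal (exp (\<gamma> * Y i \<omega>)) \<partial>Q) = B" for i
    unfolding B_def Y[of i, symmetric] by (subst nn_integral_distr) auto
  have mgf: "(\<integral>\<^sup>+\<omega>. ennreal (exp (\<gamma> * S n \<omega>)) \<partial>Q) = (A * B) ^ n" for n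
  proof -
    \<comment> \<open>Independence is given jointly over the sum type, so the exponential of the
      walk is written as one product over both kinds of index.\<close>
    define Z where "Z i x = ennreal (case i of Inl j \<Rightarrow> exp (- \<gamma> * x) | Inr j \<Rightarrow> exp (\<gamma> * x))"
      for i :: "nat + nat" and x :: real
    have "Z i \<in> borel_measurable borel" for i by (cases i) (simp_all add: Z_def[abs_def])
    then have "Q.indep_vars (\<lambda>_. borel) (\<lambda>i \<omega>. Z i (case_sum T Y i \<omega>)) UNIV"
      by (intro Q.indep_vars_compose2[OF indep]) auto
    then have ind: "Q.indep_vars (\<lambda>_. borel) (\<lambda>i \<omega>. Z i (case_sum T Y i \<omega>)) ({..<n} <+> {..<n})"
      by (rule Q.indep_vars_subset) simp
    have "ennreal (exp (\<gamma> * S n \<omega>)) = (\<Prod>i\<in>{..<n} <+> {..<n}. Z i (case_sum T Y i \<omega>))" for \<omega>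
    proof -
      have "exp (\<gamma> * S n \<omega>) = (\<Prod>i<n. exp (- \<gamma> * T i \<omega>)) * (\<Prod>i<n. exp (\<gamma> * Y i \<omega>))"
        by (simp add: S_def sum_distrib_left exp_sum[symmetric] mult_exp_exp sum_subtractf
            right_diff_distrib sum_negf)
      then show ?thesis
        by (simp add: prod.Plus Z_def prod_ennreal ennreal_mult' prod_nonneg o_def)
    qed
    then have "(\<integral>\<^sup>+\<omega>. ennreal (exp (\<gamma> * S n \<omega>)) \<partial>Q)
        = (\<integral>\<^sup>+\<omega>. (\<Prod>i\<in>{..<n} <+> {..<n}. Z i (case_sum T Y i \<omega>)) \<partial>Q)" by simp
    also have "\<dots> = (\<Prod>i\<in>{..<n} <+> {..<n}. \<integral>\<^sup>+\<omega>. Z i (case_sum T Y i \<omega>) \<partial>Q)"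
      by (rule Q.indep_vars_nn_integral[OF _ ind]) auto
    also have "\<dots> = A ^ n * B ^ n"
      using TA YB by (simp add: prod.Plus Z_def o_def)
    finally show ?thesis by (simp add: power_mult_distrib)
  qed
  \<comment> \<open>The case \<open>n = 1\<close> identifies the product of the two factors, which
    is all that is used of them.\<close>
  have "A * B = (\<integral>\<^sup>+\<omega>. ennreal (exp (\<gamma> * D \<omega>)) \<partial>Q)"
    using mgf[of 1] by (simp add: S_def D_def)
  also have "\<dots> = ennreal r" unfolding r_def by (rule nn_integral_eq_integral[OF int]) simp
  finally have AB: "A * B = ennreal r" .
  have tail: "emeasure Q {\<omega>\<in>space Q. u < S n \<omega>} \<le> ennreal (exp (- \<gamma> * u) * r ^ n)" for u n
  proof -
    have "emeasure Q {\<omega>\<in>space Q. u < S n \<omega>} = (\<integral>\<^sup>+\<omega>. indicator {\<omega>\<in>space Q. u < S n \<omega>} \<omega> \<partial>Q)"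
      by simp
    also have "\<dots> \<le> (\<integral>\<^sup>+\<omega>. ennreal (exp (- \<gamma> * u)) * ennreal (exp (\<gamma> * S n \<omega>)) \<partial>Q)"
    proof (rule nn_integral_mono)
      fix \<omega>
      have "1 \<le> ennreal (exp (- \<gamma> * u)) * ennreal (exp (\<gamma> * S n \<omega>))" if "u < S n \<omega>"
        using that \<gamma> by (simp add: ennreal_mult[symmetric] mult_exp_exp del: ennreal_1 flip: ennreal_1)
      then show "indicator {\<omega>\<in>space Q. u < S n \<omega>} \<omega>
          \<le> ennreal (exp (- \<gamma> * u)) * ennreal (exp (\<gamma> * S n \<omega>))"
        by (auto simp: indicator_def)
    qed
    also have "\<dots> = ennreal (exp (- \<gamma> * u)) * ennreal r ^ n"
      by (subst nn_integral_cmult) (auto simp: mgf AB)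
    also have "\<dots> = ennreal (exp (- \<gamma> * u) * r ^ n)"
      using r by (simp add: ennreal_mult ennreal_power)
    finally show ?thesis .
  qed
  have "tail (distr Q borel R) u \<le> 1 / (1 - r) * exp (- \<gamma> * u)" for u
  proof -
    have "emeasure Q {\<omega>\<in>space Q. u < R \<omega>} \<le> emeasure Q (\<Union>n. {\<omega>\<in>space Q. u < S n \<omega>})"
    proof (rule emeasure_mono_AE)
      show "AE \<omega> in Q. \<omega> \<in> {\<omega>\<in>space Q. u < R \<omega>} \<longrightarrow> \<omega> \<in> (\<Union>n. {\<omega>\<in>space Q. u < S n \<omega>})"
        using Tpos sup
      proof (eventually_elim, intro impI)
        case (elim \<omega>)
        assume \<omega>: "\<omega> \<in> {\<omega>\<in>space Q. u < R \<omega>}"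
        then have "ereal u < (SUP t\<in>{0..}. ereal (claim_surplus T Y t \<omega>))"
          using elim(2) by (metis (no_types, lifting) less_ereal.simps(1) mem_Collect_eq)
        then obtain t where "0 \<le> t" "u < claim_surplus T Y t \<omega>" by (auto simp: less_SUP_iff)
        then obtain n where "u < S n \<omega>"
          using claim_surplus_le_random_walk[of T \<omega> t Y] elim(1) by (auto simp: S_def intro: less_le_trans)
        then show "\<omega> \<in> (\<Union>n. {\<omega>\<in>space Q. u < S n \<omega>})" using \<omega> by auto
      qed
    qed measurable
    also have "\<dots> \<le> (\<Sum>n. emeasure Q {\<omega>\<in>space Q. u < S n \<omega>})"
      by (intro emeasure_subadditive_countably) auto
    also have "\<dots> \<le> (\<Sum>n. ennreal (exp (- \<gamma> * u) * r ^ n))"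
      by (intro suminf_le tail) auto
    also have "\<dots> = ennreal (\<Sum>n. exp (- \<gamma> * u) * r ^ n)"
      using r by (intro suminf_ennreal2 summable_mult summable_geometric) auto
    also have "(\<Sum>n. exp (- \<gamma> * u) * r ^ n) = 1 / (1 - r) * exp (- \<gamma> * u)"
      using r by (simp add: suminf_mult suminf_geometric summable_geometric)
    finally have "Q.prob {\<omega>\<in>space Q. u < R \<omega>} \<le> 1 / (1 - r) * exp (- \<gamma> * u)"
      using r by (simp add: Q.emeasure_eq_measure)
    moreover have "tail (distr Q borel R) u = Q.prob {\<omega>\<in>space Q. u < R \<omega>}"
      by (simp add: tail_eq_measure[OF rdR] measure_distr vimage_def Int_def conj_commute)
    ultimately show ?thesis by simp
  qed
  then show "\<exists>\<gamma>>0. \<exists>K. \<forall>u. tail (distr Q borel R) u \<le> K * exp (- \<gamma> * u)"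
    using \<gamma> by blast
qed

section \<open>Tails of the simulated variables\<close>

lemma distr_nonneg_AE:
  assumes "X \<in> borel_measurable Q" "nonneg_law (distr Q borel X)"
  shows "AE \<omega> in Q. 0 \<le> X \<omega>"
  using AE_distrD[OF assms(1) nonneg_lawD(2)[OF assms(2)]] .

context
  fixes \<Omega> :: "'a measure" and FM FC :: "real measure" and a :: real
    and M C :: "nat \<Rightarrow> 'a \<Rightarrow> real" and N :: "'a \<Rightarrow> nat"
  assumes input: "simulation_input \<Omega> FM FC a M C N"
begin

interpretation \<Omega>: prob_space \<Omega>
  using input by (simp add: simulation_input_def)

definition input_indices :: "input_index set" where
  "input_indices = range Base \<union> Excess ` {1..} \<union> {Count}"

lemma input_indep: "\<Omega>.indep_vars (\<lambda>_. borel) (input_var M C N) input_indices"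
  using input by (simp add: simulation_input_def input_indices_def)

lemma input_rv: "i \<in> input_indices \<Longrightarrow> input_var M C N i \<in> borel_measurable \<Omega>"
  using input_indep by (simp add: \<Omega>.indep_vars_def)

lemma base_rv [measurable]: "M k \<in> borel_measurable \<Omega>"
  using input_rv[of "Base k"] by (simp add: input_indices_def)

lemma excess_rv: "1 \<le> k \<Longrightarrow> C k \<in> borel_measurable \<Omega>"
  using input_rv[of "Excess k"] by (simp add: input_indices_def)

lemma count_rv [measurable]: "N \<in> measurable \<Omega> (count_space UNIV)"
proof -
  have [measurable]: "(\<lambda>\<omega>. real (N \<omega>)) \<in> borel_measurable \<Omega>"
    using input_rv[of Count] by (simp add: input_indices_def)
  have "(\<lambda>\<omega>. nat \<lfloor>real (N \<omega>)\<rfloor>) \<in> measurable \<Omega> (count_space UNIV)" by measurable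
  then show ?thesis by simp
qed

lemma base_law: "distr \<Omega> borel (M k) = FM"
  using input by (simp add: simulation_input_def)

lemma excess_law: "1 \<le> k \<Longrightarrow> distr \<Omega> borel (C k) = FC"
  using input by (simp add: simulation_input_def)

lemma count_law: "\<Omega>.prob {\<omega>\<in>space \<Omega>. N \<omega> = k} = (1 - a) * a ^ k"
  using input by (simp add: simulation_input_def)

lemma real_distribution_FM: "real_distribution FM"
  using \<Omega>.real_distribution_distr[OF base_rv[of 0]] by (simp only: base_law)

lemma real_distribution_FC: "real_distribution FC"
  using \<Omega>.real_distribution_distr[OF excess_rv[of 1]] by (simp only: excess_law order_refl)

section \<open>Laws of the partial sums\<close>

text \<open>The total of \<open>M 0, ..., M k\<close> and \<open>C 1, ..., C k\<close>, so that
  \<open>V\<close> is this sum at the random index \<open>N + 2\<close>. A single sum over input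
  indices lets joint independence apply directly.\<close>

definition partial_input :: "nat \<Rightarrow> 'a \<Rightarrow> real" where
  "partial_input k \<omega> = (\<Sum>i\<in>Base ` {..k} \<union> Excess ` {1..k}. input_var M C N i \<omega>)"

lemma partial_input_rv [measurable]: "partial_input k \<in> borel_measurable \<Omega>"
  unfolding partial_input_def[abs_def]
  by (intro borel_measurable_sum input_rv) (auto simp: input_indices_def)

lemma partial_input_eq: "partial_input k \<omega> = (\<Sum>i\<le>k. M i \<omega>) + (\<Sum>i=1..k. C i \<omega>)"
  unfolding partial_input_def
  by (subst sum.union_disjoint) (auto simp: sum.reindex inj_on_def)

lemma V_var_eq: "V_var M C N \<omega> = partial_input (N \<omega> + 2) \<omega>"
proof -
  have "(\<Sum>i\<le>k + 2. M i \<omega>) = M 0 \<omega> + M 1 \<omega> + (\<Sum>i=2..k + 2. M i \<omega>)"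
    and "(\<Sum>i=1..k + 2. C i \<omega>) = C 1 \<omega> + (\<Sum>i=2..k + 2. C i \<omega>)" for k
    by (induction k) (simp_all add: atLeastAtMostSuc_conv numeral_2_eq_2)
  then show ?thesis by (simp add: V_var_def partial_input_eq sum.distrib)
qed

lemma V_var_rv [measurable]: "V_var M C N \<in> borel_measurable \<Omega>"
proof -
  have "(\<lambda>\<omega>. partial_input (N \<omega> + 2) \<omega>) \<in> borel_measurable \<Omega>" by measurable
  then show ?thesis by (simp add: V_var_eq[abs_def])
qed

lemma Vn_var_rv [measurable]: "Vn_var n C N \<in> borel_measurable \<Omega>"
proof -
  have "(\<lambda>\<omega>. Max ((\<lambda>k. C k \<omega>) ` {1..m + 2})) \<in> borel_measurable \<Omega>" for m
    by (intro borel_measurable_Max excess_rv) auto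
  then have "(\<lambda>\<omega>. Max ((\<lambda>k. C k \<omega>) ` {1..N \<omega> + 2})) \<in> borel_measurable \<Omega>"
    by (rule measurable_compose_countable) (rule count_rv)
  then show ?thesis unfolding Vn_var_def[abs_def] by measurable
qed

text \<open>The two new inputs are added one at a time, each independent of what precedes. The
  convolution is then rearranged so that the step \<open>FM \<star> FC\<close> stands on the right,
  as Kesten's recursion expects.\<close>

lemma partial_input_law:
  "distr \<Omega> borel (partial_input 0) = FM"
  "distr \<Omega> borel (partial_input (Suc k)) = (distr \<Omega> borel (partial_input k) \<star> (FM \<star> FC))"
proof -
  have "partial_input 0 = M 0" by (simp add: partial_input_def fun_eq_iff)
  then show "distr \<Omega> borel (partial_input 0) = FM" by (simp add: base_law)
next
  let ?X = "input_var M C N" and ?J = "Base ` {..k} \<union> Excess ` {1..k}"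
  let ?I = "insert (Excess (Suc k)) ?J" and ?L = "distr \<Omega> borel (partial_input k)"
  note fin = real_distribution_FM real_distribution_FC \<Omega>.real_distribution_distr[OF partial_input_rv]
  note finm = fin[THEN real_distribution.axioms(1), THEN prob_space.finite_measure]
  note sets = fin[THEN real_distribution.events_eq_borel]
  have sub: "insert (Base (Suc k)) ?I \<subseteq> input_indices" by (auto simp: input_indices_def)
  have meas: "(\<lambda>\<omega>. \<Sum>i\<in>A. ?X i \<omega>) \<in> borel_measurable \<Omega>" if "A \<subseteq> input_indices" for A
    using that by (intro borel_measurable_sum input_rv) auto
  have "\<Omega>.indep_var borel (?X (Excess (Suc k))) borel (\<lambda>\<omega>. \<Sum>i\<in>?J. ?X i \<omega>)"
    by (intro \<Omega>.indep_vars_sum \<Omega>.indep_vars_subset[OF input_indep]) (use sub in auto)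
  then have "distr \<Omega> borel (\<lambda>\<omega>. ?X (Excess (Suc k)) \<omega> + (\<Sum>i\<in>?J. ?X i \<omega>))
      = (distr \<Omega> borel (?X (Excess (Suc k))) \<star> distr \<Omega> borel (\<lambda>\<omega>. \<Sum>i\<in>?J. ?X i \<omega>))"
    by (intro \<Omega>.sum_indep_random_variable input_rv meas) (use sub in auto)
  moreover have "(\<lambda>\<omega>. ?X (Excess (Suc k)) \<omega> + (\<Sum>i\<in>?J. ?X i \<omega>)) = (\<lambda>\<omega>. \<Sum>i\<in>?I. ?X i \<omega>)"
    by (subst sum.insert) auto
  ultimately have 1: "distr \<Omega> borel (\<lambda>\<omega>. \<Sum>i\<in>?I. ?X i \<omega>) = (FC \<star> ?L)"
    by (simp add: excess_law partial_input_def[abs_def])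
  have "\<Omega>.indep_var borel (?X (Base (Suc k))) borel (\<lambda>\<omega>. \<Sum>i\<in>?I. ?X i \<omega>)"
    by (intro \<Omega>.indep_vars_sum \<Omega>.indep_vars_subset[OF input_indep]) (use sub in auto)
  then have "distr \<Omega> borel (\<lambda>\<omega>. ?X (Base (Suc k)) \<omega> + (\<Sum>i\<in>?I. ?X i \<omega>))
      = (distr \<Omega> borel (?X (Base (Suc k))) \<star> distr \<Omega> borel (\<lambda>\<omega>. \<Sum>i\<in>?I. ?X i \<omega>))"
    by (intro \<Omega>.sum_indep_random_variable input_rv meas) (use sub in auto)
  moreover have "(\<lambda>\<omega>. ?X (Base (Suc k)) \<omega> + (\<Sum>i\<in>?I. ?X i \<omega>)) = partial_input (Suc k)"
  proof
    fix \<omega>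
    have "Base ` {..Suc k} \<union> Excess ` {1..Suc k} = insert (Base (Suc k)) ?I"
      by (auto simp: atMost_Suc atLeastAtMostSuc_conv)
    moreover have "Base (Suc k) \<notin> ?I" by auto
    ultimately show "?X (Base (Suc k)) \<omega> + (\<Sum>i\<in>?I. ?X i \<omega>) = partial_input (Suc k) \<omega>"
      unfolding partial_input_def by (metis (no_types, lifting) finite.insertI finite_UnI
          finite_atMost finite_atLeastAtMost finite_imageI sum.insert)
  qed
  ultimately have "distr \<Omega> borel (partial_input (Suc k)) = (FM \<star> (FC \<star> ?L))"
    using 1 by (simp add: base_law)
  also have "(FM \<star> (FC \<star> ?L)) = ((FM \<star> FC) \<star> ?L)"
    by (rule convolution_associative) (simp_all add: finm sets)
  also have "\<dots> = (?L \<star> (FM \<star> FC))"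
    by (rule convolution_commutative)
      (simp_all add: finm sets convolution_finite)
  finally show "distr \<Omega> borel (partial_input (Suc k)) = (?L \<star> (FM \<star> FC))" .
qed

lemma prob_count_partial_input:
  "\<Omega>.prob {\<omega>\<in>space \<Omega>. N \<omega> = m \<and> u < partial_input k \<omega>}
    = (1 - a) * a ^ m * tail (distr \<Omega> borel (partial_input k)) u"
proof -
  let ?X = "input_var M C N" and ?J = "Base ` {..k} \<union> Excess ` {1..k}"
  have "\<Omega>.indep_var borel (?X Count) borel (\<lambda>\<omega>. \<Sum>i\<in>?J. ?X i \<omega>)"
    by (intro \<Omega>.indep_vars_sum \<Omega>.indep_vars_subset[OF input_indep]) (auto simp: input_indices_def)
  then have "\<Omega>.indep_var borel (\<lambda>\<omega>. real (N \<omega>)) borel (partial_input k)"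
    by (simp add: partial_input_def[abs_def])
  then have "\<Omega>.prob ((\<lambda>\<omega>. (real (N \<omega>), partial_input k \<omega>)) -` ({real m} \<times> {u<..}) \<inter> space \<Omega>)
      = \<Omega>.prob ((\<lambda>\<omega>. real (N \<omega>)) -` {real m} \<inter> space \<Omega>) * \<Omega>.prob (partial_input k -` {u<..} \<inter> space \<Omega>)"
    by (intro \<Omega>.indep_varD) auto
  moreover have "(\<lambda>\<omega>. (real (N \<omega>), partial_input k \<omega>)) -` ({real m} \<times> {u<..}) \<inter> space \<Omega>
      = {\<omega>\<in>space \<Omega>. N \<omega> = m \<and> u < partial_input k \<omega>}" by auto
  moreover have "(\<lambda>\<omega>. real (N \<omega>)) -` {real m} \<inter> space \<Omega> = {\<omega>\<in>space \<Omega>. N \<omega> = m}" by auto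
  moreover have "\<Omega>.prob (partial_input k -` {u<..} \<inter> space \<Omega>) = tail (distr \<Omega> borel (partial_input k)) u"
    by (simp add: tail_eq_measure \<Omega>.real_distribution_distr measure_distr)
  ultimately show ?thesis by (simp add: count_law)
qed

lemma prob_V_sums:
  "(\<lambda>m. (1 - a) * a ^ m * tail (distr \<Omega> borel (partial_input (m + 2))) u)
    sums \<Omega>.prob {\<omega>\<in>space \<Omega>. u < V_var M C N \<omega>}"
proof -
  let ?A = "\<lambda>m. {\<omega>\<in>space \<Omega>. N \<omega> = m \<and> u < partial_input (m + 2) \<omega>}"
  have "(\<lambda>m. \<Omega>.prob (?A m)) sums \<Omega>.prob (\<Union>m. ?A m)"
    by (intro \<Omega>.finite_measure_UNION) (auto simp: disjoint_family_on_def)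
  moreover have "(\<Union>m. ?A m) = {\<omega>\<in>space \<Omega>. u < V_var M C N \<omega>}" by (auto simp: V_var_eq)
  ultimately show ?thesis by (simp add: prob_count_partial_input)
qed

text \<open>The complement within \<open>N = m\<close> is the product event that all
  \<open>m + 2\<close> excesses are at most \<open>u\<close>, to which independence applies.\<close>

lemma prob_count_max:
  "\<Omega>.prob {\<omega>\<in>space \<Omega>. N \<omega> = m \<and> u < Max ((\<lambda>k. C k \<omega>) ` {1..m + 2})}
    = (1 - a) * a ^ m * (1 - (1 - tail FC u) ^ (m + 2))"
proof -
  let ?X = "input_var M C N" and ?J = "insert Count (Excess ` {1..m + 2})"
  define A where "A i = (case i of Count \<Rightarrow> {real m} | _ \<Rightarrow> {..u})" for i
  have "\<Omega>.prob (\<Inter>i\<in>?J. ?X i -` A i \<inter> space \<Omega>) = (\<Prod>i\<in>?J. \<Omega>.prob (?X i -` A i \<inter> space \<Omega>))"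
    by (rule \<Omega>.indep_varsD[OF input_indep])
      (auto simp: input_indices_def A_def split: input_index.split)
  also have "\<dots> = \<Omega>.prob (?X Count -` A Count \<inter> space \<Omega>)
      * (\<Prod>i\<in>{1..m + 2}. \<Omega>.prob (?X (Excess i) -` A (Excess i) \<inter> space \<Omega>))"
    by (subst prod.insert) (auto simp: prod.reindex inj_on_def)
  also have "?X Count -` A Count \<inter> space \<Omega> = {\<omega>\<in>space \<Omega>. N \<omega> = m}" by (auto simp: A_def)
  also have "(\<Prod>i\<in>{1..m + 2}. \<Omega>.prob (?X (Excess i) -` A (Excess i) \<inter> space \<Omega>))
      = (\<Prod>i\<in>{1..m + 2}. 1 - tail FC u)"
  proof (rule prod.cong)
    fix i assume i: "i \<in> {1..m + 2}"
    then have "\<Omega>.prob (C i -` {..u} \<inter> space \<Omega>) = measure (distr \<Omega> borel (C i)) {..u}"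
      by (subst measure_distr) (auto intro: excess_rv)
    then show "\<Omega>.prob (?X (Excess i) -` A (Excess i) \<inter> space \<Omega>) = 1 - tail FC u"
      using i by (simp add: A_def excess_law measure_Iic[OF real_distribution_FC])
  qed simp
  finally have le: "\<Omega>.prob (\<Inter>i\<in>?J. ?X i -` A i \<inter> space \<Omega>) = (1 - a) * a ^ m * (1 - tail FC u) ^ (m + 2)"
    by (simp add: count_law)
  define E where "E = (\<Inter>i\<in>?J. ?X i -` A i \<inter> space \<Omega>)"
  have Max: "u < Max ((\<lambda>k. C k \<omega>) ` {1..m + 2}) \<longleftrightarrow> (\<exists>k\<in>{1..m + 2}. u < C k \<omega>)" for \<omega>
    by (subst Max_gr_iff) auto
  have "{\<omega>\<in>space \<Omega>. N \<omega> = m \<and> u < Max ((\<lambda>k. C k \<omega>) ` {1..m + 2})}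
      = {\<omega>\<in>space \<Omega>. N \<omega> = m} - E"
    unfolding Max E_def by (auto simp: A_def not_le)
  moreover have "E \<subseteq> {\<omega>\<in>space \<Omega>. N \<omega> = m}"
    by (auto simp: A_def E_def)
  moreover have "E \<in> sets \<Omega>" unfolding E_def
    by (intro sets.finite_INT measurable_sets[OF input_rv])
      (auto simp: input_indices_def A_def split: input_index.split)
  moreover have "{\<omega>\<in>space \<Omega>. N \<omega> = m} \<in> sets \<Omega>" by measurable
  ultimately have "\<Omega>.prob {\<omega>\<in>space \<Omega>. N \<omega> = m \<and> u < Max ((\<lambda>k. C k \<omega>) ` {1..m + 2})}
      = (1 - a) * a ^ m - (1 - a) * a ^ m * (1 - tail FC u) ^ (m + 2)"
    by (simp only: \<Omega>.finite_measure_Diff le[folded E_def] count_law)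
  then show ?thesis by (simp add: right_diff_distrib)
qed

text \<open>For \<open>N + 2 > n\<close> the control is 0, which does not exceed \<open>u\<close>
  because \<open>0 \<le> u\<close>. The remaining values of \<open>N\<close> are those below
  \<open>n - 1\<close>, none at all when \<open>n \<le> 1\<close>.\<close>

lemma prob_Vn:
  assumes u: "0 \<le> u"
  shows "\<Omega>.prob {\<omega>\<in>space \<Omega>. u < Vn_var n C N \<omega>}
    = (\<Sum>m<n - 1. (1 - a) * a ^ m * (1 - (1 - tail FC u) ^ (m + 2)))"
proof -
  let ?A = "\<lambda>m. {\<omega>\<in>space \<Omega>. N \<omega> = m \<and> u < Max ((\<lambda>k. C k \<omega>) ` {1..m + 2})}"
  have [measurable]: "(\<lambda>\<omega>. Max ((\<lambda>k. C k \<omega>) ` {1..m + 2})) \<in> borel_measurable \<Omega>" for m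
    by (intro borel_measurable_Max excess_rv) auto
  have A: "?A m \<in> sets \<Omega>" for m by measurable
  have "{\<omega>\<in>space \<Omega>. u < Vn_var n C N \<omega>} = (\<Union>m\<in>{..<n - 1}. ?A m)"
    using u by (auto simp: Vn_var_def split: if_splits)
  moreover have "\<Omega>.prob (\<Union>m\<in>{..<n - 1}. ?A m) = (\<Sum>m<n - 1. \<Omega>.prob (?A m))"
    by (intro \<Omega>.finite_measure_finite_Union image_subsetI A) (auto simp: disjoint_family_on_def)
  ultimately show ?thesis by (simp only: prob_count_max)
qed

text \<open>An excess above \<open>u\<close> is one of the almost surely nonnegative terms of
  \<open>V\<close>. This nesting makes \<open>q - p\<close> the probability that \<open>V\<close>
  exceeds while its control does not.\<close>

lemma Vn_exceeds_imp_V_exceeds: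
  assumes FM: "nonneg_law FM" and FC: "nonneg_law FC" and u: "0 \<le> u"
  shows "AE \<omega> in \<Omega>. u < Vn_var n C N \<omega> \<longrightarrow> u < V_var M C N \<omega>"
proof -
  have "AE \<omega> in \<Omega>. 0 \<le> M k \<omega>" for k
    by (rule distr_nonneg_AE) (simp_all add: base_law FM)
  then have Mn: "AE \<omega> in \<Omega>. \<forall>k. 0 \<le> M k \<omega>" by (simp add: AE_all_countable)
  have "AE \<omega> in \<Omega>. 0 \<le> C (Suc k) \<omega>" for k
    by (rule distr_nonneg_AE) (simp_all add: excess_law excess_rv FC)
  then have Cn: "AE \<omega> in \<Omega>. \<forall>k. 0 \<le> C (Suc k) \<omega>" by (simp add: AE_all_countable)
  show ?thesis
    using Mn Cn
  proof (eventually_elim, intro impI)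
    case (elim \<omega>)
    assume "u < Vn_var n C N \<omega>"
    then have "u < Max ((\<lambda>k. C k \<omega>) ` {1..N \<omega> + 2})"
      using u by (auto simp: Vn_var_def split: if_splits)
    then obtain k where k: "k \<in> {1..N \<omega> + 2}" "u < C k \<omega>" by (subst (asm) Max_gr_iff) auto
    have C: "0 \<le> C i \<omega>" if "i \<in> {1..N \<omega> + 2}" for i
      using elim(2)[rule_format, of "i - 1"] that by simp
    have "C k \<omega> \<le> (\<Sum>i=1..N \<omega> + 2. C i \<omega>)"
      by (rule member_le_sum[OF k(1)]) (use C in auto)
    moreover have "0 \<le> (\<Sum>i\<le>N \<omega> + 2. M i \<omega>)" using elim(1) by (intro sum_nonneg) auto
    ultimately show "u < V_var M C N \<omega>" using k(2) by (simp add: V_var_eq partial_input_eq)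
  qed
qed

section \<open>Asymptotics of the simulated variable and its control\<close>

context
  assumes a: "0 < a" "a < 1" and FC: "subexp FC" and FM: "nonneg_law FM"
    and light: "((\<lambda>u. tail FM u / tail FC u) \<longlongrightarrow> 0) at_top"
begin

lemma tail_partial_input_ratio:
  "((\<lambda>u. tail (distr \<Omega> borel (partial_input k)) u / tail FC u) \<longlongrightarrow> real k) at_top \<and>
    nonneg_law (distr \<Omega> borel (partial_input k))"
proof (induction k)
  case 0
  then show ?case using light FM by (simp add: partial_input_law(1))
next
  case (Suc k)
  have H: "nonneg_law (FM \<star> FC)" by (rule nonneg_law_convolution[OF FM subexpD(1)[OF FC]])
  have "((\<lambda>u. tail (distr \<Omega> borel (partial_input (Suc k))) u / tail FC u) \<longlongrightarrow> real k + 1) at_top"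
    unfolding partial_input_law(2)
    by (rule tail_convolution_ratio[OF FC _ H _ subexp_convolution(2)[OF FC FM light]])
      (use Suc in auto)
  moreover have "nonneg_law (distr \<Omega> borel (partial_input (Suc k)))"
    unfolding partial_input_law(2) by (rule nonneg_law_convolution[OF _ H]) (use Suc in auto)
  ultimately show ?case by (simp add: add.commute)
qed

theorem V_tail_ratio:
  "((\<lambda>u. \<Omega>.prob {\<omega>\<in>space \<Omega>. u < V_var M C N \<omega>} / tail FC u) \<longlongrightarrow> (2 - a) / (1 - a)) at_top"
proof -
  let ?L = "\<lambda>k. distr \<Omega> borel (partial_input k)"
  \<comment> \<open>Makes \<open>a * (1 + \<eta>)\<close> the midpoint \<open>(1 + a) / 2\<close> of
    \<open>a\<close> and 1, so that Kesten's growth is absorbed by the geometric weights.\<close>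
  define \<eta> where "\<eta> = (1 - a) / (2 * a)"
  have \<eta>: "0 < \<eta>" "a * (1 + \<eta>) = (1 + a) / 2" using a by (auto simp: \<eta>_def field_simps)
  note H = subexp_convolution[OF FC FM light]
  have "\<exists>K. \<forall>k u. tail (?L k) u \<le> K * (1 + \<eta>) ^ k * tail (FM \<star> FC) u"
    by (rule subexp_iterated_convolution_bound[OF H(1) \<eta>(1)])
      (simp_all add: partial_input_law H(3) \<Omega>.real_distribution_distr)
  then obtain K where K: "\<And>k u. tail (?L k) u \<le> K * (1 + \<eta>) ^ k * tail (FM \<star> FC) u" by blast
  define f where "f m u = (1 - a) * a ^ m * tail (?L (m + 2)) u / tail FC u" for m u
  define B where "B m = 2 * \<bar>K\<bar> * (1 + \<eta>)\<^sup>2 * ((1 + a) / 2) ^ m" for m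
  \<comment> \<open>Kesten's bound is relative to the step law \<open>FM \<star> FC\<close>; a
    factor 2 passes to \<open>FC\<close> from some level on, uniformly in \<open>m\<close>.\<close>
  have ev: "\<forall>\<^sub>F u in at_top. tail (FM \<star> FC) u / tail FC u < 2"
    using order_tendstoD(2)[OF H(2)] by simp
  have bound: "norm (f m u) \<le> B m" if u: "tail (FM \<star> FC) u / tail FC u < 2" for m u
  proof -
    have pos: "0 < tail FC u" "0 < tail (FM \<star> FC) u"
      using subexpD(3)[OF FC] subexpD(3)[OF H(1)] by auto
    have "tail (?L (m + 2)) u \<le> \<bar>K\<bar> * (1 + \<eta>) ^ (m + 2) * tail (FM \<star> FC) u"
      using pos \<eta>(1) by (intro order_trans[OF K] mult_right_mono) auto
    also have "\<dots> \<le> \<bar>K\<bar> * (1 + \<eta>) ^ (m + 2) * (2 * tail FC u)"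
      using pos \<eta>(1) u by (intro mult_left_mono) (auto simp: field_simps)
    finally have le: "tail (?L (m + 2)) u / tail FC u \<le> 2 * \<bar>K\<bar> * (1 + \<eta>) ^ (m + 2)"
      using pos by (simp add: field_simps)
    have nn: "0 \<le> tail (?L (m + 2)) u / tail FC u"
      using pos by (simp add: tail_nonneg \<Omega>.real_distribution_distr)
    have "0 \<le> (1 - a) * a ^ m * (tail (?L (m + 2)) u / tail FC u)"
      using a nn by (intro mult_nonneg_nonneg) auto
    then have "norm (f m u) = (1 - a) * a ^ m * (tail (?L (m + 2)) u / tail FC u)"
      unfolding f_def real_norm_def by (simp only: times_divide_eq_right abs_of_nonneg)
    also have "\<dots> \<le> 1 * a ^ m * (2 * \<bar>K\<bar> * (1 + \<eta>) ^ (m + 2))"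
      using a le nn by (intro mult_mono) auto
    also have "\<dots> = 2 * \<bar>K\<bar> * (1 + \<eta>)\<^sup>2 * (a * (1 + \<eta>)) ^ m"
      by (simp add: power_add power_mult_distrib power2_eq_square)
    finally show ?thesis unfolding \<eta>(2) B_def .
  qed
  have "((\<lambda>u. \<Sum>m. f m u) \<longlongrightarrow> (\<Sum>m. (1 - a) * a ^ m * real (m + 2))) at_top"
  proof (rule tannerys_theorem[THEN conjunct2, THEN conjunct2])
    fix m
    have "((\<lambda>u. (1 - a) * a ^ m * (tail (?L (m + 2)) u / tail FC u))
        \<longlongrightarrow> (1 - a) * a ^ m * real (m + 2)) at_top"
      using tail_partial_input_ratio by (intro tendsto_intros) blast
    then show "(f m \<longlongrightarrow> (1 - a) * a ^ m * real (m + 2)) at_top"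
      by (simp add: f_def[abs_def])
  next
    show "\<forall>\<^sub>F (m, u) in at_top \<times>\<^sub>F at_top. norm (f m u) \<le> B m"
      unfolding eventually_prod_filter
      by (rule exI[of _ "\<lambda>_. True"], rule exI[of _ "\<lambda>u. tail (FM \<star> FC) u / tail FC u < 2"])
        (use ev bound in auto)
    show "summable B" unfolding B_def[abs_def]
      using a by (intro summable_mult summable_geometric) auto
  qed simp
  \<comment> \<open>The mean of \<open>N + 2\<close>. Splitting \<open>m + 2\<close> as
    \<open>Suc m + 1\<close> leaves the derived geometric series and the geometric series
    itself.\<close>
  moreover have "(\<lambda>m. (1 - a) * a ^ m * real (m + 2)) sums ((2 - a) / (1 - a))"
  proof -
    have "(\<lambda>m. (1 - a) * (real (Suc m) * a ^ m + a ^ m)) sums ((1 - a) * (1 / (1 - a)\<^sup>2 + 1 / (1 - a)))"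
      using a by (intro sums_mult sums_add geometric_deriv_sums geometric_sums) auto
    moreover have "(1 - a) * (1 / (1 - a)\<^sup>2 + 1 / (1 - a)) = (2 - a) / (1 - a)"
    proof -
      have "(1 - a) * (1 / (1 - a)\<^sup>2 + 1 / (1 - a)) = 1 / (1 - a) + 1"
        using a by (simp add: distrib_left power2_eq_square)
      also have "\<dots> = (2 - a) / (1 - a)" using a by (simp add: field_simps)
      finally show ?thesis .
    qed
    ultimately show ?thesis by (simp add: algebra_simps)
  qed
  moreover have "(\<Sum>m. f m u) = \<Omega>.prob {\<omega>\<in>space \<Omega>. u < V_var M C N \<omega>} / tail FC u" for u
    unfolding f_def by (rule sums_unique[symmetric, OF sums_divide[OF prob_V_sums]])
  ultimately show ?thesis by (simp add: sums_iff)
qed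

text \<open>The quotient of \<open>1 - (1 - x) ^ k\<close> by \<open>x\<close> is a geometric sum
  with limit \<open>k\<close> as \<open>x\<close> tends to 0. With finitely many values of
  \<open>N\<close> no domination is required.\<close>

lemma Vn_tail_ratio:
  "((\<lambda>u. \<Omega>.prob {\<omega>\<in>space \<Omega>. u < Vn_var n C N \<omega>} / tail FC u)
    \<longlongrightarrow> (\<Sum>m<n - 1. (1 - a) * a ^ m * real (m + 2))) at_top"
proof -
  note pos = subexpD(3)[OF FC]
  have geo: "(1 - (1 - x) ^ k) / x = (\<Sum>i<k. (1 - x) ^ i)" if "x \<noteq> 0" for x :: real and k
    using sum_gp_strict[of "1 - x" k] that by simp
  have "((\<lambda>u. \<Sum>m<n - 1. (1 - a) * a ^ m * (\<Sum>i<m + 2. (1 - tail FC u) ^ i))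
      \<longlongrightarrow> (\<Sum>m<n - 1. (1 - a) * a ^ m * (\<Sum>i<m + 2. (1 - 0) ^ i))) at_top"
    by (intro tendsto_intros tail_tendsto_0 real_distribution_FC)
  moreover have "\<forall>\<^sub>F u in at_top. (\<Sum>m<n - 1. (1 - a) * a ^ m * (\<Sum>i<m + 2. (1 - tail FC u) ^ i))
      = \<Omega>.prob {\<omega>\<in>space \<Omega>. u < Vn_var n C N \<omega>} / tail FC u"
    using eventually_ge_at_top[of 0]
  proof eventually_elim
    case (elim u)
    have "tail FC u \<noteq> 0" using pos[of u] by simp
    then show ?case
      unfolding prob_Vn[OF elim] sum_divide_distrib
      by (intro sum.cong refl) (subst geo[symmetric], simp_all only: times_divide_eq_right not_False_eq_True)
  qed
  ultimately show ?thesis by (subst (asm) tendsto_cong) (auto elim: filterlim_mono_eventually)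
qed

end

end

text \<open>The left side is the mean of \<open>N + 2\<close> restricted to
  \<open>N + 2 > n\<close>. The induction starts at \<open>n = 1\<close>, where nothing is
  subtracted from the full mean.\<close>

lemma geometric_tail_identity:
  fixes a :: real
  assumes "a \<noteq> 1" "1 \<le> n"
  shows "(2 - a) / (1 - a) - (\<Sum>m<n - 1. (1 - a) * a ^ m * real (m + 2))
    = a ^ (n - 1) * ((1 + real n * (1 - a)) / (1 - a))"
  using assms(2)
proof (induction n rule: dec_induct)
  case (step n)
  then obtain k where "n = Suc k" by (cases n) auto
  with step.IH assms(1) show ?case by (simp add: field_simps)
qed (use assms(1) in \<open>simp add: field_simps\<close>)

section \<open>Variance of the control variate estimator\<close>

lemma sample_mean_indicator:
  assumes "A \<subseteq> {1..\<kappa>}"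
  shows "sample_mean \<kappa> (\<lambda>i. s * of_bool (i \<in> A)) = s * real (card A) / real \<kappa>"
proof -
  have "(\<Sum>i=1..\<kappa>. s * of_bool (i \<in> A)) = (\<Sum>i=1..\<kappa>. if i \<in> A then s else 0)"
    by (intro sum.cong) auto
  also have "\<dots> = (\<Sum>i\<in>{1..\<kappa>} \<inter> A. s)" by (simp only: sum.inter_restrict finite_atLeastAtMost)
  also have "\<dots> = s * real (card A)" using assms by (simp add: Int_absorb1 mult.commute)
  finally show ?thesis by (simp add: sample_mean_def)
qed

text \<open>When no control exceeds \<open>u\<close> the quotient is 0/0, which is 0, and the
  estimator reduces to the plain sample mean.\<close>

lemma no_variation: "sample_mean \<kappa> (\<lambda>_. 0) = 0" "cv_coefficient \<kappa> z (\<lambda>_. 0) = 0"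
  by (simp_all add: cv_coefficient_def sample_mean_def)

section \<open>From sample configurations to the variance\<close>

text \<open>The deterministic core: \<open>A\<close> and \<open>B\<close> stand for the samples
  whose \<open>V\<close>, respectively \<open>Vn\<close>, exceeds \<open>u\<close>. In the error,
  \<open>\<phi> * real (card A)\<close> pays for a single joint exceedance, where the estimator
  equals \<open>\<phi>\<close>, and the product pays for two or more exceedances, being 0
  otherwise.\<close>

lemma cv_estimator_bounds:
  fixes s :: real
  assumes s: "0 < s" and \<kappa>: "2 \<le> \<kappa>"
  obtains K where "0 \<le> K"
    "\<And>A B \<phi> e. \<lbrakk>B \<subseteq> A; A \<subseteq> {1..\<kappa>}; 0 \<le> \<phi>; \<phi> \<le> s;
        e = cv_estimator \<kappa> (\<lambda>i. s * of_bool (i \<in> A)) (\<lambda>i. s * of_bool (i \<in> B)) \<phi>\<rbrakk>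
      \<Longrightarrow> \<bar>e\<bar> \<le> K * real (card A) \<and>
        \<bar>e\<^sup>2 - (s / real \<kappa>)\<^sup>2 * real (card (A - B))\<bar>
          \<le> K * (\<phi> * real (card A) + real (card A) * (real (card A) - 1))"
proof -
  define x where "x A i = s * of_bool (i \<in> A)" for A :: "nat set" and i
  define I where "I = {1..\<kappa>}"
  \<comment> \<open>Only finitely many pairs of subsets occur, so the coefficient is bounded
    although its denominator has no evident lower bound.\<close>
  define c where "c = Max ((\<lambda>(A, B). \<bar>cv_coefficient \<kappa> (x A) (x B)\<bar>) ` (Pow I \<times> Pow I))"
  have c: "\<bar>cv_coefficient \<kappa> (x A) (x B)\<bar> \<le> c" if "A \<subseteq> I" "B \<subseteq> I" for A B
    unfolding c_def by (rule Max_ge) (use that in \<open>auto simp: I_def\<close>)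
  have c0: "0 \<le> c" using c[of "{}" "{}"] by simp
  have mean: "sample_mean \<kappa> (x A) = s * real (card A) / real \<kappa>" if "A \<subseteq> I" for A
    unfolding x_def by (rule sample_mean_indicator) (use that in \<open>simp add: I_def\<close>)
  have card: "real (card A) \<le> real \<kappa>" if "A \<subseteq> I" for A
    using card_mono[of I A] that by (simp add: I_def)
  have mean_bounds: "0 \<le> sample_mean \<kappa> (x A)" "sample_mean \<kappa> (x A) \<le> s" if "A \<subseteq> I" for A
    using mult_left_mono[OF card[OF that], of s] s \<kappa> unfolding mean[OF that]
    by (auto simp: pos_divide_le_eq)
  define b where "b = s + c * (2 * s)"
  have b: "0 \<le> b" using s c0 by (simp add: b_def)
  \<comment> \<open>Large enough for all cases: \<open>b\<close> and
    \<open>b\<^sup>2 + s\<^sup>2\<close> serve the crude bounds for two or more exceedances,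
    \<open>s\<close> serves a single one.\<close>
  define K where "K = b + b\<^sup>2 + s + s\<^sup>2"
  have K: "0 \<le> K" "b \<le> K" "b\<^sup>2 + s\<^sup>2 \<le> K" "s \<le> K" using b s by (auto simp: K_def)
  show thesis
  proof (rule that[OF K(1)])
    fix A B \<phi> e
    assume BA: "B \<subseteq> A" and A: "A \<subseteq> {1..\<kappa>}" and \<phi>: "0 \<le> \<phi>" "\<phi> \<le> s"
      and e0: "e = cv_estimator \<kappa> (\<lambda>i. s * of_bool (i \<in> A)) (\<lambda>i. s * of_bool (i \<in> B)) \<phi>"
    have AI: "A \<subseteq> I" "B \<subseteq> I" using A BA by (auto simp: I_def)
    have fin: "finite A" using A by (rule finite_subset) simp
    have e: "e = sample_mean \<kappa> (x A) + cv_coefficient \<kappa> (x A) (x B) * (sample_mean \<kappa> (x B) - \<phi>)"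
      unfolding e0 cv_estimator_def x_def ..
    have x_empty: "x {} = (\<lambda>_. 0)" by (simp add: x_def fun_eq_iff)
    consider "card A = 0" | "card A = 1" "B = {}" | "card A = 1" "B \<noteq> {}" | "2 \<le> card A" by linarith
    then show "\<bar>e\<bar> \<le> K * real (card A) \<and>
        \<bar>e\<^sup>2 - (s / real \<kappa>)\<^sup>2 * real (card (A - B))\<bar>
          \<le> K * (\<phi> * real (card A) + real (card A) * (real (card A) - 1))"
    proof cases
      case 1
      then have "A = {}" "B = {}" using fin BA by auto
      then have "e = 0" by (simp add: e x_empty no_variation)
      then show ?thesis using \<open>A = {}\<close> by simp
    next
      case 2
      then have "e = s / real \<kappa>" unfolding e by (simp add: mean[OF AI(1)] x_empty no_variation)
      moreover have "s / real \<kappa> \<le> K" using s \<kappa> K(4) divide_left_mono[of 1 "real \<kappa>" s] by simp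
      ultimately show ?thesis using 2 s \<phi> K(1) by simp
    next
      case 3
      then obtain i where i: "A = {i}" by (auto simp: card_1_singleton_iff)
      then have B: "B = A" using BA 3 by auto
      \<comment> \<open>The second index, available as \<open>\<kappa> \<ge> 2\<close>, has value 0
        and hence lies away from the sample mean, so the denominator is positive.\<close>
      obtain j where j: "j \<in> I" "j \<noteq> i"
        using \<kappa> by (intro that[of "if i = 1 then 2 else 1"]) (auto simp: I_def)
      have "0 < (\<Sum>k=1..\<kappa>. (x A k - sample_mean \<kappa> (x A))\<^sup>2)"
      proof (rule sum_pos2[where i = j])
        show "0 < (x A j - sample_mean \<kappa> (x A))\<^sup>2"
          using j s \<kappa> by (simp add: mean[OF AI(1)]) (simp add: x_def i)
      qed (use j in \<open>auto simp: I_def\<close>)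
      \<comment> \<open>The controls coincide with the samples, so the regression is exact and the
        two sample means cancel.\<close>
      then have "cv_coefficient \<kappa> (x A) (x A) = -1"
        by (simp add: cv_coefficient_def power2_eq_square)
      then have e\<phi>: "e = \<phi>" unfolding e B by simp
      have "\<phi>\<^sup>2 \<le> K * \<phi>" using \<phi> K(4) unfolding power2_eq_square by (intro mult_right_mono) auto
      then show ?thesis using 3(1) \<phi> K(4) by (simp add: e\<phi> B)
    next
      case 4
      have "\<bar>sample_mean \<kappa> (x B) - \<phi>\<bar> \<le> 2 * s" using mean_bounds[OF AI(2)] \<phi> by linarith
      then have "\<bar>cv_coefficient \<kappa> (x A) (x B) * (sample_mean \<kappa> (x B) - \<phi>)\<bar> \<le> c * (2 * s)"
        unfolding abs_mult using c[OF AI] c0 by (intro mult_mono) auto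
      then have eb: "\<bar>e\<bar> \<le> b" unfolding e b_def using mean_bounds[OF AI(1)] by linarith
      have "b * 1 \<le> K * real (card A)" using K b 4 by (intro mult_mono) auto
      moreover have "\<bar>e\<^sup>2 - (s / real \<kappa>)\<^sup>2 * real (card (A - B))\<bar> \<le> b\<^sup>2 + s\<^sup>2"
      proof -
        have "e\<^sup>2 \<le> b\<^sup>2" using eb b by (simp add: abs_le_square_iff[symmetric])
        moreover have "(s / real \<kappa>)\<^sup>2 * real (card (A - B)) \<le> (s / real \<kappa>)\<^sup>2 * (real \<kappa> * real \<kappa>)"
          using card[of "A - B"] AI \<kappa> by (intro mult_left_mono order_trans[OF card]) auto
        moreover have "(s / real \<kappa>)\<^sup>2 * (real \<kappa> * real \<kappa>) = s\<^sup>2"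
          using \<kappa> by (simp add: power2_eq_square)
        moreover have "0 \<le> (s / real \<kappa>)\<^sup>2 * real (card (A - B))" by simp
        moreover have "0 \<le> e\<^sup>2" "0 \<le> b\<^sup>2" "0 \<le> s\<^sup>2" by simp_all
        ultimately show ?thesis by linarith
      qed
      moreover have "K * 1 \<le> K * (\<phi> * real (card A) + real (card A) * (real (card A) - 1))"
      proof (rule mult_left_mono[OF _ K(1)])
        have "1 * 1 \<le> real (card A) * (real (card A) - 1)" using 4 by (intro mult_mono) auto
        moreover have "0 \<le> \<phi> * real (card A)" using \<phi> by simp
        ultimately show "1 \<le> \<phi> * real (card A) + real (card A) * (real (card A) - 1)" by linarith
      qed
      ultimately show ?thesis using eb K(3) by linarith
    qed
  qed
qed

text \<open>With \<open>q\<close> small, at most one of the events occurs up to a probability of order \<open>q\<^sup>2\<close>, so the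
  variance is the second moment collected on the events \<open>E i\<close>.\<close>
lemma (in prob_space) variance_rare_events:
  fixes f :: "'a \<Rightarrow> real" and I :: "'i set"
  assumes I: "finite I" and A: "\<And>i. i \<in> I \<Longrightarrow> A i \<in> events" "\<And>i. i \<in> I \<Longrightarrow> prob (A i) = q"
    and pair: "\<And>i j. i \<in> I \<Longrightarrow> j \<in> I \<Longrightarrow> i \<noteq> j \<Longrightarrow> prob (A i \<inter> A j) = q\<^sup>2"
    and E: "\<And>i. i \<in> I \<Longrightarrow> E i \<in> events" "\<And>i. i \<in> I \<Longrightarrow> prob (E i) = r"
    and K: "0 \<le> K" and [measurable]: "f \<in> borel_measurable M"
    and bound: "AE \<omega> in M. \<bar>f \<omega>\<bar> \<le> K * (\<Sum>i\<in>I. indicator (A i) \<omega>)"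
    and square: "AE \<omega> in M. \<bar>(f \<omega>)\<^sup>2 - c * (\<Sum>i\<in>I. indicator (E i) \<omega>)\<bar>
        \<le> K * (q * (\<Sum>i\<in>I. indicator (A i) \<omega>)
          + (\<Sum>i\<in>I. indicator (A i) \<omega>) * ((\<Sum>i\<in>I. indicator (A i) \<omega>) - 1))"
  shows "\<bar>variance f - c * (real (card I) * r)\<bar>
    \<le> (K * real (card I) + K * (real (card I))\<^sup>2 + (K * real (card I))\<^sup>2) * q\<^sup>2"
proof -
  define n where "n \<omega> = (\<Sum>i\<in>I. indicator (A i) \<omega> :: real)" for \<omega>
  define m where "m \<omega> = (\<Sum>i\<in>I. \<Sum>j\<in>I - {i}. indicator (A i \<inter> A j) \<omega> :: real)" for \<omega>
  define g where "g \<omega> = (\<Sum>i\<in>I. indicator (E i) \<omega> :: real)" for \<omega>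
  let ?k = "real (card I)"
  \<comment> \<open>The product \<open>n \<omega> * (n \<omega> - 1)\<close> counts ordered pairs of
    distinct events, so its expectation involves only pairwise intersections, each of probability
    \<open>q\<^sup>2\<close>.\<close>
  have nm: "n \<omega> * (n \<omega> - 1) = m \<omega>" for \<omega>
  proof -
    have "n \<omega> * n \<omega> = (\<Sum>i\<in>I. \<Sum>j\<in>I. indicator (A i \<inter> A j) \<omega>)"
      by (simp add: n_def sum_product indicator_inter_arith)
    also have "\<dots> = (\<Sum>i\<in>I. indicator (A i) \<omega> + (\<Sum>j\<in>I - {i}. indicator (A i \<inter> A j) \<omega>))"
      using I by (intro sum.cong refl) (simp add: sum.remove)
    finally show ?thesis by (simp add: sum.distrib n_def m_def algebra_simps)
  qed
  have int: "integrable M (indicator B :: 'a \<Rightarrow> real)" if "B \<in> events" for B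
    using that by (intro integrable_real_indicator) (auto simp: emeasure_eq_measure)
  have intn: "integrable M n" and intm: "integrable M m" and intg: "integrable M g"
    unfolding n_def[abs_def] m_def[abs_def] g_def[abs_def] using A(1) E(1)
    by (auto intro!: Bochner_Integration.integrable_sum int)
  have expect: "expectation (indicator B :: 'a \<Rightarrow> real) = prob B" if "B \<in> events" for B
    using that by simp
  have En: "expectation n = ?k * q" and Eg: "expectation g = ?k * r"
    unfolding n_def[abs_def] g_def[abs_def] using A E
    by (subst Bochner_Integration.integral_sum, auto intro!: int)+
  have Aij: "A i \<inter> A j \<in> events" if "i \<in> I" "j \<in> I" for i j using A(1) that by auto
  have "expectation m = (\<Sum>i\<in>I. \<Sum>j\<in>I - {i}. expectation (indicator (A i \<inter> A j)))"
    unfolding m_def[abs_def] using A(1)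
    by (subst Bochner_Integration.integral_sum, (intro Bochner_Integration.integrable_sum int Aij; simp))
      (intro sum.cong refl Bochner_Integration.integral_sum int Aij; simp)
  also have "\<dots> = (\<Sum>i\<in>I. \<Sum>j\<in>I - {i}. q\<^sup>2)"
    by (intro sum.cong refl, subst expect) (auto simp: pair intro!: Aij)
  also have "\<dots> \<le> (\<Sum>i\<in>I. \<Sum>j\<in>I. q\<^sup>2)"
    using I by (intro sum_mono sum_mono2) auto
  finally have Em: "expectation m \<le> ?k\<^sup>2 * q\<^sup>2" by (simp add: power2_eq_square)
  have n_le: "n \<omega> \<le> ?k" for \<omega>
    unfolding n_def using sum_bounded_above[of I "\<lambda>i. indicator (A i) \<omega>" "1::real"] by simp
  have fb: "AE \<omega> in M. \<bar>f \<omega>\<bar> \<le> K * ?k"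
    using bound by eventually_elim
      (use n_le K in \<open>auto simp: n_def intro: order_trans mult_left_mono\<close>)
  have intf: "integrable M f" by (rule integrable_const_bound[of _ "K * ?k"]) (use fb in auto)
  have "AE \<omega> in M. norm ((f \<omega>)\<^sup>2) \<le> (K * ?k)\<^sup>2"
    using fb by eventually_elim (simp add: abs_le_square_iff[symmetric] K)
  then have intf2: "integrable M (\<lambda>\<omega>. (f \<omega>)\<^sup>2)" by (rule integrable_const_bound) simp
  \<comment> \<open>The mean is of order \<open>q\<close>, hence its square belongs to the error and
    the variance may be replaced by the second moment.\<close>
  have "\<bar>expectation f\<bar> \<le> expectation (\<lambda>\<omega>. \<bar>f \<omega>\<bar>)" by (rule integral_abs_bound)
  also have "\<dots> \<le> expectation (\<lambda>\<omega>. K * n \<omega>)"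
  proof (rule integral_mono_AE)
    show "AE \<omega> in M. \<bar>f \<omega>\<bar> \<le> K * n \<omega>" using bound by (simp add: n_def)
  qed (use intf intn in auto)
  also have "\<dots> = K * ?k * q" by (simp add: En)
  finally have "(expectation f)\<^sup>2 \<le> (K * ?k * q)\<^sup>2"
    by (metis abs_ge_zero abs_le_square_iff abs_of_nonneg order_trans)
  then have Ef: "(expectation f)\<^sup>2 \<le> (K * ?k)\<^sup>2 * q\<^sup>2" by (simp add: power_mult_distrib)
  have "\<bar>expectation (\<lambda>\<omega>. (f \<omega>)\<^sup>2 - c * g \<omega>)\<bar> \<le> expectation (\<lambda>\<omega>. \<bar>(f \<omega>)\<^sup>2 - c * g \<omega>\<bar>)"
    by (rule integral_abs_bound)
  also have "\<dots> \<le> expectation (\<lambda>\<omega>. K * (q * n \<omega> + m \<omega>))"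
  proof (rule integral_mono_AE)
    show "AE \<omega> in M. \<bar>(f \<omega>)\<^sup>2 - c * g \<omega>\<bar> \<le> K * (q * n \<omega> + m \<omega>)"
      using square by (simp add: nm[symmetric] n_def g_def)
  qed (use intf2 intg intn intm in auto)
  also have "\<dots> = K * (q * (?k * q) + expectation m)" using intn intm by (simp add: En)
  also have "\<dots> \<le> K * (q * (?k * q) + ?k\<^sup>2 * q\<^sup>2)" using K Em by (intro mult_left_mono) auto
  finally have Ef2: "\<bar>expectation (\<lambda>\<omega>. (f \<omega>)\<^sup>2) - c * (?k * r)\<bar> \<le> (K * ?k + K * ?k\<^sup>2) * q\<^sup>2"
    using intf2 intg by (simp add: Eg algebra_simps power2_eq_square)
  have "variance f = expectation (\<lambda>\<omega>. (f \<omega>)\<^sup>2) - (expectation f)\<^sup>2"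
    by (rule variance_eq[OF intf intf2])
  then have "\<bar>variance f - c * (?k * r)\<bar> \<le> (K * ?k + K * ?k\<^sup>2) * q\<^sup>2 + (K * ?k)\<^sup>2 * q\<^sup>2"
    using Ef2 Ef zero_le_power2[of "expectation f"] by linarith
  then show ?thesis by (simp add: algebra_simps)
qed

text \<open>The constant does not depend on \<open>u\<close>, so the quadratic error stays
  negligible as \<open>q u\<close> tends to 0 for growing \<open>u\<close>.\<close>

theorem cv_variance_bounds:
  fixes V Vn :: "'a \<Rightarrow> real" and V' Vn' :: "nat \<Rightarrow> 'b \<Rightarrow> real"
  assumes \<Omega>: "prob_space \<Omega>" and V: "V \<in> borel_measurable \<Omega>" "Vn \<in> borel_measurable \<Omega>"
    and imp: "\<And>u. 0 \<le> u \<Longrightarrow> AE \<omega> in \<Omega>. u < Vn \<omega> \<longrightarrow> u < V \<omega>"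
    and copies: "iid_copies \<Omega> V Vn \<Omega>' \<kappa> V' Vn'" and \<kappa>: "2 \<le> \<kappa>" and a: "0 < a"
  defines "q \<equiv> \<lambda>u. measure \<Omega> {\<omega>\<in>space \<Omega>. u < V \<omega>}"
    and "p \<equiv> \<lambda>u. measure \<Omega> {\<omega>\<in>space \<Omega>. u < Vn \<omega>}"
  obtains K where
    "\<And>u. 0 \<le> u \<Longrightarrow> \<bar>prob_space.variance \<Omega>' (phi_hat \<kappa> a (phi_n \<Omega> a Vn) V' Vn' u)
        - a ^ 4 / real \<kappa> * (q u - p u)\<bar> \<le> K * (q u)\<^sup>2"
    "\<And>u. 0 \<le> u \<Longrightarrow> \<bar>prob_space.variance \<Omega>' (z_hat \<kappa> a V' u) - a ^ 4 / real \<kappa> * q u\<bar> \<le> K * (q u)\<^sup>2"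
proof -
  interpret \<Omega>: prob_space \<Omega> by fact
  interpret \<Omega>': prob_space \<Omega>' using copies by (simp add: iid_copies_def)
  note [measurable] = V
  define I where "I = {1..\<kappa>}"
  have indep: "\<Omega>'.indep_vars (\<lambda>_. borel \<Otimes>\<^sub>M borel) (\<lambda>i \<omega>. (V' i \<omega>, Vn' i \<omega>)) I"
    and law: "\<And>i. i \<in> I \<Longrightarrow> distr \<Omega>' (borel \<Otimes>\<^sub>M borel) (\<lambda>\<omega>. (V' i \<omega>, Vn' i \<omega>)) =
                 distr \<Omega> (borel \<Otimes>\<^sub>M borel) (\<lambda>\<omega>. (V \<omega>, Vn \<omega>))"
    using copies by (auto simp: iid_copies_def I_def)
  have rv: "(\<lambda>\<omega>. (V' i \<omega>, Vn' i \<omega>)) \<in> measurable \<Omega>' (borel \<Otimes>\<^sub>M borel)" if "i \<in> I" for i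
    using indep that by (simp add: \<Omega>'.indep_vars_def)
  have V'_rv: "V' i \<in> borel_measurable \<Omega>'" "Vn' i \<in> borel_measurable \<Omega>'" if "i \<in> I" for i
    using measurable_compose[OF rv[OF that] measurable_fst]
      measurable_compose[OF rv[OF that] measurable_snd] by simp_all
  \<comment> \<open>The joint law of the pair is needed, since the events compare a sample with its
    own control.\<close>
  have transfer: "\<Omega>'.prob {\<omega>\<in>space \<Omega>'. Q (V' i \<omega>) (Vn' i \<omega>)} = \<Omega>.prob {\<omega>\<in>space \<Omega>. Q (V \<omega>) (Vn \<omega>)}"
    if i: "i \<in> I" and Q: "{x \<in> space (borel \<Otimes>\<^sub>M borel). Q (fst x) (snd x)} \<in> sets (borel \<Otimes>\<^sub>M borel)"
    for i Q
  proof -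
    let ?S = "{x \<in> space (borel \<Otimes>\<^sub>M borel). Q (fst x) (snd x)}"
    have "measure (distr \<Omega>' (borel \<Otimes>\<^sub>M borel) (\<lambda>\<omega>. (V' i \<omega>, Vn' i \<omega>))) ?S
        = measure (distr \<Omega> (borel \<Otimes>\<^sub>M borel) (\<lambda>\<omega>. (V \<omega>, Vn \<omega>))) ?S" by (simp only: law[OF i])
    moreover have "(\<lambda>\<omega>. (V \<omega>, Vn \<omega>)) \<in> measurable \<Omega> (borel \<Otimes>\<^sub>M borel)" by measurable
    ultimately show ?thesis
      using rv[OF i] Q by (simp add: measure_distr vimage_def Int_def space_pair_measure conj_commute)
  qed
  define s where "s = a\<^sup>2"
  have s: "0 < s" using a by (simp add: s_def)
  obtain K where K: "0 \<le> K"
    "\<And>A B \<phi> e. \<lbrakk>B \<subseteq> A; A \<subseteq> {1..\<kappa>}; 0 \<le> \<phi>; \<phi> \<le> s;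
        e = cv_estimator \<kappa> (\<lambda>i. s * of_bool (i \<in> A)) (\<lambda>i. s * of_bool (i \<in> B)) \<phi>\<rbrakk>
      \<Longrightarrow> \<bar>e\<bar> \<le> K * real (card A) \<and>
        \<bar>e\<^sup>2 - (s / real \<kappa>)\<^sup>2 * real (card (A - B))\<bar>
          \<le> K * (\<phi> * real (card A) + real (card A) * (real (card A) - 1))"
    using cv_estimator_bounds[OF s \<kappa>] by metis
  \<comment> \<open>Enlarged so that one constant serves both estimators: \<open>K * s\<close>
    absorbs the factor between \<open>\<phi>\<close> and \<open>q u\<close>, while \<open>s\<close>
    and its square are for crude Monte Carlo.\<close>
  define L where "L = K * (1 + s) + s + s\<^sup>2"
  have "0 \<le> K * s" using K(1) s by simp
  then have L: "0 \<le> L" "K \<le> L" "K * s \<le> L" "s \<le> L" "s\<^sup>2 \<le> L"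
    using K(1) s by (auto simp: L_def distrib_left)
  define K' where "K' = L * real \<kappa> + L * (real \<kappa>)\<^sup>2 + (L * real \<kappa>)\<^sup>2"
  have cardI: "card I = \<kappa>" and finI: "finite I" by (simp_all add: I_def)
  have const: "(s / real \<kappa>)\<^sup>2 * (real (card I) * t) = a ^ 4 / real \<kappa> * t" for t
    using \<kappa> by (simp add: s_def cardI power2_eq_square eval_nat_numeral)
  have exceed: "scaled_exceedance a u v = s * of_bool (u < v)" for u v
    by (simp add: scaled_exceedance_def s_def indicator_def)
  have restrict: "sample_mean \<kappa> (\<lambda>i. s * of_bool (P i)) = sample_mean \<kappa> (\<lambda>i. s * of_bool (i \<in> {i\<in>I. P i}))"
    for P by (simp add: sample_mean_def I_def)
  have count: "(\<Sum>i\<in>I. indicator {\<omega>\<in>space \<Omega>'. P i \<omega>} \<omega>) = real (card {i\<in>I. P i \<omega>})"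
    if "\<omega> \<in> space \<Omega>'" for P :: "nat \<Rightarrow> 'b \<Rightarrow> bool" and \<omega>
    using that by (simp add: indicator_def I_def sum.If_cases Int_def)
  show thesis
  proof (rule that[of K'])
    fix u :: real assume u: "0 \<le> u"
    let ?A = "\<lambda>i. {\<omega>\<in>space \<Omega>'. u < V' i \<omega>}"
    let ?E = "\<lambda>i. {\<omega>\<in>space \<Omega>'. u < V' i \<omega> \<and> \<not> u < Vn' i \<omega>}"
    have A: "?A i \<in> \<Omega>'.events" "?E i \<in> \<Omega>'.events" if "i \<in> I" for i
      using V'_rv[OF that] by measurable
    have qA: "\<Omega>'.prob (?A i) = q u" if "i \<in> I" for i
      unfolding q_def by (rule transfer[OF that]) measurable
    have "\<Omega>'.prob (?E i) = \<Omega>.prob {\<omega>\<in>space \<Omega>. u < V \<omega> \<and> \<not> u < Vn \<omega>}" if "i \<in> I" for i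
      by (rule transfer[OF that]) measurable
    moreover have "\<Omega>.prob {\<omega>\<in>space \<Omega>. u < V \<omega> \<and> \<not> u < Vn \<omega>} = q u - p u"
    proof -
      have "\<Omega>.prob {\<omega>\<in>space \<Omega>. u < V \<omega> \<and> u < Vn \<omega>} = p u"
        unfolding p_def using imp[OF u] by (intro \<Omega>.finite_measure_eq_AE) auto
      moreover have "{\<omega>\<in>space \<Omega>. u < V \<omega> \<and> \<not> u < Vn \<omega>}
          = {\<omega>\<in>space \<Omega>. u < V \<omega>} - {\<omega>\<in>space \<Omega>. u < V \<omega> \<and> u < Vn \<omega>}" by auto
      ultimately show ?thesis unfolding q_def
        by (simp add: \<Omega>.finite_measure_Diff subset_eq)
    qed
    ultimately have rE: "\<Omega>'.prob (?E i) = q u - p u" if "i \<in> I" for i using that by simp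
    have pair: "\<Omega>'.prob (?A i \<inter> ?A j) = (q u)\<^sup>2" if ij: "i \<in> I" "j \<in> I" "i \<noteq> j" for i j
    proof -
      let ?X = "\<lambda>i \<omega>. (V' i \<omega>, Vn' i \<omega>)" and ?S = "{u<..} \<times> (UNIV :: real set)"
      have "\<Omega>'.prob (\<Inter>k\<in>{i, j}. ?X k -` ?S \<inter> space \<Omega>') = (\<Prod>k\<in>{i, j}. \<Omega>'.prob (?X k -` ?S \<inter> space \<Omega>'))"
        using ij by (intro \<Omega>'.indep_varsD[OF indep]) auto
      moreover have "?X k -` ?S \<inter> space \<Omega>' = ?A k" for k by auto
      ultimately show ?thesis using ij by (simp add: qA power2_eq_square)
    qed
    have subset: "AE \<omega> in \<Omega>'. \<forall>i\<in>I. u < Vn' i \<omega> \<longrightarrow> u < V' i \<omega>"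
    proof (rule AE_finite_allI)
      fix i assume i: "i \<in> I"
      have "\<Omega>'.prob {\<omega>\<in>space \<Omega>'. u < Vn' i \<omega> \<longrightarrow> u < V' i \<omega>}
          = \<Omega>.prob {\<omega>\<in>space \<Omega>. u < Vn \<omega> \<longrightarrow> u < V \<omega>}"
        by (rule transfer[OF i]) measurable
      also have "\<dots> = 1" using imp[OF u] by (subst \<Omega>.prob_eq_1) auto
      finally have "AE \<omega> in \<Omega>'. \<omega> \<in> {\<omega>\<in>space \<Omega>'. u < Vn' i \<omega> \<longrightarrow> u < V' i \<omega>}"
        by (rule \<Omega>'.AE_prob_1)
      then show "AE \<omega> in \<Omega>'. u < Vn' i \<omega> \<longrightarrow> u < V' i \<omega>" by eventually_elim auto
    qed (simp add: I_def)
    define \<phi> where "\<phi> = phi_n \<Omega> a Vn u"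
    have "\<phi> = (\<integral>\<omega>. s * indicator {\<omega>\<in>space \<Omega>. u < Vn \<omega>} \<omega> \<partial>\<Omega>)"
      unfolding \<phi>_def phi_n_def
      by (intro Bochner_Integration.integral_cong) (auto simp: exceed indicator_def)
    then have \<phi>_eq: "\<phi> = s * p u" by (simp add: p_def)
    have pq: "p u \<le> q u"
      unfolding p_def q_def using imp[OF u] by (intro \<Omega>.finite_measure_mono_AE) auto
    \<comment> \<open>The mean of the control is of order \<open>q u\<close>; this turns the
      \<open>\<phi>\<close> in the deterministic error into the \<open>q\<close> that
      \<open>variance_rare_events\<close> asks for.\<close>
    have \<phi>: "0 \<le> \<phi>" "\<phi> \<le> s" "\<phi> \<le> s * q u"
      using s pq by (auto simp: \<phi>_eq p_def mult_left_le)
    have est: "phi_hat \<kappa> a (phi_n \<Omega> a Vn) V' Vn' u \<omega>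
        = cv_estimator \<kappa> (\<lambda>i. s * of_bool (i \<in> {i\<in>I. u < V' i \<omega>}))
            (\<lambda>i. s * of_bool (i \<in> {i\<in>I. u < Vn' i \<omega>})) \<phi>" for \<omega>
      unfolding phi_hat_def exceed cv_estimator_def cv_coefficient_def \<phi>_def[symmetric] restrict[symmetric]
      by (simp add: I_def)
    have meas1: "phi_hat \<kappa> a (phi_n \<Omega> a Vn) V' Vn' u \<in> borel_measurable \<Omega>'"
    proof -
      have [measurable]: "V' i \<in> borel_measurable \<Omega>'" "Vn' i \<in> borel_measurable \<Omega>'" if "i \<in> {1..\<kappa>}" for i
        using V'_rv[of i] that by (simp_all add: I_def)
      show ?thesis
        unfolding phi_hat_def[abs_def] cv_estimator_def cv_coefficient_def sample_mean_def scaled_exceedance_def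
        by measurable
    qed
    have key: "AE \<omega> in \<Omega>'. \<bar>phi_hat \<kappa> a (phi_n \<Omega> a Vn) V' Vn' u \<omega>\<bar>
          \<le> K * (\<Sum>i\<in>I. indicator (?A i) \<omega>) \<and>
        \<bar>(phi_hat \<kappa> a (phi_n \<Omega> a Vn) V' Vn' u \<omega>)\<^sup>2 - (s / real \<kappa>)\<^sup>2 * (\<Sum>i\<in>I. indicator (?E i) \<omega>)\<bar>
        \<le> K * (\<phi> * (\<Sum>i\<in>I. indicator (?A i) \<omega>)
          + (\<Sum>i\<in>I. indicator (?A i) \<omega>) * ((\<Sum>i\<in>I. indicator (?A i) \<omega>) - 1))"
      using subset AE_space
    proof eventually_elim
      case (elim \<omega>)
      have "{i\<in>I. u < V' i \<omega> \<and> \<not> u < Vn' i \<omega>} = {i\<in>I. u < V' i \<omega>} - {i\<in>I. u < Vn' i \<omega>}" by auto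
      then show ?case
        unfolding count[OF elim(2)]
        using K(2)[OF _ _ \<phi>(1,2) est[of \<omega>]] elim(1) by (auto simp: I_def subset_eq)
    qed
    have nn: "0 \<le> (\<Sum>i\<in>I. indicator (?A i) \<omega> :: real)"
      "0 \<le> (\<Sum>i\<in>I. indicator (?A i) \<omega>) * ((\<Sum>i\<in>I. indicator (?A i) \<omega> :: real) - 1)"
      if "\<omega> \<in> space \<Omega>'" for \<omega>
    proof -
      have "0 \<le> real m * (real m - 1)" for m by (cases m) auto
      then show "0 \<le> (\<Sum>i\<in>I. indicator (?A i) \<omega>) * ((\<Sum>i\<in>I. indicator (?A i) \<omega> :: real) - 1)"
        unfolding count[OF that] by blast
    qed (simp add: sum_nonneg)
    have "\<bar>\<Omega>'.variance (phi_hat \<kappa> a (phi_n \<Omega> a Vn) V' Vn' u) - (s / real \<kappa>)\<^sup>2 * (real (card I) * (q u - p u))\<bar>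
        \<le> (L * real (card I) + L * (real (card I))\<^sup>2 + (L * real (card I))\<^sup>2) * (q u)\<^sup>2"
    proof (rule \<Omega>'.variance_rare_events[where A = ?A and E = ?E])
      show "AE \<omega> in \<Omega>'. \<bar>phi_hat \<kappa> a (phi_n \<Omega> a Vn) V' Vn' u \<omega>\<bar> \<le> L * (\<Sum>i\<in>I. indicator (?A i) \<omega>)"
        using key AE_space
      proof eventually_elim
        case (elim \<omega>)
        then show ?case using mult_right_mono[OF L(2) nn(1)[OF elim(2)]] by linarith
      qed
      show "AE \<omega> in \<Omega>'. \<bar>(phi_hat \<kappa> a (phi_n \<Omega> a Vn) V' Vn' u \<omega>)\<^sup>2
          - (s / real \<kappa>)\<^sup>2 * (\<Sum>i\<in>I. indicator (?E i) \<omega>)\<bar>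
        \<le> L * (q u * (\<Sum>i\<in>I. indicator (?A i) \<omega>)
          + (\<Sum>i\<in>I. indicator (?A i) \<omega>) * ((\<Sum>i\<in>I. indicator (?A i) \<omega>) - 1))"
        using key AE_space
      proof eventually_elim
        case (elim \<omega>)
        define n where "n = (\<Sum>i\<in>I. indicator (?A i) \<omega> :: real)"
        have n: "0 \<le> n" "0 \<le> n * (n - 1)" using nn[OF elim(2)] by (simp_all add: n_def)
        have "K * \<phi> \<le> K * (s * q u)" using \<phi>(3) K(1) by (rule mult_left_mono)
        also have "\<dots> \<le> L * q u" using L(3) by (simp add: mult.assoc[symmetric] mult_right_mono q_def)
        finally have "K * \<phi> * n + K * (n * (n - 1)) \<le> L * q u * n + L * (n * (n - 1))"
          using n L(2) by (intro add_mono mult_right_mono)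
        then show ?case using elim(1) unfolding n_def[symmetric] by (simp add: algebra_simps)
      qed
    qed (simp_all only: finI A qA rE pair L(1) meas1 simp_thms)
    then show "\<bar>\<Omega>'.variance (phi_hat \<kappa> a (phi_n \<Omega> a Vn) V' Vn' u) - a ^ 4 / real \<kappa> * (q u - p u)\<bar>
        \<le> K' * (q u)\<^sup>2"
      unfolding const by (simp add: K'_def cardI)
    have z: "z_hat \<kappa> a V' u \<omega> = s / real \<kappa> * (\<Sum>i\<in>I. indicator (?A i) \<omega>)" if "\<omega> \<in> space \<Omega>'" for \<omega>
      unfolding z_hat_def exceed count[OF that]
      by (subst restrict, subst sample_mean_indicator) (auto simp: I_def)
    have meas2: "z_hat \<kappa> a V' u \<in> borel_measurable \<Omega>'"
    proof -
      have [measurable]: "V' i \<in> borel_measurable \<Omega>'" if "i \<in> {1..\<kappa>}" for i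
        using V'_rv[of i] that by (simp_all add: I_def)
      show ?thesis
        unfolding z_hat_def[abs_def] sample_mean_def scaled_exceedance_def by measurable
    qed
    have s\<kappa>: "s / real \<kappa> \<le> s" "(s / real \<kappa>)\<^sup>2 \<le> s\<^sup>2"
      using s \<kappa> divide_left_mono[of 1 "real \<kappa>" s] by (auto intro!: power_mono)
    \<comment> \<open>The same lemma with \<open>E\<close> equal to \<open>A\<close>. The square of
      the number of exceedances differs from that number exactly by the pair count.\<close>
    have "\<bar>\<Omega>'.variance (z_hat \<kappa> a V' u) - (s / real \<kappa>)\<^sup>2 * (real (card I) * q u)\<bar>
        \<le> (L * real (card I) + L * (real (card I))\<^sup>2 + (L * real (card I))\<^sup>2) * (q u)\<^sup>2"
    proof (rule \<Omega>'.variance_rare_events[where A = ?A and E = ?A])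
      show "AE \<omega> in \<Omega>'. \<bar>z_hat \<kappa> a V' u \<omega>\<bar> \<le> L * (\<Sum>i\<in>I. indicator (?A i) \<omega>)"
        using AE_space
      proof eventually_elim
        case (elim \<omega>)
        have "s / real \<kappa> \<le> L" using s\<kappa>(1) L(4) by linarith
        from mult_right_mono[OF this nn(1)[OF elim]] show ?case
          using s nn(1)[OF elim] by (simp add: z[OF elim] abs_mult)
      qed
      show "AE \<omega> in \<Omega>'. \<bar>(z_hat \<kappa> a V' u \<omega>)\<^sup>2 - (s / real \<kappa>)\<^sup>2 * (\<Sum>i\<in>I. indicator (?A i) \<omega>)\<bar>
        \<le> L * (q u * (\<Sum>i\<in>I. indicator (?A i) \<omega>)
          + (\<Sum>i\<in>I. indicator (?A i) \<omega>) * ((\<Sum>i\<in>I. indicator (?A i) \<omega>) - 1))"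
        using AE_space
      proof eventually_elim
        case (elim \<omega>)
        define n where "n = (\<Sum>i\<in>I. indicator (?A i) \<omega> :: real)"
        have n: "0 \<le> n" "0 \<le> n * (n - 1)" using nn[OF elim] by (simp_all add: n_def)
        have "(z_hat \<kappa> a V' u \<omega>)\<^sup>2 - (s / real \<kappa>)\<^sup>2 * n = (s / real \<kappa>)\<^sup>2 * (n * (n - 1))"
          unfolding z[OF elim] n_def[symmetric] 
          by (simp only: power_mult_distrib power2_eq_square[of n] right_diff_distrib mult_1_right)
        moreover have "(s / real \<kappa>)\<^sup>2 * (n * (n - 1)) \<le> L * (n * (n - 1))"
          using s\<kappa>(2) L(5) n(2) by (intro mult_right_mono) auto
        moreover have "0 \<le> L * (q u * n)" using L(1) n(1) by (simp add: q_def)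
        moreover have "0 \<le> (s / real \<kappa>)\<^sup>2 * (n * (n - 1))" using n(2) by simp
        ultimately show ?case unfolding n_def[symmetric] by (simp add: distrib_left)
      qed
    qed (simp_all only: finI A qA pair L(1) meas2 simp_thms)
    then show "\<bar>\<Omega>'.variance (z_hat \<kappa> a V' u) - a ^ 4 / real \<kappa> * q u\<bar> \<le> K' * (q u)\<^sup>2"
      unfolding const by (simp add: K'_def cardI)
  qed
qed

section \<open>Assembling the limits\<close>

text \<open>With a mean that is negative or 0 (division by 0 giving 0) the density would be at most
  0, and its conversion by \<open>ennreal\<close> would leave total mass 0.\<close>

lemma mean_pos_of_stationary_excess:
  assumes "real_distribution F" "real_distribution (stationary_excess F)"
  shows "0 < mean F"
proof (rule ccontr)
  assume "\<not> 0 < mean F"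
  then have "indicator {0..} x * ((1 - cdf F x) / mean F) \<le> 0" for x
    using real_distribution.cdf_bounded_prob[OF assms(1), of x]
    by (auto simp: indicator_def divide_nonneg_nonpos)
  then have "stationary_excess F = density lborel (\<lambda>_. 0)"
    unfolding stationary_excess_def by (simp add: ennreal_neg)
  then have "emeasure (stationary_excess F) (space (stationary_excess F)) = 0"
    by (simp add: emeasure_density)
  then show False
    using prob_space.emeasure_space_1[OF real_distribution.axioms(1)[OF assms(2)]] by simp
qed

text \<open>Relative to \<open>F\<close>, the error is \<open>(q u / F u)\<^sup>2 * F u\<close> up
  to a constant: a convergent factor times one that tends to 0.\<close>

lemma tendsto_ratio_quadratic_error:
  fixes v g q F :: "real \<Rightarrow> real"
  assumes F: "\<And>u. 0 < F u" "(F \<longlongrightarrow> 0) at_top"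
    and q: "((\<lambda>u. q u / F u) \<longlongrightarrow> c) at_top"
    and g: "((\<lambda>u. g u / F u) \<longlongrightarrow> l) at_top"
    and bound: "\<And>u. 0 \<le> u \<Longrightarrow> \<bar>v u - g u\<bar> \<le> K * (q u)\<^sup>2"
  shows "((\<lambda>u. v u / F u) \<longlongrightarrow> l) at_top"
proof -
  have "((\<lambda>u. K * (q u / F u)\<^sup>2 * F u) \<longlongrightarrow> K * c\<^sup>2 * 0) at_top"
    by (intro tendsto_intros q F)
  then have err: "((\<lambda>u. K * (q u / F u)\<^sup>2 * F u) \<longlongrightarrow> 0) at_top" by simp
  have "((\<lambda>u. v u / F u - g u / F u) \<longlongrightarrow> 0) at_top"
  proof (rule Lim_null_comparison[OF _ err])
    show "\<forall>\<^sub>F u in at_top. norm (v u / F u - g u / F u) \<le> K * (q u / F u)\<^sup>2 * F u"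
      using eventually_ge_at_top[of 0]
    proof eventually_elim
      case (elim u)
      have "norm (v u / F u - g u / F u) = \<bar>v u - g u\<bar> / F u"
        using F(1)[of u] by (simp add: diff_divide_distrib[symmetric])
      also have "\<dots> \<le> K * (q u)\<^sup>2 / F u"
        using F(1)[of u] bound[OF elim] by (intro divide_right_mono) auto
      also have "\<dots> = K * (q u / F u)\<^sup>2 * F u"
        using F(1)[of u] by (simp add: power2_eq_square)
      finally show ?case .
    qed
  qed
  from tendsto_add[OF this g] show ?thesis by simp
qed

theorem theorem3p4:
  fixes \<epsilon> rate \<delta> \<theta> \<rho>p \<rho> :: real
    and Fp Fh :: "real measure"
    and S :: "'s set" and \<Delta> :: 's and \<alpha> :: "'s \<Rightarrow> real"
    and P :: "'s \<Rightarrow> 'p measure" and X :: "real \<Rightarrow> 'p \<Rightarrow> 's"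
    and Q :: "'q measure" and T Y :: "nat \<Rightarrow> 'q \<Rightarrow> real" and Mp :: "'q \<Rightarrow> real"
    and \<Omega> :: "'a measure" and M C :: "nat \<Rightarrow> 'a \<Rightarrow> real" and N :: "'a \<Rightarrow> nat"
    and \<Omega>' :: "'b measure" and V' Vn' :: "nat \<Rightarrow> 'b \<Rightarrow> real"
    and n \<kappa> :: nat
  assumes eps: "0 < \<epsilon>" "\<epsilon> < 1"
    and rate: "0 < rate"
    and Fp: "phase_type S \<Delta> \<alpha> P X Fp" "integrable Fp (\<lambda>x. x)"
    and Fh: "subexponential Fh" "integrable Fh (\<lambda>x. x)"
    and Fhe: "subexponential (stationary_excess Fh)"
    and delta: "\<delta> = rate * mean Fp"
    and theta: "\<theta> = rate * mean Fh"
    and rhop: "\<rho>p = (1 - \<epsilon>) * \<delta>"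
    and rho: "\<rho> = \<rho>p + \<epsilon> * \<theta>"
    and safety: "\<rho> < 1"
    and base_model: "compound_poisson_model Q ((1 - \<epsilon>) * rate) Fp T Y"
    and base_sup: "surplus_supremum Q T Y Mp"
    and input: "simulation_input \<Omega> (distr Q borel Mp) (stationary_excess Fh)
                  (\<epsilon> * \<theta> / (1 - \<rho>p)) M C N"
    and copies: "iid_copies \<Omega> (V_var M C N) (Vn_var n C N) \<Omega>' \<kappa> V' Vn'"
    and n: "1 \<le> n"
    and kappa: "2 \<le> \<kappa>"
  shows "ratio_equiv
      (\<lambda>u. prob_space.variance \<Omega>'
             (phi_hat \<kappa> (\<epsilon> * \<theta> / (1 - \<rho>p))
                (phi_n \<Omega> (\<epsilon> * \<theta> / (1 - \<rho>p)) (Vn_var n C N)) V' Vn' u))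
      (\<lambda>u. (\<epsilon> * \<theta> / (1 - \<rho>p)) ^ (n + 3)
             * ((1 + real n * ((1 - \<rho>) / (1 - \<rho>p))) / ((1 - \<rho>) / (1 - \<rho>p)))
             * (tail (stationary_excess Fh) u / real \<kappa>))
    \<and>
    ((\<lambda>u. prob_space.variance \<Omega>'
             (phi_hat \<kappa> (\<epsilon> * \<theta> / (1 - \<rho>p))
                (phi_n \<Omega> (\<epsilon> * \<theta> / (1 - \<rho>p)) (Vn_var n C N)) V' Vn' u)
           / prob_space.variance \<Omega>' (z_hat \<kappa> (\<epsilon> * \<theta> / (1 - \<rho>p)) V' u))
       \<longlongrightarrow> (\<epsilon> * \<theta> / (1 - \<rho>p)) ^ (n - 1)
             * ((1 + real n * ((1 - \<rho>) / (1 - \<rho>p))) / (1 + (1 - \<rho>) / (1 - \<rho>p)))) at_top"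
proof -
  define a where "a = \<epsilon> * \<theta> / (1 - \<rho>p)"
  define b where "b = (1 - \<rho>) / (1 - \<rho>p)"
  define FM where "FM = distr Q borel Mp"
  define FC where "FC = stationary_excess Fh"
  have FC: "subexp FC" unfolding FC_def by (rule subexponential_imp_subexp[OF Fhe])
  note rdFC = subexpD(2)[OF FC] and posFC = subexpD(3)[OF FC]
  have "0 < mean Fh"
    using rdFC subexpD(2)[OF subexponential_imp_subexp[OF Fh(1)]] unfolding FC_def
    by (intro mean_pos_of_stationary_excess)
  then have \<epsilon>\<theta>: "0 < \<epsilon> * \<theta>" using eps rate theta by simp
  have \<rho>p: "\<epsilon> * \<theta> < 1 - \<rho>p" using rho safety by simp
  have a: "0 < a" "a < 1" using \<epsilon>\<theta> \<rho>p by (auto simp: a_def)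
  have b: "b = 1 - a" using \<epsilon>\<theta> \<rho>p rho by (simp add: a_def b_def field_simps)
  obtain K c where c: "0 < c" "\<And>x. 0 \<le> x \<Longrightarrow> tail Fp x \<le> K * exp (- c * x)"
    using phase_type_exponential_tail[OF Fp(1)] by metis
  \<comment> \<open>Safety loading of the full model gives that of the base model, because
    \<open>\<epsilon> * \<theta>\<close> is positive.\<close>
  have \<beta>: "0 < (1 - \<epsilon>) * rate" "(1 - \<epsilon>) * rate * mean Fp < 1"
    using eps rate delta rhop \<epsilon>\<theta> \<rho>p by (auto simp: mult.assoc)
  note base = surplus_supremum_exponential_tail[OF base_model base_sup \<beta>(1) Fp(2) \<beta>(2) c,
      folded FM_def]
  have FM: "nonneg_law FM" by (rule base(1))
  obtain \<gamma> K' where \<gamma>: "0 < \<gamma>" "\<And>u. tail FM u \<le> K' * exp (- \<gamma> * u)" using base(2) by blast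
  have light: "((\<lambda>u. tail FM u / tail FC u) \<longlongrightarrow> 0) at_top"
    by (rule exp_bounded_tail_negligible[OF FC nonneg_lawD(1)[OF FM] \<gamma>])
  have inp: "simulation_input \<Omega> FM FC a M C N" using input by (simp add: FM_def FC_def a_def)
  let ?V = "V_var M C N" and ?Vn = "Vn_var n C N"
  define q where "q u = measure \<Omega> {\<omega>\<in>space \<Omega>. u < ?V \<omega>}" for u
  define p where "p u = measure \<Omega> {\<omega>\<in>space \<Omega>. u < ?Vn \<omega>}" for u
  define v where "v u = prob_space.variance \<Omega>' (phi_hat \<kappa> a (phi_n \<Omega> a ?Vn) V' Vn' u)" for u
  define w where "w u = prob_space.variance \<Omega>' (z_hat \<kappa> a V' u)" for u
  have "prob_space \<Omega>" using inp by (simp add: simulation_input_def)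
  then have "\<exists>K. (\<forall>u\<ge>0. \<bar>v u - a ^ 4 / real \<kappa> * (q u - p u)\<bar> \<le> K * (q u)\<^sup>2) \<and>
      (\<forall>u\<ge>0. \<bar>w u - a ^ 4 / real \<kappa> * q u\<bar> \<le> K * (q u)\<^sup>2)"
    unfolding v_def w_def q_def p_def
  proof (rule cv_variance_bounds[OF _ V_var_rv[OF inp] Vn_var_rv[OF inp] _ copies kappa a(1)])
    fix u :: real assume "0 \<le> u"
    then show "AE \<omega> in \<Omega>. u < ?Vn \<omega> \<longrightarrow> u < ?V \<omega>"
      by (rule Vn_exceeds_imp_V_exceeds[OF inp FM subexpD(1)[OF FC]])
  qed blast
  then obtain K where K: "\<And>u. 0 \<le> u \<Longrightarrow> \<bar>v u - a ^ 4 / real \<kappa> * (q u - p u)\<bar> \<le> K * (q u)\<^sup>2"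
    "\<And>u. 0 \<le> u \<Longrightarrow> \<bar>w u - a ^ 4 / real \<kappa> * q u\<bar> \<le> K * (q u)\<^sup>2"
    by blast
  have q: "((\<lambda>u. q u / tail FC u) \<longlongrightarrow> (2 - a) / (1 - a)) at_top"
    unfolding q_def by (rule V_tail_ratio[OF inp a FC FM light])
  have p: "((\<lambda>u. p u / tail FC u) \<longlongrightarrow> (\<Sum>m<n - 1. (1 - a) * a ^ m * real (m + 2))) at_top"
    unfolding p_def by (rule Vn_tail_ratio[OF inp a FC FM light])
  have split: "a ^ 4 / real \<kappa> * (q u - p u) / tail FC u
      = a ^ 4 / real \<kappa> * (q u / tail FC u - p u / tail FC u)" for u
    by (simp only: diff_divide_distrib[symmetric] times_divide_eq_right)
  have "((\<lambda>u. a ^ 4 / real \<kappa> * (q u - p u) / tail FC u)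
      \<longlongrightarrow> a ^ 4 / real \<kappa> * (a ^ (n - 1) * ((1 + real n * b) / b))) at_top"
    unfolding split b geometric_tail_identity[OF less_imp_neq[OF a(2)] n, symmetric]
    by (intro tendsto_mult tendsto_diff tendsto_const q p)
  then have v: "((\<lambda>u. v u / tail FC u) \<longlongrightarrow> a ^ 4 / real \<kappa> * (a ^ (n - 1) * ((1 + real n * b) / b))) at_top"
    by (rule tendsto_ratio_quadratic_error[OF posFC tail_tendsto_0[OF rdFC] q _ K(1)])
  have "((\<lambda>u. a ^ 4 / real \<kappa> * (q u / tail FC u)) \<longlongrightarrow> a ^ 4 / real \<kappa> * ((1 + b) / b)) at_top"
    using q by (intro tendsto_mult tendsto_const) (simp add: b)
  then have w: "((\<lambda>u. w u / tail FC u) \<longlongrightarrow> a ^ 4 / real \<kappa> * ((1 + b) / b)) at_top"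
    by (intro tendsto_ratio_quadratic_error[OF posFC tail_tendsto_0[OF rdFC] q _ K(2)]) simp
  have b0: "0 < b" using a b by simp
  define D where "D = a ^ 4 / real \<kappa> * (a ^ (n - 1) * ((1 + real n * b) / b))"
  have "0 < 1 + real n * b" using b0 by (simp add: add_pos_nonneg)
  then have D: "D \<noteq> 0" using a b0 kappa by (simp add: D_def)
  \<comment> \<open>The exponents add up to \<open>n + 3\<close> because \<open>1 \<le> n\<close>
    makes the natural subtraction exact.\<close>
  have "a ^ 4 * a ^ (n - 1) = a ^ (n + 3)" using n by (simp add: power_add[symmetric] add.commute)
  then have D_eq: "a ^ (n + 3) * ((1 + real n * b) / b) * (t / real \<kappa>) = D * t" for t
    unfolding D_def by (simp add: mult_ac flip: \<open>a ^ 4 * a ^ (n - 1) = a ^ (n + 3)\<close>)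
  have "((\<lambda>u. (v u / tail FC u) / D) \<longlongrightarrow> D / D) at_top"
    using v D unfolding D_def by (intro tendsto_divide tendsto_const)
  then have "((\<lambda>u. v u / (a ^ (n + 3) * ((1 + real n * b) / b) * (tail FC u / real \<kappa>))) \<longlongrightarrow> 1) at_top"
    unfolding D_eq using D by (simp add: mult.commute)
  moreover have "((\<lambda>u. v u / w u) \<longlongrightarrow> a ^ (n - 1) * ((1 + real n * b) / (1 + b))) at_top"
  proof -
    have "((\<lambda>u. (v u / tail FC u) / (w u / tail FC u))
        \<longlongrightarrow> (a ^ 4 / real \<kappa> * (a ^ (n - 1) * ((1 + real n * b) / b))) / (a ^ 4 / real \<kappa> * ((1 + b) / b))) at_top"
      using a b0 kappa by (intro tendsto_divide v w) auto
    moreover have "(v u / tail FC u) / (w u / tail FC u) = v u / w u" for u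
      using posFC[of u] by simp
    moreover have "(a ^ 4 / real \<kappa> * (a ^ (n - 1) * ((1 + real n * b) / b))) / (a ^ 4 / real \<kappa> * ((1 + b) / b))
        = a ^ (n - 1) * ((1 + real n * b) / (1 + b))"
    proof -
      have "x * (y * (z / b)) / (x * (t / b)) = y * (z / t)" if "x \<noteq> 0" for x y z t :: real
        using that b0 by simp
      then show ?thesis using a kappa by simp
    qed
    ultimately show ?thesis by (simp only:)
  qed
  ultimately show ?thesis
    unfolding ratio_equiv_def v_def w_def a_def b_def FC_def by blast
qed

end
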